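(* Let $d\ge 1$, let $X=(X_t)_{t\ge0}$ be a Lévy process on $\mathbf{R}^d$ with $L^2$-generator $\mathsf{L}$ and transition densities $p(t,x,y)$, let $u_0:\mathbf{R}^d\to\mathbf{R}_+$ be non-random, bounded and measurable, let $\lambda\in\mathbf{R}$, let $\nu$ be a Lévy measure on $\mathbf{R}^d$, and let $N$ be a Poisson random measure on $\mathbf{R}_+\times\mathbf{R}^d\times\mathbf{R}^d$ with intensity $dt\,dx\,\nu(dh)$. Let $\sigma:\mathbf{R}\times\mathbf{R}^d\to\mathbf{R}$ be measurable and suppose there exist a positive function $J:\mathbf{R}^d\to(0,\infty)$ and finite positive constants $\mathrm{Lip}_\sigma$ and $K$ such that for all $x,y\in\mathbf{R}$ and $h\in\mathbf{R}^d$ $$|\sigma(0,h)|\le J(h),\qquad |\sigma(x,h)-\sigma(y,h)|\le J(h)\,\mathrm{Lip}_\sigma|x-y|,\qquad \int_{\mathbf{R}^d}J(h)\,\nu(dh)\le K.$$ Let $u=\{u(t,x)\}_{t>0,x\in\mathbf{R}^d}$ be the unique random field solution of $$\Big[\frac{\partial u}{\partial t}(t,x)-\mathsf{L}u(t,x)\Big]dx\,dt=\lambda\int_{\mathbf{R}^d}\sigma(u(t,x),h)\,N(dh,dx,dt),\qquad u(0,x)=u_0(x).$$ Then for each $x\in\mathbf{R}^d$, $u$ is mean continuous in time: for every $t_2>0$, $$\lim_{t_1\uparrow t_2}E|u(t_2,x)-u(t_1,x)|=0,$$ and the function $t\mapsto E[|u(t,x)|]$ is continuous on $(0,\infty)$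.
   Context: The kernel $p(t,x,y)$ is the transition density of $X$: $E^x[f(X_t)]=\int_{\mathbf{R}^d}p(t,x,y)f(y)\,dy$ for measurable $f:\mathbf{R}^d\to\mathbf{R}_+$. A Lévy measure $\nu$ on $\mathbf{R}^d$ satisfies $\int_{\mathbf{R}^d}(1\wedge |h|^2)\,\nu(dh)<\infty$. $\{\mathcal F_t\}$ is the filtration generated by $N$, augmented by null sets. For $\{\mathcal F_t\}$-predictable $f(s,x,h)$ with $\int_0^t\int\int E|f(s,x,h)|\,ds\,dx\,\nu(dh)<\infty$, the integral $\int_0^t\int\int f\,dN$ is the almost surely absolutely convergent sum of the values of $f$ over the atoms of $N$ with time coordinate at most $t$. A (predictable) process $u$ is a mild solution of the equation if, almost surely, $$u(t,x)=\int_{\mathbf{R}^d}p(t,x,y)u_0(y)\,dy+\lambda\int_0^t\int_{\mathbf{R}^d}\int_{\mathbf{R}^d}p(t-s,x,y)\,\sigma(u(s,y),h)\,N(dh,dy,ds).$$ It is a random field solution if in addition $\sup_{0<t\le T}\sup_{x\in\mathbf{R}^d}E|u(t,x)|<\infty$ for all $T>0$. Uniqueness is up to modification. *)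

theory Defs
  imports "HOL-Probability.Probability"
begin

section \<open>Levy processes and their transition densities\<close>

(* Levy process indexed by [0,infinity), in the stochastically continuous form.  Regularity of the
   paths is not demanded: only the law of the process matters for the transition densities, and
   a cadlag version always exists. *)
definition levy_process :: "'v measure \<Rightarrow> (real \<Rightarrow> 'v \<Rightarrow> 'a::euclidean_space) \<Rightarrow> bool" where
  "levy_process P X \<longleftrightarrow>
     prob_space P \<and>
     (\<forall>t\<ge>0. X t \<in> borel_measurable P) \<and>
     (AE \<omega> in P. X 0 \<omega> = 0) \<and>
     (\<forall>n (\<tau>::nat \<Rightarrow> real). 0 \<le> \<tau> 0 \<and> (\<forall>i<n. \<tau> i \<le> \<tau> (Suc i)) \<longrightarrow>
        prob_space.indep_vars P (\<lambda>_. borel) (\<lambda>i \<omega>. X (\<tau> (Suc i)) \<omega> - X (\<tau> i) \<omega>) {..<n}) \<and>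
     (\<forall>s\<ge>0. \<forall>t\<ge>0. distr P borel (\<lambda>\<omega>. X (s + t) \<omega> - X s \<omega>) = distr P borel (X t)) \<and>
     (\<forall>s\<ge>0. \<forall>\<epsilon>>0. ((\<lambda>t. measure P {\<omega> \<in> space P. norm (X t \<omega> - X s \<omega>) > \<epsilon>}) \<longlongrightarrow> 0)
        (at s within {0..}))"

(* Under the law started from x the process is x + X, so that the expectation of f(X_t) there is
   the integral of f(x + X_t) with respect to P. *)
definition transition_density ::
  "'v measure \<Rightarrow> (real \<Rightarrow> 'v \<Rightarrow> 'a::euclidean_space) \<Rightarrow> (real \<Rightarrow> 'a \<Rightarrow> 'a \<Rightarrow> real) \<Rightarrow> bool" where
  "transition_density P X p \<longleftrightarrow>
     (\<forall>t>0. \<forall>x y. 0 \<le> p t x y) \<and>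
     (\<lambda>(t, x, y). p t x y) \<in> borel_measurable (restrict_space borel ({0<..} \<times> UNIV)) \<and>
     (\<forall>t>0. \<forall>x. \<forall>f :: 'a \<Rightarrow> real. f \<in> borel_measurable borel \<longrightarrow> (\<forall>y. 0 \<le> f y) \<longrightarrow>
        (\<integral>\<^sup>+\<omega>. ennreal (f (x + X t \<omega>)) \<partial>P) = (\<integral>\<^sup>+y. ennreal (p t x y * f y) \<partial>lborel))"

(* Graph of the generator of the transition semigroup on L^2: the pairs (f, g) of square integrable
   functions such that (P_t f - f) / t tends to g in L^2 as t decreases to 0. *)
definition L2_generator ::
  "'v measure \<Rightarrow> (real \<Rightarrow> 'v \<Rightarrow> 'a::euclidean_space) \<Rightarrow> (('a \<Rightarrow> real) \<times> ('a \<Rightarrow> real)) set" where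
  "L2_generator P X =
     {(f, g). f \<in> borel_measurable borel \<and> integrable lborel (\<lambda>x. (f x)\<^sup>2) \<and>
              g \<in> borel_measurable borel \<and> integrable lborel (\<lambda>x. (g x)\<^sup>2) \<and>
              ((\<lambda>t. \<integral>\<^sup>+x. ennreal ((((\<integral>\<omega>. f (x + X t \<omega>) \<partial>P) - f x) / t - g x)\<^sup>2) \<partial>lborel)
                 \<longlongrightarrow> 0) (at_right 0)}"


section \<open>The Poisson noise\<close>

definition levy_measure :: "'a::euclidean_space measure \<Rightarrow> bool" where
  "levy_measure \<nu> \<longleftrightarrow>
     sets \<nu> = sets borel \<and> (\<integral>\<^sup>+h. ennreal (min 1 ((norm h)\<^sup>2)) \<partial>\<nu>) < \<infinity>"

definition poisson_random_measure :: "'w measure \<Rightarrow> 'e measure \<Rightarrow> ('w \<Rightarrow> 'e measure) \<Rightarrow> bool" where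
  "poisson_random_measure M \<mu> N \<longleftrightarrow>
     prob_space M \<and>
     (\<forall>\<omega>\<in>space M. sets (N \<omega>) = sets \<mu>) \<and>
     (\<forall>B\<in>sets \<mu>. (\<lambda>\<omega>. emeasure (N \<omega>) B) \<in> borel_measurable M) \<and>
     (\<forall>B\<in>sets \<mu>. emeasure \<mu> B < \<infinity> \<longrightarrow>
        (\<forall>k::nat. measure M {\<omega> \<in> space M. emeasure (N \<omega>) B = of_nat k}
                    = exp (- measure \<mu> B) * measure \<mu> B ^ k / fact k)) \<and>
     (\<forall>B\<in>sets \<mu>. emeasure \<mu> B = \<infinity> \<longrightarrow> (AE \<omega> in M. emeasure (N \<omega>) B = \<infinity>)) \<and>
     (\<forall>n. \<forall>B :: nat \<Rightarrow> 'e set. (\<forall>i<n. B i \<in> sets \<mu>) \<and> disjoint_family_on B {..<n} \<longrightarrow>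
        prob_space.indep_vars M (\<lambda>_. borel) (\<lambda>i \<omega>. emeasure (N \<omega>) (B i)) {..<n})"

(* The measure dt dx nu(dh) on [0,infinity) x R^d x R^d; points are triples (t, x, h). *)
definition noise_intensity ::
  "'a::euclidean_space measure \<Rightarrow> (real \<times> 'a \<times> 'a) measure" where
  "noise_intensity \<nu> = restrict_space lborel {0..} \<Otimes>\<^sub>M (lborel \<Otimes>\<^sub>M \<nu>)"

(* The null sets are those of M; when M is complete these are all negligible sets.  Nothing is lost
   by this choice, since M may be replaced by its completion. *)
definition noise_filtration ::
  "'w measure \<Rightarrow> ('w \<Rightarrow> (real \<times> 'a::euclidean_space \<times> 'a) measure) \<Rightarrow> real \<Rightarrow> 'w measure" where
  "noise_filtration M N t =
     sigma (space M)
       ({{\<omega> \<in> space M. emeasure (N \<omega>) B \<in> A} | B A.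
            B \<in> sets borel \<and> B \<subseteq> {0..t} \<times> UNIV \<and> A \<in> sets borel} \<union> null_sets M)"

definition predictable_sigma :: "'w set \<Rightarrow> (real \<Rightarrow> 'w measure) \<Rightarrow> (real \<times> 'w) measure" where
  "predictable_sigma \<Omega> F =
     sigma ({0<..} \<times> \<Omega>) {{a<..b} \<times> A | a b A. 0 \<le> a \<and> a \<le> b \<and> A \<in> sets (F a)}"

definition predictable_field ::
  "'w measure \<Rightarrow> ('w \<Rightarrow> (real \<times> 'a::euclidean_space \<times> 'a) measure) \<Rightarrow>
   (real \<Rightarrow> 'b::topological_space \<Rightarrow> 'w \<Rightarrow> real) \<Rightarrow> bool" where
  "predictable_field M N f \<longleftrightarrow>
     (\<lambda>((s, \<omega>), z). f s z \<omega>) \<in>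
       borel_measurable (predictable_sigma (space M) (noise_filtration M N) \<Otimes>\<^sub>M borel)"

(* Integrands are functions of the time s, the pair (y, h) and the sample point. *)
definition noise_integrable ::
  "'w measure \<Rightarrow> 'a::euclidean_space measure \<Rightarrow> ('w \<Rightarrow> (real \<times> 'a \<times> 'a) measure) \<Rightarrow> real \<Rightarrow>
   (real \<Rightarrow> 'a \<times> 'a \<Rightarrow> 'w \<Rightarrow> real) \<Rightarrow> bool" where
  "noise_integrable M \<nu> N t f \<longleftrightarrow>
     predictable_field M N f \<and>
     (\<integral>\<^sup>+s\<in>{0<..t}. (\<integral>\<^sup>+y. (\<integral>\<^sup>+h. (\<integral>\<^sup>+\<omega>. ennreal \<bar>f s (y, h) \<omega>\<bar> \<partial>M) \<partial>\<nu>) \<partial>lborel) \<partial>lborel) < \<infinity>"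

(* Sum over the atoms with time coordinate at most t, counted with their mass, which is almost surely
   1 because the intensity is diffuse. *)
definition noise_integral ::
  "('w \<Rightarrow> (real \<times> 'a::euclidean_space \<times> 'a) measure) \<Rightarrow> real \<Rightarrow>
   (real \<Rightarrow> 'a \<times> 'a \<Rightarrow> 'w \<Rightarrow> real) \<Rightarrow> 'w \<Rightarrow> real" where
  "noise_integral N t f \<omega> =
     (\<Sum>\<^sub>\<infinity>(s, z) \<in> {(s, z). 0 \<le> s \<and> s \<le> t \<and> emeasure (N \<omega>) {(s, z)} > 0}.
        measure (N \<omega>) {(s, z)} * f s z \<omega>)"


section \<open>Solutions\<close>

(* At s = t the kernel p(t - s, x, y) has no meaning; almost surely no atom has time coordinate t,
   so the integrand is set to 0 there. *)
definition mild_integrand ::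
  "(real \<Rightarrow> 'a::euclidean_space \<Rightarrow> 'a \<Rightarrow> real) \<Rightarrow> (real \<Rightarrow> 'a \<Rightarrow> real) \<Rightarrow> (real \<Rightarrow> 'a \<Rightarrow> 'w \<Rightarrow> real) \<Rightarrow>
   real \<Rightarrow> 'a \<Rightarrow> real \<Rightarrow> 'a \<times> 'a \<Rightarrow> 'w \<Rightarrow> real" where
  "mild_integrand p \<sigma> u t x =
     (\<lambda>s (y, h) \<omega>. if s < t then p (t - s) x y * \<sigma> (u s y \<omega>) h else 0)"

(* As u is only determined up to modification, the equation holds almost surely for each (t, x). *)
definition mild_solution ::
  "'w measure \<Rightarrow> 'a::euclidean_space measure \<Rightarrow> ('w \<Rightarrow> (real \<times> 'a \<times> 'a) measure) \<Rightarrow>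
   (real \<Rightarrow> 'a \<Rightarrow> 'a \<Rightarrow> real) \<Rightarrow> real \<Rightarrow> (real \<Rightarrow> 'a \<Rightarrow> real) \<Rightarrow> ('a \<Rightarrow> real) \<Rightarrow>
   (real \<Rightarrow> 'a \<Rightarrow> 'w \<Rightarrow> real) \<Rightarrow> bool" where
  "mild_solution M \<nu> N p lam \<sigma> u0 u \<longleftrightarrow>
     predictable_field M N u \<and>
     (\<forall>t>0. \<forall>x.
        noise_integrable M \<nu> N t (mild_integrand p \<sigma> u t x) \<and>
        (AE \<omega> in M. u t x \<omega> =
           (\<integral>y. p t x y * u0 y \<partial>lborel)
             + lam * noise_integral N t (mild_integrand p \<sigma> u t x) \<omega>))"

definition random_field_solution ::
  "'w measure \<Rightarrow> 'a::euclidean_space measure \<Rightarrow> ('w \<Rightarrow> (real \<times> 'a \<times> 'a) measure) \<Rightarrow>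
   (real \<Rightarrow> 'a \<Rightarrow> 'a \<Rightarrow> real) \<Rightarrow> real \<Rightarrow> (real \<Rightarrow> 'a \<Rightarrow> real) \<Rightarrow> ('a \<Rightarrow> real) \<Rightarrow>
   (real \<Rightarrow> 'a \<Rightarrow> 'w \<Rightarrow> real) \<Rightarrow> bool" where
  "random_field_solution M \<nu> N p lam \<sigma> u0 u \<longleftrightarrow>
     mild_solution M \<nu> N p lam \<sigma> u0 u \<and>
     (\<forall>T>0. (SUP t\<in>{0<..T}. SUP x. \<integral>\<^sup>+\<omega>. ennreal \<bar>u t x \<omega>\<bar> \<partial>M) < \<infinity>)"

end

theory Submission
  imports Defs
begin

text \<open>The increment \<open>u(t2,x) - u(t1,x)\<close> is the sum of an increment of the semigroup applied to \<open>u0\<close> and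
  of \<open>\<lambda>\<close> times an integral against \<open>N\<close> of \<open>(p(t2-s,x,y) - p(t1-s,x,y)) \<sigma>(u(s,y),h)\<close>. The compensation
  formula for predictable integrands bounds the mean of the latter by a multiple of the \<open>L\<^sup>1\<close> distance
  between \<open>(r,y) \<mapsto> p(r,x,y)\<close>, cut off to bounded \<open>r\<close>, and its translate by \<open>t2 - t1\<close> in time, which tends
  to \<open>0\<close> because translation is continuous in \<open>L\<^sup>1\<close>. The same modulus controls the semigroup term: by the
  Markov property the total variation distance between \<open>p(r,x,\<cdot>)\<close> and \<open>p(r+\<delta>,x,\<cdot>)\<close> dominates the
  increment over \<open>[t1, t1+\<delta>]\<close> for every \<open>r < t1\<close>, so it may be averaged over \<open>r\<close>.\<close>


section \<open>Translation continuity in the mean\<close>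


text \<open>Of \<open>p\<close> as a function of time only joint measurability is known, so no
  pointwise limit of the kernels is available. Continuity of translations in \<open>L^1\<close> over
  space-time asks for no more than integrability, and each \<open>p r x\<close> has mass one.
  Extending the density by zero to nonpositive times lets a single modulus measure both the change
  of kernel against the noise before \<open>t1\<close> and the fresh noise between \<open>t1\<close>
  and \<open>t2\<close>. The bound on the first moments of \<open>u\<close> and the linear growth of
  \<open>sigma\<close> reduce the rest of the integrand to a constant factor. Averaging the
  semigroup term costs a division by \<open>t1\<close>, so the final bound is uniform only for times
  bounded away from 0. The noise is described by its counts on disjoint sets, and measurability in
  the sample point is given one set at a time. Integrals of predictable integrands are therefore
  compared through two kernels on the predictable space that agree in mean on a generating
  pi-system. This works where both kernels are finite, which forces a localisation to sets of finite
  intensity and to an almost sure event.\<close>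

lemma integrable_lborel_translate:
  fixes f :: "'a::euclidean_space \<Rightarrow> real"
  assumes "integrable lborel f"
  shows "integrable lborel (\<lambda>x. f (x + v))" "(\<integral>x. f (x + v) \<partial>lborel) = (\<integral>x. f x \<partial>lborel)"
proof -
  have [measurable]: "f \<in> borel_measurable borel"
    using borel_measurable_integrable[OF assms] by simp
  have *: "integrable (distr lborel borel ((+) v)) f"
    unfolding lborel_distr_plus by fact
  show "integrable lborel (\<lambda>x. f (x + v))"
    using * by (subst (asm) integrable_distr_eq) (auto simp: add.commute)
  have "(\<integral>x. f x \<partial>lborel) = (\<integral>x. f x \<partial>distr lborel borel ((+) v))"
    unfolding lborel_distr_plus ..
  also have "\<dots> = (\<integral>x. f (x + v) \<partial>lborel)"
    by (subst integral_distr) (auto simp: add.commute)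
  finally show "(\<integral>x. f (x + v) \<partial>lborel) = (\<integral>x. f x \<partial>lborel)" ..
qed

text \<open>A three-epsilon argument: by translation invariance, replacing \<open>f\<close> by
  \<open>g\<close> costs the same \<open>L^1\<close> error before and after the shift.\<close>

lemma L1_translation_approx:
  fixes f :: "'a::euclidean_space \<Rightarrow> real" and v :: "nat \<Rightarrow> 'a"
  assumes f: "integrable lborel f"
    and approx: "\<And>e. 0 < e \<Longrightarrow> \<exists>g. integrable lborel g \<and> (\<integral>x. \<bar>f x - g x\<bar> \<partial>lborel) < e \<and>
           (\<lambda>n. \<integral>x. \<bar>g (x + v n) - g x\<bar> \<partial>lborel) \<longlonglongrightarrow> 0"
  shows "(\<lambda>n. \<integral>x. \<bar>f (x + v n) - f x\<bar> \<partial>lborel) \<longlonglongrightarrow> 0"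
proof (rule LIMSEQ_I)
  fix e :: real assume "0 < e"
  then obtain g where g: "integrable lborel g" "(\<integral>x. \<bar>f x - g x\<bar> \<partial>lborel) < e / 3"
    "(\<lambda>n. \<integral>x. \<bar>g (x + v n) - g x\<bar> \<partial>lborel) \<longlonglongrightarrow> 0"
    using approx[of "e / 3"] by auto
  from LIMSEQ_D[OF g(3), of "e / 3"] \<open>0 < e\<close>
  obtain n0 where n0: "\<And>n. n \<ge> n0 \<Longrightarrow> \<bar>\<integral>x. \<bar>g (x + v n) - g x\<bar> \<partial>lborel\<bar> < e / 3" by auto
  show "\<exists>n0. \<forall>n\<ge>n0. norm ((\<integral>x. \<bar>f (x + v n) - f x\<bar> \<partial>lborel) - 0) < e"
  proof (intro exI[of _ n0] allI impI)
    fix n assume n: "n \<ge> n0"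
    have i1: "integrable lborel (\<lambda>x. \<bar>f x - g x\<bar>)" using f g by auto
    note i2 = integrable_lborel_translate(1)[OF i1, of "v n"]
    have i3: "integrable lborel (\<lambda>x. \<bar>g (x + v n) - g x\<bar>)"
      using integrable_lborel_translate(1)[OF g(1), of "v n"] g(1) by auto
    have "(\<integral>x. \<bar>f (x + v n) - f x\<bar> \<partial>lborel) \<le>
        (\<integral>x. \<bar>f (x + v n) - g (x + v n)\<bar> + (\<bar>f x - g x\<bar> + \<bar>g (x + v n) - g x\<bar>) \<partial>lborel)"
      using integrable_lborel_translate(1)[OF f, of "v n"] f
      by (intro integral_mono Bochner_Integration.integrable_add i1 i2 i3 integrable_abs
            Bochner_Integration.integrable_diff) auto
    also have "\<dots> = (\<integral>x. \<bar>f (x + v n) - g (x + v n)\<bar> \<partial>lborel) + ((\<integral>x. \<bar>f x - g x\<bar> \<partial>lborel)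
          + (\<integral>x. \<bar>g (x + v n) - g x\<bar> \<partial>lborel))"
      using i1 i2 i3 by (simp add: Bochner_Integration.integral_add)
    also have "\<dots> < e / 3 + (e / 3 + e / 3)"
      using integrable_lborel_translate(2)[OF i1, of "v n"] g(2) n0[OF n] by linarith
    finally have "(\<integral>x. \<bar>f (x + v n) - f x\<bar> \<partial>lborel) < e" by simp
    moreover have "0 \<le> (\<integral>x. \<bar>f (x + v n) - f x\<bar> \<partial>lborel)" by simp
    ultimately show "norm ((\<integral>x. \<bar>f (x + v n) - f x\<bar> \<partial>lborel) - 0) < e" by simp
  qed
qed

text \<open>For indicators the distance is the sum of the two measures minus twice the measure of
  the overlap. The overlap carries the factor \<open>?f x\<close>, so pointwise convergence is
  required only at points of \<open>U\<close>, where openness gives it. What happens on the boundary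
  of \<open>U\<close> never enters, and \<open>?f\<close> itself dominates.\<close>

lemma L1_translation_open:
  fixes U :: "'a::euclidean_space set" and v :: "nat \<Rightarrow> 'a"
  assumes U: "open U" "emeasure lborel U < \<infinity>" and v: "v \<longlonglongrightarrow> 0"
  shows "(\<lambda>n. \<integral>x. \<bar>indicator U (x + v n) - indicator U x\<bar> \<partial>lborel) \<longlonglongrightarrow> (0::real)"
proof -
  let ?f = "indicator U :: 'a \<Rightarrow> real"
  have [measurable]: "U \<in> sets borel" using U by simp
  have f: "integrable lborel ?f" using U by (auto intro!: integrable_real_indicator)
  have p: "integrable lborel (\<lambda>x. ?f x * ?f (x + v n))" for n
    by (rule Bochner_Integration.integrable_bound[OF f]) (auto split: split_indicator)
  have lim: "(\<lambda>n. \<integral>x. ?f x * ?f (x + v n) \<partial>lborel) \<longlonglongrightarrow> (\<integral>x. ?f x \<partial>lborel)"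
  proof (rule integral_dominated_convergence[where w="?f"])
    show "AE x in lborel. (\<lambda>n. ?f x * ?f (x + v n)) \<longlonglongrightarrow> ?f x"
    proof (rule AE_I2)
      fix x
      show "(\<lambda>n. ?f x * ?f (x + v n)) \<longlonglongrightarrow> ?f x"
      proof (cases "x \<in> U")
        case True
        have "(\<lambda>n. x + v n) \<longlonglongrightarrow> x" using tendsto_add[OF tendsto_const v, of x] by simp
        then have "eventually (\<lambda>n. x + v n \<in> U) sequentially"
          using topological_tendstoD U(1) True by blast
        then show ?thesis
          by (intro tendsto_eventually) (auto elim!: eventually_mono simp: True)
      qed simp
    qed
  qed (use f in \<open>auto split: split_indicator\<close>)
  have "(\<integral>x. \<bar>?f (x + v n) - ?f x\<bar> \<partial>lborel) =
      2 * (\<integral>x. ?f x \<partial>lborel) - 2 * (\<integral>x. ?f x * ?f (x + v n) \<partial>lborel)" for n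
  proof -
    note t = integrable_lborel_translate[OF f, of "v n"]
    have "(\<integral>x. \<bar>?f (x + v n) - ?f x\<bar> \<partial>lborel) =
        (\<integral>x. (?f (x + v n) + ?f x) - 2 * (?f x * ?f (x + v n)) \<partial>lborel)"
      by (intro Bochner_Integration.integral_cong) (auto split: split_indicator)
    also have "\<dots> = (\<integral>x. ?f (x + v n) + ?f x \<partial>lborel) - (\<integral>x. 2 * (?f x * ?f (x + v n)) \<partial>lborel)"
      using p f t(1)
      by (intro Bochner_Integration.integral_diff Bochner_Integration.integrable_add
            integrable_mult_right) auto
    also have "\<dots> = 2 * (\<integral>x. ?f x \<partial>lborel) - 2 * (\<integral>x. ?f x * ?f (x + v n) \<partial>lborel)"
      using Bochner_Integration.integral_add[OF t(1) f] t(2)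
        integral_mult_right_zero[of lborel 2 "\<lambda>x. ?f x * ?f (x + v n)"] by linarith
    finally show ?thesis .
  qed
  then show ?thesis
    using tendsto_diff[OF tendsto_const[of "2 * (\<integral>x. ?f x \<partial>lborel)"] tendsto_mult_left[OF lim, of 2]] by simp
qed

text \<open>Induction over integrable functions. A measurable set of finite measure is approximated
  from outside by an open set, for which the previous lemma applies; sums use the triangle
  inequality, and limits of simple functions are again approximations in \<open>L^1\<close>.\<close>

lemma L1_translation_seq:
  fixes f :: "'a::euclidean_space \<Rightarrow> real" and v :: "nat \<Rightarrow> 'a"
  assumes f: "integrable lborel f" and v: "v \<longlonglongrightarrow> 0"
  shows "(\<lambda>n. \<integral>x. \<bar>f (x + v n) - f x\<bar> \<partial>lborel) \<longlonglongrightarrow> 0"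
  using f
proof (induct rule: integrable_induct)
  case (base A c)
  then have [measurable]: "A \<in> sets borel" by simp
  have iA: "integrable lborel (indicator A :: 'a \<Rightarrow> real)"
    using base by (auto intro!: integrable_real_indicator)
  show ?case
  proof (rule L1_translation_approx)
    fix e :: real assume "0 < e"
    have "A \<in> sets lebesgue" using base by simp
    \<comment> \<open>The tolerance \<open>e / (1 + \<bar>c\<bar>)\<close> leaves an error below
      \<open>e\<close> after multiplication by \<open>\<bar>c\<bar>\<close>, and is meaningful also
      for \<open>c = 0\<close>.\<close>
    then obtain U where U: "open U" "A \<subseteq> U" "U - A \<in> lmeasurable"
      "emeasure lebesgue (U - A) < ennreal (e / (1 + \<bar>c\<bar>))"
      using sets_lebesgue_outer_open[of A "e / (1 + \<bar>c\<bar>)"] \<open>0 < e\<close> by auto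
    have [measurable]: "U \<in> sets borel" using U by simp
    have e1: "emeasure lborel (U - A) < ennreal (e / (1 + \<bar>c\<bar>))" using U(4) by simp
    have "emeasure lborel U \<le> emeasure lborel (U - A) + emeasure lborel A"
      using emeasure_subadditive[of "U - A" lborel A] U(2) by (simp add: Un_absorb2)
    also have "\<dots> < \<infinity>"
      using order.strict_trans[OF e1 ennreal_less_top] base(2) by simp
    finally have fU: "emeasure lborel U < \<infinity>" .
    let ?g = "\<lambda>x. indicator U x *\<^sub>R c"
    have "(\<integral>x. \<bar>indicator A x *\<^sub>R c - ?g x\<bar> \<partial>lborel) = (\<integral>x. \<bar>c\<bar> * indicator (U - A) x \<partial>lborel)"
      using U(2) by (intro Bochner_Integration.integral_cong) (auto split: split_indicator)
    also have "\<dots> = \<bar>c\<bar> * measure lborel (U - A)" by simp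
    also have "\<dots> < e"
    proof -
      have "measure lborel (U - A) < e / (1 + \<bar>c\<bar>)"
        using e1 \<open>0 < e\<close> unfolding measure_def
        by (subst enn2real_less_iff) (auto intro: order.strict_trans[OF e1 ennreal_less_top])
      then have "measure lborel (U - A) * (1 + \<bar>c\<bar>) < e" by (simp add: pos_less_divide_eq)
      then show ?thesis
        using measure_nonneg[of lborel "U - A"] unfolding distrib_left mult.commute[of "\<bar>c\<bar>"] by linarith
    qed
    finally have "(\<integral>x. \<bar>indicator A x *\<^sub>R c - ?g x\<bar> \<partial>lborel) < e" .
    moreover have "integrable lborel ?g"
      using fU by (auto intro!: integrable_real_indicator)
    moreover have "(\<lambda>n. \<integral>x. \<bar>?g (x + v n) - ?g x\<bar> \<partial>lborel) \<longlonglongrightarrow> 0"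
    proof -
      have "\<bar>?g (x + v n) - ?g x\<bar> = \<bar>c\<bar> * \<bar>indicator U (x + v n) - indicator U x\<bar>" for x n
        by (auto split: split_indicator)
      then show ?thesis
        using tendsto_mult_left[OF L1_translation_open[OF U(1) fU v], of "\<bar>c\<bar>"] by simp
    qed
    ultimately show "\<exists>g. integrable lborel g \<and> (\<integral>x. \<bar>indicator A x *\<^sub>R c - g x\<bar> \<partial>lborel) < e \<and>
           (\<lambda>n. \<integral>x. \<bar>g (x + v n) - g x\<bar> \<partial>lborel) \<longlonglongrightarrow> 0" by blast
  qed (use iA in auto)
next
  case (add f g)
  show ?case
  proof (rule tendsto_sandwich[OF _ _ tendsto_const])
    show "(\<lambda>n. (\<integral>x. \<bar>f (x + v n) - f x\<bar> \<partial>lborel) + (\<integral>x. \<bar>g (x + v n) - g x\<bar> \<partial>lborel)) \<longlonglongrightarrow> 0"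
      using tendsto_add[OF add(2,4)] by simp
    show "\<forall>\<^sub>F n in sequentially. (\<integral>x. \<bar>f (x + v n) + g (x + v n) - (f x + g x)\<bar> \<partial>lborel)
       \<le> (\<integral>x. \<bar>f (x + v n) - f x\<bar> \<partial>lborel) + (\<integral>x. \<bar>g (x + v n) - g x\<bar> \<partial>lborel)"
    proof (rule always_eventually, rule allI)
      fix n
      note i = add(1,3) integrable_lborel_translate(1)[OF add(1), of "v n"]
        integrable_lborel_translate(1)[OF add(3), of "v n"]
      show "(\<integral>x. \<bar>f (x + v n) + g (x + v n) - (f x + g x)\<bar> \<partial>lborel)
       \<le> (\<integral>x. \<bar>f (x + v n) - f x\<bar> \<partial>lborel) + (\<integral>x. \<bar>g (x + v n) - g x\<bar> \<partial>lborel)"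
        using i
        by (subst Bochner_Integration.integral_add[symmetric],
            auto intro!: integral_mono Bochner_Integration.integrable_add simp del: Bochner_Integration.integral_add)
    qed
  qed simp
next
  case (lim f s)
  have "(\<lambda>i. \<integral>x. \<bar>f x - s i x\<bar> \<partial>lborel) \<longlonglongrightarrow> (\<integral>x. 0 \<partial>(lborel :: 'a measure))"
  \<comment> \<open>The induction supplies approximants with norm at most
    \<open>2 * \<bar>f x\<bar>\<close>, whence the factor 3 for the difference.\<close>
  proof (rule integral_dominated_convergence[where w="\<lambda>x. 3 * \<bar>f x\<bar>"])
    show "AE x in lborel. (\<lambda>i. \<bar>f x - s i x\<bar>) \<longlonglongrightarrow> 0"
    proof (rule AE_I2)
      fix x :: 'a
      have "(\<lambda>i. s i x) \<longlonglongrightarrow> f x" using lim(3) by simp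
      from tendsto_rabs[OF tendsto_diff[OF tendsto_const this, of "f x"]]
      show "(\<lambda>i. \<bar>f x - s i x\<bar>) \<longlonglongrightarrow> 0" by simp
    qed
    show "AE x in lborel. norm \<bar>f x - s i x\<bar> \<le> 3 * \<bar>f x\<bar>" for i
    proof (rule AE_I2)
      fix x :: 'a
      show "norm \<bar>f x - s i x\<bar> \<le> 3 * \<bar>f x\<bar>" using lim(4)[of x i] by simp
    qed
  qed (use lim in auto)
  then have *: "(\<lambda>i. \<integral>x. \<bar>f x - s i x\<bar> \<partial>lborel) \<longlonglongrightarrow> 0" by simp
  show ?case
  proof (rule L1_translation_approx[OF lim(5)])
    fix e :: real assume "0 < e"
    from LIMSEQ_D[OF * this] obtain i where "\<bar>\<integral>x. \<bar>f x - s i x\<bar> \<partial>lborel\<bar> < e" by auto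
    then show "\<exists>g. integrable lborel g \<and> (\<integral>x. \<bar>f x - g x\<bar> \<partial>lborel) < e \<and>
           (\<lambda>n. \<integral>x. \<bar>g (x + v n) - g x\<bar> \<partial>lborel) \<longlonglongrightarrow> 0"
      using lim(1,2) by (intro exI[of _ "s i"]) auto
  qed
qed

lemma L1_translation_continuous:
  fixes f :: "'a::euclidean_space \<Rightarrow> real"
  assumes f: "integrable lborel f"
  shows "((\<lambda>v. \<integral>\<^sup>+x. ennreal \<bar>f (x + v) - f x\<bar> \<partial>lborel) \<longlongrightarrow> 0) (at 0)"
  unfolding tendsto_at_iff_sequentially comp_def
proof (intro allI impI)
  fix v :: "nat \<Rightarrow> 'a" assume v: "v \<longlonglongrightarrow> 0"
  have "(\<integral>\<^sup>+x. ennreal \<bar>f (x + v n) - f x\<bar> \<partial>lborel) = ennreal (\<integral>x. \<bar>f (x + v n) - f x\<bar> \<partial>lborel)" for n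
    using integrable_lborel_translate(1)[OF f, of "v n"] f by (intro nn_integral_eq_integral) auto
  then show "(\<lambda>n. \<integral>\<^sup>+x. ennreal \<bar>f (x + v n) - f x\<bar> \<partial>lborel) \<longlonglongrightarrow> 0"
    using tendsto_ennrealI[OF L1_translation_seq[OF f v]] by simp
qed

section \<open>The transition semigroup\<close>


lemma (in prob_space) indep_vars_imp_indep_var:
  assumes "indep_vars (\<lambda>_. S) Y I" "i \<in> I" "j \<in> I" "i \<noteq> j"
  shows "indep_var S (Y i) S (Y j)"
proof -
  have "indep_var S ((\<lambda>f. f i) \<circ> (\<lambda>\<omega>. restrict (\<lambda>k. Y k \<omega>) {i})) S ((\<lambda>f. f j) \<circ> (\<lambda>\<omega>. restrict (\<lambda>k. Y k \<omega>) {j}))"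
    using assms by (intro indep_var_compose[OF indep_var_restrict[OF assms(1)]]) auto
  then show ?thesis by (simp add: comp_def)
qed

text \<open>The Markov property at time \<open>r\<close> on the level of laws: \<open>X t\<close> is
  the sum of two independent increments, and stationarity replaces their laws by those of
  \<open>X r\<close> and \<open>X (t - r)\<close>.\<close>

lemma levy_process_convolution:
  fixes f :: "'a::euclidean_space \<Rightarrow> ennreal"
  assumes levy: "levy_process P X" and r: "0 \<le> r" "r \<le> t" and [measurable]: "f \<in> borel_measurable borel"
  shows "(\<integral>\<^sup>+\<omega>. f (X t \<omega>) \<partial>P) = (\<integral>\<^sup>+\<omega>'. (\<integral>\<^sup>+\<omega>. f (X r \<omega>' + X (t - r) \<omega>) \<partial>P) \<partial>P)"
proof -
  interpret prob_space P using levy by (simp add: levy_process_def)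
  have X: "X s \<in> borel_measurable P" if "0 \<le> s" for s
    using levy that by (simp add: levy_process_def)
  have [measurable]: "X 0 \<in> borel_measurable P" "X r \<in> borel_measurable P" "X t \<in> borel_measurable P"
      "X (t - r) \<in> borel_measurable P"
    using X r by auto
  \<comment> \<open>The grid \<open>0, r, t\<close>, constant afterwards. The first increment is
    \<open>X r - X 0\<close> and not \<open>X r\<close>, since the process starts at 0 only almost
    surely.\<close>
  let ?\<tau> = "\<lambda>i::nat. if i = 0 then 0 else if i = 1 then r else t"
  let ?U = "\<lambda>\<omega>. X r \<omega> - X 0 \<omega>" and ?V = "\<lambda>\<omega>. X t \<omega> - X r \<omega>"
  have "indep_vars (\<lambda>_. borel) (\<lambda>i \<omega>. X (?\<tau> (Suc i)) \<omega> - X (?\<tau> i) \<omega>) {..<2::nat}"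
  proof -
    have incr: "\<forall>n \<tau>. 0 \<le> \<tau> 0 \<and> (\<forall>i<n. \<tau> i \<le> \<tau> (Suc i)) \<longrightarrow>
        indep_vars (\<lambda>_. borel) (\<lambda>i \<omega>. X (\<tau> (Suc i)) \<omega> - X (\<tau> i) \<omega>) {..<n}"
      using levy unfolding levy_process_def by (elim conjE)
    show ?thesis by (rule incr[rule_format]) (use r in auto)
  qed
  from indep_vars_imp_indep_var[OF this, of 0 1]
  have indep: "indep_var borel ?U borel ?V" by (simp add: One_nat_def)
  have stat: "distr P borel (\<lambda>\<omega>. X (s + h) \<omega> - X s \<omega>) = distr P borel (X h)" if "0 \<le> s" "0 \<le> h" for s h
    using levy that by (simp add: levy_process_def)
  have dU: "distr P borel ?U = distr P borel (X r)" using stat[of 0 r] r by simp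
  have dV: "distr P borel ?V = distr P borel (X (t - r))" using stat[of r "t - r"] r by simp
  have "(\<integral>\<^sup>+\<omega>. f (X t \<omega>) \<partial>P) = (\<integral>\<^sup>+\<omega>. f (?U \<omega> + ?V \<omega>) \<partial>P)"
    using levy unfolding levy_process_def by (intro nn_integral_cong_AE) auto
  also have "\<dots> = (\<integral>\<^sup>+z. f (fst z + snd z) \<partial>distr P (borel \<Otimes>\<^sub>M borel) (\<lambda>\<omega>. (?U \<omega>, ?V \<omega>)))"
    by (subst nn_integral_distr) auto
  also have "\<dots> = (\<integral>\<^sup>+z. f (fst z + snd z) \<partial>(distr P borel ?U \<Otimes>\<^sub>M distr P borel ?V))"
    using indep by (simp add: indep_var_distribution_eq)
  also have "\<dots> = (\<integral>\<^sup>+z. f (fst z + snd z) \<partial>(distr P borel (X r) \<Otimes>\<^sub>M distr P borel (X (t - r))))"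
    unfolding dU dV ..
  also have "\<dots> = (\<integral>\<^sup>+a. \<integral>\<^sup>+b. f (a + b) \<partial>distr P borel (X (t - r)) \<partial>distr P borel (X r))"
  proof -
    interpret D: prob_space "distr P borel (X (t - r))" by (rule prob_space_distr) simp
    show ?thesis by (subst D.nn_integral_fst[symmetric]) auto
  qed
  also have "\<dots> = (\<integral>\<^sup>+a. \<integral>\<^sup>+\<omega>. f (a + X (t - r) \<omega>) \<partial>P \<partial>distr P borel (X r))"
    by (intro nn_integral_cong, subst nn_integral_distr) auto
  also have "\<dots> = (\<integral>\<^sup>+\<omega>'. \<integral>\<^sup>+\<omega>. f (X r \<omega>' + X (t - r) \<omega>) \<partial>P \<partial>P)"
    by (subst nn_integral_distr) auto
  finally show ?thesis .
qed

text \<open>The values of \<open>p\<close> at nonpositive times are arbitrary, so they are replaced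
  by 0 before measurability on the whole of space-time is claimed.\<close>

lemma transition_density_measurable:
  assumes "transition_density P X p"
  shows "(\<lambda>z. if 0 < fst z then p (fst z) x (snd z) else 0) \<in> borel_measurable (borel :: (real \<times> 'a::euclidean_space) measure)"
proof -
  have "(\<lambda>(t, x, y). p t x y) \<in> borel_measurable (restrict_space borel ({0<..} \<times> UNIV))"
    using assms by (simp add: transition_density_def)
  moreover have "{0<..} \<times> UNIV \<inter> space borel \<in> sets (borel :: (real \<times> 'a \<times> 'a) measure)"
    by (auto intro!: borel_open open_Times)
  ultimately have m[measurable]: "(\<lambda>z. if z \<in> {0<..} \<times> UNIV then (\<lambda>(t, x, y). p t x y) z else 0) \<in> borel_measurable borel"
    by (simp add: measurable_restrict_space_iff)
  have [measurable]: "(\<lambda>z :: real \<times> 'a. (fst z, x, snd z)) \<in> borel \<rightarrow>\<^sub>M borel"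
    unfolding borel_prod[symmetric] by measurable
  have "(\<lambda>z :: real \<times> 'a. (\<lambda>z. if z \<in> {0<..} \<times> UNIV then (\<lambda>(t, x, y). p t x y) z else 0) (fst z, x, snd z)) \<in> borel_measurable borel"
    by measurable
  then show ?thesis by (simp add: mem_Times_iff cong: if_cong)
qed

lemma transition_density_section_measurable:
  fixes p :: "real \<Rightarrow> 'a::euclidean_space \<Rightarrow> 'a \<Rightarrow> real"
  assumes "transition_density P X p" "0 < t"
  shows "p t x \<in> borel_measurable borel"
proof -
  have [measurable]: "(\<lambda>y :: 'a. (t, y)) \<in> borel \<rightarrow>\<^sub>M borel"
    unfolding borel_prod[symmetric] by measurable
  have "(\<lambda>y. (\<lambda>z. if 0 < fst z then p (fst z) x (snd z) else 0) (t, y)) \<in> borel_measurable borel"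
    using transition_density_measurable[OF assms(1), of x] by measurable
  then show ?thesis using assms(2) by simp
qed

lemma transition_density_nn_integral:
  fixes p :: "real \<Rightarrow> 'a::euclidean_space \<Rightarrow> 'a \<Rightarrow> real"
  assumes "levy_process P X" "transition_density P X p" "0 < t"
  shows "(\<integral>\<^sup>+y. ennreal (p t x y) \<partial>lborel) = 1"
proof -
  interpret prob_space P using assms by (simp add: levy_process_def)
  have "(\<integral>\<^sup>+\<omega>. ennreal 1 \<partial>P) = (\<integral>\<^sup>+y. ennreal (p t x y * 1) \<partial>lborel)"
  proof -
    have "(\<integral>\<^sup>+\<omega>. ennreal (f (x + X t \<omega>)) \<partial>P) = (\<integral>\<^sup>+y. ennreal (p t x y * f y) \<partial>lborel)"
      if "f \<in> borel_measurable borel" "\<forall>y. 0 \<le> f y" for f :: "'a \<Rightarrow> real"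
      using assms(2,3) that unfolding transition_density_def by blast
    from this[of "\<lambda>_. 1"] show ?thesis by simp
  qed
  then show ?thesis by (simp add: emeasure_space_1)
qed

lemma transition_density_integrable:
  fixes p :: "real \<Rightarrow> 'a::euclidean_space \<Rightarrow> 'a \<Rightarrow> real"
  assumes "levy_process P X" "transition_density P X p" "0 < t"
  shows "integrable lborel (p t x)"
  using transition_density_nn_integral[OF assms, of x] transition_density_section_measurable[OF assms(2,3), of x]
    assms(2,3)
  by (intro integrableI_nonneg) (auto simp: transition_density_def)

text \<open>The inner semigroup operator is written as an expectation over \<open>X (t - r)\<close>
  and not through \<open>p\<close>, because \<open>t - r\<close> may be 0, where there is no
  density. Boundedness of \<open>f\<close> makes the inner Bochner integral agree with the
  nonnegative one used in the definition of the density.\<close>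

lemma semigroup_property:
  fixes p :: "real \<Rightarrow> 'a::euclidean_space \<Rightarrow> 'a \<Rightarrow> real" and f :: "'a \<Rightarrow> real"
  assumes levy: "levy_process P X" and p: "transition_density P X p"
    and r: "0 < r" "r \<le> t"
    and f[measurable]: "f \<in> borel_measurable borel" and f0: "\<And>y. 0 \<le> f y" and fB: "\<And>y. f y \<le> B"
  shows "(\<integral>y. p t x y * f y \<partial>lborel) = (\<integral>z. p r x z * (\<integral>\<omega>. f (z + X (t - r) \<omega>) \<partial>P) \<partial>lborel)"
proof -
  interpret prob_space P using levy by (simp add: levy_process_def)
  have [measurable]: "X s \<in> borel_measurable P" if "0 \<le> s" for s
    using levy that by (simp add: levy_process_def)
  have [measurable]: "X (t - r) \<in> borel_measurable P" using r by simp
  have dens: "(\<integral>\<^sup>+\<omega>. ennreal (g (x + X s \<omega>)) \<partial>P) = (\<integral>\<^sup>+y. ennreal (p s x y * g y) \<partial>lborel)"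
    if "0 < s" "g \<in> borel_measurable borel" "\<And>y. 0 \<le> g y" for s x and g :: "'a \<Rightarrow> real"
    using p that unfolding transition_density_def by blast
  note [measurable] = transition_density_section_measurable[OF p]
  have p0: "0 \<le> p s x y" if "0 < s" for s x y using p that by (simp add: transition_density_def)
  define g where "g z = (\<integral>\<omega>. f (z + X (t - r) \<omega>) \<partial>P)" for z
  have g[measurable]: "g \<in> borel_measurable borel" unfolding g_def by measurable
  have g0: "0 \<le> g z" for z unfolding g_def using f0 by simp
  have "(\<integral>\<^sup>+y. ennreal (p t x y * f y) \<partial>lborel) = (\<integral>\<^sup>+\<omega>. ennreal (f (x + X t \<omega>)) \<partial>P)"
    using r f0 by (subst dens) auto
  also have "\<dots> = (\<integral>\<^sup>+\<omega>'. \<integral>\<^sup>+\<omega>. ennreal (f (x + (X r \<omega>' + X (t - r) \<omega>))) \<partial>P \<partial>P)"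
    using r by (subst levy_process_convolution[OF levy, of r t "\<lambda>y. ennreal (f (x + y))"]) auto
  also have "\<dots> = (\<integral>\<^sup>+\<omega>'. ennreal (g (x + X r \<omega>')) \<partial>P)"
  proof (rule nn_integral_cong)
    fix \<omega>'
    have "integrable P (\<lambda>\<omega>. f (x + X r \<omega>' + X (t - r) \<omega>))"
      using f0 fB by (intro integrable_const_bound[where B=B]) auto
    then show "(\<integral>\<^sup>+\<omega>. ennreal (f (x + (X r \<omega>' + X (t - r) \<omega>))) \<partial>P) = ennreal (g (x + X r \<omega>'))"
      unfolding g_def using f0 by (subst nn_integral_eq_integral) (auto simp: add.assoc)
  qed
  also have "\<dots> = (\<integral>\<^sup>+y. ennreal (p r x y * g y) \<partial>lborel)"
    using r g0 by (subst dens) auto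
  finally have "(\<integral>\<^sup>+y. ennreal (p t x y * f y) \<partial>lborel) = (\<integral>\<^sup>+y. ennreal (p r x y * g y) \<partial>lborel)" .
  then show ?thesis
    unfolding g_def[symmetric] using r p0 f0 g0
    by (subst (1 2) integral_eq_nn_integral) (auto intro!: AE_I2)
qed

text \<open>Both times leave the same remaining duration, as
  \<open>(t + d) - (r + d) = t - r\<close>. Hence one function \<open>g\<close> with values in
  \<open>[0, B]\<close> is integrated against \<open>p (r + d) x\<close> and against
  \<open>p r x\<close>, and only the \<open>L^1\<close> distance of these two densities remains. The
  intermediate time \<open>r\<close> is free.\<close>

lemma semigroup_difference:
  fixes p :: "real \<Rightarrow> 'a::euclidean_space \<Rightarrow> 'a \<Rightarrow> real" and f :: "'a \<Rightarrow> real"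
  assumes levy: "levy_process P X" and p: "transition_density P X p"
    and r: "0 < r" "r \<le> t" and d: "0 \<le> d"
    and f[measurable]: "f \<in> borel_measurable borel" and f0: "\<And>y. 0 \<le> f y" and fB: "\<And>y. f y \<le> B"
  shows "ennreal \<bar>(\<integral>y. p (t + d) x y * f y \<partial>lborel) - (\<integral>y. p t x y * f y \<partial>lborel)\<bar>
      \<le> ennreal B * (\<integral>\<^sup>+z. ennreal \<bar>p (r + d) x z - p r x z\<bar> \<partial>lborel)"
proof -
  interpret prob_space P using levy by (simp add: levy_process_def)
  have [measurable]: "X (t - r) \<in> borel_measurable P"
    using levy r by (simp add: levy_process_def)
  define g where "g z = (\<integral>\<omega>. f (z + X (t - r) \<omega>) \<partial>P)" for z
  have g[measurable]: "g \<in> borel_measurable borel" unfolding g_def by measurable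
  have g0: "0 \<le> g z" for z unfolding g_def using f0 by simp
  have B0: "0 \<le> B" using f0[of 0] fB[of 0] by simp
  have gB: "g z \<le> B" for z
  proof -
    have "integrable P (\<lambda>\<omega>. f (z + X (t - r) \<omega>))"
      using f0 fB by (intro integrable_const_bound[where B=B]) auto
    then have "g z \<le> (\<integral>\<omega>. B \<partial>P)" unfolding g_def using fB by (intro integral_mono) auto
    then show ?thesis by (simp add: prob_space)
  qed
  have rd: "0 < r + d" using r d by simp
  note i = transition_density_integrable[OF levy p]
  have ig: "integrable lborel (\<lambda>z. p s x z * g z)" if "0 < s" for s
    by (rule Bochner_Integration.integrable_bound[where f="\<lambda>z. p s x z * B"])
       (use g0 gB B0 i[OF that] in \<open>auto simp: abs_mult intro!: mult_left_mono\<close>)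
  have e1: "(\<integral>y. p (t + d) x y * f y \<partial>lborel) = (\<integral>z. p (r + d) x z * g z \<partial>lborel)"
    unfolding g_def using semigroup_property[OF levy p rd _ f f0 fB, of "t + d" x] r by simp
  have e2: "(\<integral>y. p t x y * f y \<partial>lborel) = (\<integral>z. p r x z * g z \<partial>lborel)"
    unfolding g_def using semigroup_property[OF levy p r f f0 fB] by auto
  have "\<bar>(\<integral>y. p (t + d) x y * f y \<partial>lborel) - (\<integral>y. p t x y * f y \<partial>lborel)\<bar>
      = \<bar>\<integral>z. p (r + d) x z * g z - p r x z * g z \<partial>lborel\<bar>"
    unfolding e1 e2 using ig[OF rd] ig[OF r(1)] by (subst Bochner_Integration.integral_diff) auto
  also have "\<dots> \<le> (\<integral>z. \<bar>p (r + d) x z * g z - p r x z * g z\<bar> \<partial>lborel)"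
    by (rule integral_abs_bound)
  also have "\<dots> \<le> (\<integral>z. B * \<bar>p (r + d) x z - p r x z\<bar> \<partial>lborel)"
  proof (rule integral_mono)
    show "integrable lborel (\<lambda>z. \<bar>p (r + d) x z * g z - p r x z * g z\<bar>)"
      using ig[OF rd] ig[OF r(1)] by auto
    show "integrable lborel (\<lambda>z. B * \<bar>p (r + d) x z - p r x z\<bar>)"
      using i[OF rd] i[OF r(1)] by auto
  qed (use g0 gB in \<open>auto simp: left_diff_distrib[symmetric] abs_mult mult.commute[of B] intro!: mult_left_mono\<close>)
  also have "\<dots> = B * (\<integral>z. \<bar>p (r + d) x z - p r x z\<bar> \<partial>lborel)" by simp
  finally have "ennreal \<bar>(\<integral>y. p (t + d) x y * f y \<partial>lborel) - (\<integral>y. p t x y * f y \<partial>lborel)\<bar>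
      \<le> ennreal (B * (\<integral>z. \<bar>p (r + d) x z - p r x z\<bar> \<partial>lborel))" by (rule ennreal_leI)
  also have "\<dots> = ennreal B * (\<integral>\<^sup>+z. ennreal \<bar>p (r + d) x z - p r x z\<bar> \<partial>lborel)"
    using i[OF rd] i[OF r(1)] B0 by (subst nn_integral_eq_integral) (auto simp: ennreal_mult)
  finally show ?thesis .
qed


section \<open>The modulus of continuity of the density in space-time\<close>

definition truncated_density ::
  "(real \<Rightarrow> 'a \<Rightarrow> 'a \<Rightarrow> real) \<Rightarrow> 'a \<Rightarrow> real \<Rightarrow> real \<times> 'a \<Rightarrow> real" where
  "truncated_density p x T z = (if 0 < fst z \<and> fst z < T then p (fst z) x (snd z) else 0)"

lemma truncated_density_Pair:
  "truncated_density p x T (r, y) = (if 0 < r \<and> r < T then p r x y else 0)"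
  by (simp add: truncated_density_def)

definition density_modulus ::
  "(real \<Rightarrow> 'a::euclidean_space \<Rightarrow> 'a \<Rightarrow> real) \<Rightarrow> 'a \<Rightarrow> real \<Rightarrow> real \<Rightarrow> ennreal" where
  "density_modulus p x T \<delta> =
     (\<integral>\<^sup>+z. ennreal \<bar>truncated_density p x T (z + (\<delta>, 0)) - truncated_density p x T z\<bar> \<partial>lborel)"

lemma truncated_density_measurable:
  fixes p :: "real \<Rightarrow> 'a::euclidean_space \<Rightarrow> 'a \<Rightarrow> real"
  assumes "transition_density P X p"
  shows "truncated_density p x T \<in> borel_measurable borel"
proof -
  note [measurable] = transition_density_measurable[OF assms, of x]
  have [measurable]: "fst \<in> borel_measurable (borel :: (real \<times> 'a) measure)"
    unfolding borel_prod[symmetric] by measurable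
  have "(\<lambda>z :: real \<times> 'a. if fst z < T then (if 0 < fst z then p (fst z) x (snd z) else 0) else 0)
      \<in> borel_measurable borel"
    by measurable
  also have "(\<lambda>z :: real \<times> 'a. if fst z < T then (if 0 < fst z then p (fst z) x (snd z) else 0) else 0)
      = truncated_density p x T"
    by (auto simp: truncated_density_def fun_eq_iff)
  finally show ?thesis .
qed

text \<open>Every time slice in \<open>(0, T)\<close> has mass one, so the cut-off is what makes the
  total mass finite.\<close>

lemma truncated_density_integrable:
  fixes p :: "real \<Rightarrow> 'a::euclidean_space \<Rightarrow> 'a \<Rightarrow> real"
  assumes levy: "levy_process P X" and p: "transition_density P X p"
  shows "integrable lborel (truncated_density p x T)"
proof (rule integrableI_nonneg)
  let ?q = "truncated_density p x T"
  note m[measurable] = truncated_density_measurable[OF p, of x T]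
  show "?q \<in> borel_measurable lborel" by simp
  show "AE z in lborel. 0 \<le> ?q z"
    using p by (auto simp: truncated_density_def transition_density_def)
  have "(\<integral>\<^sup>+z. ennreal (?q z) \<partial>lborel) = (\<integral>\<^sup>+r. \<integral>\<^sup>+y. ennreal (?q (r, y)) \<partial>lborel \<partial>lborel)"
    unfolding lborel_prod[symmetric]
    by (rule lborel.nn_integral_fst[symmetric]) (simp add: lborel_prod)
  also have "\<dots> \<le> (\<integral>\<^sup>+r. indicator {0<..<T} r \<partial>lborel)"
    using transition_density_nn_integral[OF levy p, of _ x]
    by (intro nn_integral_mono) (auto simp: truncated_density_def split: split_indicator)
  also have "\<dots> < \<infinity>" by (cases "0 \<le> T") auto
  finally show "(\<integral>\<^sup>+z. ennreal (?q z) \<partial>lborel) < \<infinity>" .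
qed

lemma density_modulus_tendsto:
  fixes p :: "real \<Rightarrow> 'a::euclidean_space \<Rightarrow> 'a \<Rightarrow> real"
  assumes levy: "levy_process P X" and p: "transition_density P X p"
  shows "(density_modulus p x T \<longlongrightarrow> 0) (at 0)"
proof -
  have "filterlim (\<lambda>\<delta> :: real. (\<delta>, 0 :: 'a)) (at 0) (at 0)"
    unfolding filterlim_at
    by (auto simp: zero_prod_def eventually_at_filter intro!: tendsto_Pair)
  from filterlim_compose[OF L1_translation_continuous[OF truncated_density_integrable[OF levy p, of x T]] this]
  show ?thesis unfolding density_modulus_def[abs_def] .
qed

lemma density_modulus_iterated:
  fixes p :: "real \<Rightarrow> 'a::euclidean_space \<Rightarrow> 'a \<Rightarrow> real"
  assumes p: "transition_density P X p"
  shows "density_modulus p x T \<delta> = (\<integral>\<^sup>+r. \<integral>\<^sup>+y.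
           ennreal \<bar>truncated_density p x T (r + \<delta>, y) - truncated_density p x T (r, y)\<bar> \<partial>lborel \<partial>lborel)"
    and "(\<lambda>r. \<integral>\<^sup>+y. ennreal \<bar>truncated_density p x T (r + \<delta>, y) - truncated_density p x T (r, y)\<bar> \<partial>lborel)
           \<in> borel_measurable borel"
proof -
  let ?q = "truncated_density p x T"
  note m[measurable] = truncated_density_measurable[OF p, of x T]
  have m2: "(\<lambda>z. ennreal \<bar>?q (z + (\<delta>, 0)) - ?q z\<bar>) \<in> borel_measurable (lborel \<Otimes>\<^sub>M lborel)"
    unfolding lborel_prod by measurable
  from lborel.nn_integral_fst[OF m2]
  show "density_modulus p x T \<delta> = (\<integral>\<^sup>+r. \<integral>\<^sup>+y. ennreal \<bar>?q (r + \<delta>, y) - ?q (r, y)\<bar> \<partial>lborel \<partial>lborel)"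
    unfolding density_modulus_def lborel_prod by simp
  from lborel.borel_measurable_nn_integral_fst[OF m2]
  show "(\<lambda>r. \<integral>\<^sup>+y. ennreal \<bar>?q (r + \<delta>, y) - ?q (r, y)\<bar> \<partial>lborel) \<in> borel_measurable borel"
    by simp
qed

text \<open>Substitute \<open>r = t1 - s\<close>; then \<open>t2 - s = r + (t2 - t1)\<close>. For
  \<open>0 < s < t2\<close> both times lie strictly below \<open>T\<close>, so truncation from above
  changes nothing. For \<open>s >= t1\<close> the time \<open>r\<close> is nonpositive and the
  truncated density vanishes, exactly as the \<open>if\<close> demands. The inequality comes from
  integrating over all real \<open>r\<close> in the modulus. The reflection of time has Jacobian one
  in absolute value.\<close>

lemma kernel_time_shift_bound:
  fixes p :: "real \<Rightarrow> 'a::euclidean_space \<Rightarrow> 'a \<Rightarrow> real"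
  assumes p: "transition_density P X p" and t: "0 < t1" "t1 \<le> t2" "t2 \<le> T"
  shows "(\<integral>\<^sup>+s\<in>{0<..<t2}. c * (\<integral>\<^sup>+y. ennreal \<bar>p (t2 - s) x y - (if s < t1 then p (t1 - s) x y else 0)\<bar> \<partial>lborel) \<partial>lborel)
      \<le> c * density_modulus p x T (t2 - t1)"
proof -
  let ?q = "truncated_density p x T"
  let ?D = "\<lambda>r. \<integral>\<^sup>+y. ennreal \<bar>?q (r + (t2 - t1), y) - ?q (r, y)\<bar> \<partial>lborel"
  note [measurable] = density_modulus_iterated(2)[OF p]
  have "(\<integral>\<^sup>+s\<in>{0<..<t2}. c * (\<integral>\<^sup>+y. ennreal \<bar>p (t2 - s) x y - (if s < t1 then p (t1 - s) x y else 0)\<bar> \<partial>lborel) \<partial>lborel)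
      \<le> (\<integral>\<^sup>+s. c * ?D (t1 + (-1) * s) \<partial>lborel)"
    using t by (intro nn_integral_mono) (auto simp: truncated_density_Pair split: split_indicator)
  also have "\<dots> = c * (\<integral>\<^sup>+s. ?D (t1 + (-1) * s) \<partial>lborel)"
    by (rule nn_integral_cmult) measurable
  also have "(\<integral>\<^sup>+s. ?D (t1 + (-1) * s) \<partial>lborel) = (\<integral>\<^sup>+r. ?D r \<partial>lborel)"
    by (subst nn_integral_real_affine[OF density_modulus_iterated(2)[OF p], of "-1" _ _ _ t1]) auto
  also have "\<dots> = density_modulus p x T (t2 - t1)"
    unfolding density_modulus_iterated(1)[OF p] ..
  finally show ?thesis .
qed

text \<open>The bound of \<open>semigroup_difference\<close> holds for every intermediate time \<open>r \<le> t1\<close>; averaging it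
  over \<open>r\<close> turns the \<open>L\<^sup>1\<close> modulus in space into the modulus in space and time.\<close>

lemma semigroup_time_shift_bound:
  fixes p :: "real \<Rightarrow> 'a::euclidean_space \<Rightarrow> 'a \<Rightarrow> real" and f :: "'a \<Rightarrow> real"
  assumes levy: "levy_process P X" and p: "transition_density P X p"
    and t: "0 < t1" "t1 \<le> t2" "t2 \<le> T"
    and f[measurable]: "f \<in> borel_measurable borel" and f0: "\<And>y. 0 \<le> f y" and fB: "\<And>y. f y \<le> B"
  shows "ennreal \<bar>(\<integral>y. p t2 x y * f y \<partial>lborel) - (\<integral>y. p t1 x y * f y \<partial>lborel)\<bar>
      \<le> ennreal (B / t1) * density_modulus p x T (t2 - t1)"
proof -
  let ?q = "truncated_density p x T" and ?d = "t2 - t1"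
  let ?D = "\<lambda>r. \<integral>\<^sup>+y. ennreal \<bar>?q (r + ?d, y) - ?q (r, y)\<bar> \<partial>lborel"
  let ?c = "ennreal \<bar>(\<integral>y. p t2 x y * f y \<partial>lborel) - (\<integral>y. p t1 x y * f y \<partial>lborel)\<bar>"
  have B: "0 \<le> B" using f0[of 0] fB[of 0] by simp
  note [measurable] = density_modulus_iterated(2)[OF p]
  \<comment> \<open>The increment does not depend on \<open>r\<close>; integrating it over
    \<open>(0, t1)\<close> produces the factor \<open>t1\<close>, whose division at the end gives
    the constant \<open>B / t1\<close>.\<close>
  have "ennreal t1 * ?c = (\<integral>\<^sup>+r. ?c * indicator {0<..<t1} r \<partial>lborel)"
    using t by (subst nn_integral_cmult) (auto simp: mult.commute)
  also have "\<dots> \<le> (\<integral>\<^sup>+r. ennreal B * ?D r \<partial>lborel)"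
  proof (rule nn_integral_mono)
    fix r
    show "?c * indicator {0<..<t1} r \<le> ennreal B * ?D r"
    proof (cases "r \<in> {0<..<t1}")
      case True
      then have "?c \<le> ennreal B * (\<integral>\<^sup>+z. ennreal \<bar>p (r + ?d) x z - p r x z\<bar> \<partial>lborel)"
        using semigroup_difference[OF levy p _ _ _ f f0 fB, of r t1 ?d x] t by simp
      \<comment> \<open>Truncation is inactive here: \<open>0 < r < t1 <= T\<close>, and
        \<open>r + ?d < t2 <= T\<close>.\<close>
      also have "(\<integral>\<^sup>+z. ennreal \<bar>p (r + ?d) x z - p r x z\<bar> \<partial>lborel) = ?D r"
        using True t by (intro nn_integral_cong) (auto simp: truncated_density_def)
      finally show ?thesis using True by simp
    qed simp
  qed
  also have "\<dots> = ennreal B * density_modulus p x T ?d"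
    unfolding density_modulus_iterated(1)[OF p] by (rule nn_integral_cmult) simp
  finally have *: "ennreal t1 * ?c \<le> ennreal B * density_modulus p x T ?d" .
  have "?c = ennreal (1 / t1) * (ennreal t1 * ?c)"
    using t by (simp add: mult.assoc[symmetric] ennreal_mult[symmetric])
  also have "\<dots> \<le> ennreal (1 / t1) * (ennreal B * density_modulus p x T ?d)"
    using * by (rule mult_left_mono) simp
  also have "\<dots> = ennreal (B / t1) * density_modulus p x T ?d"
    using t B by (simp add: mult.assoc[symmetric] ennreal_mult[symmetric])
  finally show ?thesis .
qed

section \<open>Kernels agreeing on a generator\<close>


text \<open>A Dynkin argument for two random measures whose masses agree in mean on a pi-system.
  Measurability of the masses is known only on the generator, so it is carried along in the
  induction. Complements use finiteness twice: of each total mass, to subtract measures at a fixed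
  sample point, and of the mean total mass, to subtract the integrals.\<close>

lemma kernel_emeasure_unique:
  fixes K1 K2 :: "'w \<Rightarrow> 'y measure"
  assumes G: "Int_stable G" "G \<subseteq> Pow (space S)" "sets S = sigma_sets (space S) G"
    and K1: "\<And>w. w \<in> space M \<Longrightarrow> sets (K1 w) = sets S" "\<And>w. w \<in> space M \<Longrightarrow> emeasure (K1 w) (space S) < \<infinity>"
    and K2: "\<And>w. w \<in> space M \<Longrightarrow> sets (K2 w) = sets S" "\<And>w. w \<in> space M \<Longrightarrow> emeasure (K2 w) (space S) < \<infinity>"
    and m1: "\<And>A. A \<in> insert (space S) G \<Longrightarrow> (\<lambda>w. emeasure (K1 w) A) \<in> borel_measurable M"
    and m2: "\<And>A. A \<in> insert (space S) G \<Longrightarrow> (\<lambda>w. emeasure (K2 w) A) \<in> borel_measurable M"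
    and eq: "\<And>A. A \<in> insert (space S) G \<Longrightarrow> (\<integral>\<^sup>+w. emeasure (K1 w) A \<partial>M) = (\<integral>\<^sup>+w. emeasure (K2 w) A \<partial>M)"
    and fin: "(\<integral>\<^sup>+w. emeasure (K1 w) (space S) \<partial>M) < \<infinity>"
    and A: "A \<in> sets S"
  shows "(\<lambda>w. emeasure (K1 w) A) \<in> borel_measurable M \<and> (\<lambda>w. emeasure (K2 w) A) \<in> borel_measurable M \<and>
    (\<integral>\<^sup>+w. emeasure (K1 w) A \<partial>M) = (\<integral>\<^sup>+w. emeasure (K2 w) A \<partial>M)"
  using A unfolding G(3)
proof (induct rule: sigma_sets_induct_disjoint[OF G(1,2), consumes 1, case_names basic empty compl union])
  case (compl A)
  then have A: "A \<in> sets S" using G(3) by simp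
  have sub: "emeasure K (space S - A) = emeasure K (space S) - emeasure K A"
    if "sets K = sets S" "emeasure K (space S) < \<infinity>" for K
  proof (rule emeasure_Diff)
    have "emeasure K A \<le> emeasure K (space S)"
      using that A sets.sets_into_space[OF A] by (intro emeasure_mono) auto
    then show "emeasure K A \<noteq> \<infinity>" using that by (auto simp: top_unique)
  qed (use that A sets.sets_into_space[OF A] in auto)
  have s1: "emeasure (K1 w) (space S - A) = emeasure (K1 w) (space S) - emeasure (K1 w) A"
    if "w \<in> space M" for w using sub[OF K1[OF that]] .
  have s2: "emeasure (K2 w) (space S - A) = emeasure (K2 w) (space S) - emeasure (K2 w) A"
    if "w \<in> space M" for w using sub[OF K2[OF that]] .
  have le1: "emeasure (K1 w) A \<le> emeasure (K1 w) (space S)" if "w \<in> space M" for w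
    using that A K1 sets.sets_into_space[OF A] by (intro emeasure_mono) auto
  have le2: "emeasure (K2 w) A \<le> emeasure (K2 w) (space S)" if "w \<in> space M" for w
    using that A K2 sets.sets_into_space[OF A] by (intro emeasure_mono) auto
  have [measurable]: "(\<lambda>w. emeasure (K1 w) A) \<in> borel_measurable M" "(\<lambda>w. emeasure (K2 w) A) \<in> borel_measurable M"
      "(\<lambda>w. emeasure (K1 w) (space S)) \<in> borel_measurable M" "(\<lambda>w. emeasure (K2 w) (space S)) \<in> borel_measurable M"
    using compl m1 m2 by auto
  have fin1: "(\<integral>\<^sup>+w. emeasure (K1 w) A \<partial>M) < \<infinity>"
    by (rule le_less_trans[OF nn_integral_mono fin]) (rule le1)
  have fin2: "(\<integral>\<^sup>+w. emeasure (K2 w) A \<partial>M) < \<infinity>" using fin1 compl by simp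
  have "(\<integral>\<^sup>+w. emeasure (K1 w) (space S - A) \<partial>M) = (\<integral>\<^sup>+w. emeasure (K1 w) (space S) - emeasure (K1 w) A \<partial>M)"
    using s1 by (intro nn_integral_cong) auto
  also have "\<dots> = (\<integral>\<^sup>+w. emeasure (K1 w) (space S) \<partial>M) - (\<integral>\<^sup>+w. emeasure (K1 w) A \<partial>M)"
    using fin1 le1 by (intro nn_integral_diff) auto
  also have "\<dots> = (\<integral>\<^sup>+w. emeasure (K2 w) (space S) \<partial>M) - (\<integral>\<^sup>+w. emeasure (K2 w) A \<partial>M)"
    using compl eq by simp
  also have "\<dots> = (\<integral>\<^sup>+w. emeasure (K2 w) (space S) - emeasure (K2 w) A \<partial>M)"
    using fin2 le2 by (intro nn_integral_diff[symmetric]) auto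
  also have "\<dots> = (\<integral>\<^sup>+w. emeasure (K2 w) (space S - A) \<partial>M)"
    using s2 by (intro nn_integral_cong) auto
  finally show ?case
    by (simp add: s1 s2 cong: measurable_cong)
next
  case (union F)
  then have F: "range F \<subseteq> sets S" using G(3) by auto
  have s1: "emeasure (K1 w) (\<Union>i. F i) = (\<Sum>i. emeasure (K1 w) (F i))" if "w \<in> space M" for w
    using F K1(1)[OF that] union(1) by (intro suminf_emeasure[symmetric]) auto
  have s2: "emeasure (K2 w) (\<Union>i. F i) = (\<Sum>i. emeasure (K2 w) (F i))" if "w \<in> space M" for w
    using F K2(1)[OF that] union(1) by (intro suminf_emeasure[symmetric]) auto
  have [measurable]: "(\<lambda>w. emeasure (K1 w) (F i)) \<in> borel_measurable M" "(\<lambda>w. emeasure (K2 w) (F i)) \<in> borel_measurable M" for i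
    using union by auto
  have "(\<integral>\<^sup>+w. emeasure (K1 w) (\<Union>i. F i) \<partial>M) = (\<Sum>i. \<integral>\<^sup>+w. emeasure (K1 w) (F i) \<partial>M)"
    by (subst nn_integral_suminf[symmetric]) (auto intro!: nn_integral_cong simp: s1)
  also have "\<dots> = (\<Sum>i. \<integral>\<^sup>+w. emeasure (K2 w) (F i) \<partial>M)" using union by simp
  also have "\<dots> = (\<integral>\<^sup>+w. emeasure (K2 w) (\<Union>i. F i) \<partial>M)"
    by (subst nn_integral_suminf[symmetric]) (auto intro!: nn_integral_cong simp: s2)
  finally show ?case by (simp add: s1 s2 cong: measurable_cong)
qed (use m1 m2 eq in auto)

text \<open>The passage from sets to nonnegative functions. Again measurability of the integrals in
  the sample point is part of what is proved by induction, since the kernels are not given as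
  measurable maps into a space of measures.\<close>

lemma kernel_nn_integral_unique:
  fixes K1 K2 :: "'w \<Rightarrow> 'y measure"
  assumes sets: "\<And>w. w \<in> space M \<Longrightarrow> sets (K1 w) = sets S" "\<And>w. w \<in> space M \<Longrightarrow> sets (K2 w) = sets S"
    and unique: "\<And>A. A \<in> sets S \<Longrightarrow> (\<lambda>w. emeasure (K1 w) A) \<in> borel_measurable M \<and>
      (\<lambda>w. emeasure (K2 w) A) \<in> borel_measurable M \<and>
      (\<integral>\<^sup>+w. emeasure (K1 w) A \<partial>M) = (\<integral>\<^sup>+w. emeasure (K2 w) A \<partial>M)"
    and f: "f \<in> borel_measurable S"
  shows "(\<lambda>w. \<integral>\<^sup>+y. f y \<partial>K1 w) \<in> borel_measurable M \<and> (\<lambda>w. \<integral>\<^sup>+y. f y \<partial>K2 w) \<in> borel_measurable M \<and>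
    (\<integral>\<^sup>+w. \<integral>\<^sup>+y. f y \<partial>K1 w \<partial>M) = (\<integral>\<^sup>+w. \<integral>\<^sup>+y. f y \<partial>K2 w \<partial>M)"
proof -
  have ms: "\<And>w g. w \<in> space M \<Longrightarrow> g \<in> borel_measurable S \<Longrightarrow> g \<in> borel_measurable (K1 w)"
    "\<And>w g. w \<in> space M \<Longrightarrow> g \<in> borel_measurable S \<Longrightarrow> g \<in> borel_measurable (K2 w)"
    using sets by (simp_all cong: measurable_cong_sets)
  have sp: "\<And>w. w \<in> space M \<Longrightarrow> space (K1 w) = space S" "\<And>w. w \<in> space M \<Longrightarrow> space (K2 w) = space S"
    using sets by (metis sets_eq_imp_space_eq)+
  show ?thesis
    using f
  proof (induct rule: borel_measurable_induct)
    case (cong f g)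
    have "(\<integral>\<^sup>+y. f y \<partial>K1 w) = (\<integral>\<^sup>+y. g y \<partial>K1 w)" "(\<integral>\<^sup>+y. f y \<partial>K2 w) = (\<integral>\<^sup>+y. g y \<partial>K2 w)" if "w \<in> space M" for w
      using cong sp[OF that] by (auto intro!: nn_integral_cong)
    then show ?case using cong(4) by (simp cong: measurable_cong nn_integral_cong)
  next
    case (set A)
    have "(\<integral>\<^sup>+y. indicator A y \<partial>K1 w) = emeasure (K1 w) A" "(\<integral>\<^sup>+y. indicator A y \<partial>K2 w) = emeasure (K2 w) A"
      if "w \<in> space M" for w
      using set sets that by auto
    then show ?case using unique[OF set] by (simp cong: measurable_cong nn_integral_cong)
  next
    case (mult u c)
    have "(\<integral>\<^sup>+y. c * u y \<partial>K1 w) = c * (\<integral>\<^sup>+y. u y \<partial>K1 w)" "(\<integral>\<^sup>+y. c * u y \<partial>K2 w) = c * (\<integral>\<^sup>+y. u y \<partial>K2 w)"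
      if "w \<in> space M" for w
      using ms[OF that mult(2)] by (simp_all add: nn_integral_cmult)
    then show ?case using mult(4)
      by (auto simp: nn_integral_cmult intro!: borel_measurable_times_ennreal cong: measurable_cong nn_integral_cong)
  next
    case (add u v)
    have "(\<integral>\<^sup>+y. v y + u y \<partial>K1 w) = (\<integral>\<^sup>+y. v y \<partial>K1 w) + (\<integral>\<^sup>+y. u y \<partial>K1 w)"
      "(\<integral>\<^sup>+y. v y + u y \<partial>K2 w) = (\<integral>\<^sup>+y. v y \<partial>K2 w) + (\<integral>\<^sup>+y. u y \<partial>K2 w)"
      if "w \<in> space M" for w
      using ms[OF that add(1)] ms[OF that add(4)] by (simp_all add: nn_integral_add)
    then show ?case using add(3,7)
      by (auto simp: nn_integral_add intro!: borel_measurable_add cong: measurable_cong nn_integral_cong)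
  next
    case (seq U)
    have e: "(\<integral>\<^sup>+y. (SUP i. U i) y \<partial>K1 w) = (SUP i. \<integral>\<^sup>+y. U i y \<partial>K1 w)"
      "(\<integral>\<^sup>+y. (SUP i. U i) y \<partial>K2 w) = (SUP i. \<integral>\<^sup>+y. U i y \<partial>K2 w)"
      if "w \<in> space M" for w
      unfolding SUP_apply using seq(1,4) ms[OF that] by (auto intro!: nn_integral_monotone_convergence_SUP)
    have inc: "incseq (\<lambda>i w. \<integral>\<^sup>+y. U i y \<partial>K1 w)" "incseq (\<lambda>i w. \<integral>\<^sup>+y. U i y \<partial>K2 w)"
      using seq(4) by (auto intro!: nn_integral_mono simp: incseq_def le_fun_def)
    have "(\<integral>\<^sup>+w. (SUP i. \<integral>\<^sup>+y. U i y \<partial>K1 w) \<partial>M) = (SUP i. \<integral>\<^sup>+w. \<integral>\<^sup>+y. U i y \<partial>K1 w \<partial>M)"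
      using seq(3) inc by (intro nn_integral_monotone_convergence_SUP) auto
    moreover have "(\<integral>\<^sup>+w. (SUP i. \<integral>\<^sup>+y. U i y \<partial>K2 w) \<partial>M) = (SUP i. \<integral>\<^sup>+w. \<integral>\<^sup>+y. U i y \<partial>K2 w \<partial>M)"
      using seq(3) inc by (intro nn_integral_monotone_convergence_SUP) auto
    moreover have "(\<integral>\<^sup>+w. \<integral>\<^sup>+y. (SUP i. U i) y \<partial>K1 w \<partial>M) = (\<integral>\<^sup>+w. (SUP i. \<integral>\<^sup>+y. U i y \<partial>K1 w) \<partial>M)"
      "(\<integral>\<^sup>+w. \<integral>\<^sup>+y. (SUP i. U i) y \<partial>K2 w \<partial>M) = (\<integral>\<^sup>+w. (SUP i. \<integral>\<^sup>+y. U i y \<partial>K2 w) \<partial>M)"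
      by (rule nn_integral_cong[OF e(1)], assumption) (rule nn_integral_cong[OF e(2)], assumption)
    moreover have "(\<lambda>w. \<integral>\<^sup>+y. (SUP i. U i) y \<partial>K1 w) \<in> borel_measurable M
        \<longleftrightarrow> (\<lambda>w. SUP i. \<integral>\<^sup>+y. U i y \<partial>K1 w) \<in> borel_measurable M"
      by (rule measurable_cong[OF e(1)])
    moreover have "(\<lambda>w. \<integral>\<^sup>+y. (SUP i. U i) y \<partial>K2 w) \<in> borel_measurable M
        \<longleftrightarrow> (\<lambda>w. SUP i. \<integral>\<^sup>+y. U i y \<partial>K2 w) \<in> borel_measurable M"
      by (rule measurable_cong[OF e(2)])
    ultimately show ?case
      using seq(3) by (simp only:) (auto intro!: borel_measurable_SUP)
  qed
qed

section \<open>Independence of the noise from its past\<close>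


lemma space_noise_intensity:
  assumes "sets \<nu> = sets borel"
  shows "space (noise_intensity \<nu>) = {0..} \<times> UNIV"
  using sets_eq_imp_space_eq[OF assms]
  by (auto simp: noise_intensity_def space_pair_measure space_restrict_space)

lemma sets_noise_intensityI:
  fixes \<nu> :: "'a::euclidean_space measure"
  assumes \<nu>: "sets \<nu> = sets borel" and B: "B \<in> sets borel" "B \<subseteq> {0..} \<times> UNIV"
  shows "B \<in> sets (noise_intensity \<nu>)"
proof -
  have [measurable_cong]: "sets \<nu> = sets borel" by fact
  have "(\<lambda>z. (fst z, fst (snd z), snd (snd z))) \<in> noise_intensity \<nu> \<rightarrow>\<^sub>M borel \<Otimes>\<^sub>M (borel \<Otimes>\<^sub>M borel)"
    unfolding noise_intensity_def
    by (intro measurable_Pair measurable_compose[OF measurable_fst] measurable_restrict_space1) measurable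
  then have "(\<lambda>z. z) \<in> noise_intensity \<nu> \<rightarrow>\<^sub>M borel" by (simp add: borel_prod)
  from measurable_sets[OF this B(1)] show ?thesis
    using B(2) by (simp add: space_noise_intensity[OF \<nu>] Int_absorb2)
qed

text \<open>The \<open>B i\<close> may overlap, while the definition of the noise speaks of disjoint
  families. The remedy is to pass to the cells of the finite algebra generated by the
  \<open>B i\<close>: the count of each \<open>B i\<close> is a sum of cell counts, so the first
  event depends only on the cells, and these together with \<open>D\<close> form a disjoint
  family.\<close>

lemma poisson_indep_disjoint:
  fixes B :: "nat \<Rightarrow> 'e set"
  assumes N: "poisson_random_measure M \<mu> N"
    and B: "\<And>i. i < n \<Longrightarrow> B i \<in> sets \<mu>" "\<And>i. i < n \<Longrightarrow> B i \<inter> D = {}" and D: "D \<in> sets \<mu>"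
    and A: "\<And>i. i < n \<Longrightarrow> A i \<in> sets borel" and Y: "Y \<in> sets borel"
  shows "measure M ({\<omega> \<in> space M. \<forall>i<n. emeasure (N \<omega>) (B i) \<in> A i} \<inter> {\<omega> \<in> space M. emeasure (N \<omega>) D \<in> Y})
    = measure M {\<omega> \<in> space M. \<forall>i<n. emeasure (N \<omega>) (B i) \<in> A i} * measure M {\<omega> \<in> space M. emeasure (N \<omega>) D \<in> Y}"
proof -
  interpret prob_space M using N by (simp add: poisson_random_measure_def)
  define m where "m = card (Pow {..<n})"
  obtain h where h: "bij_betw h {0..<m} (Pow {..<n})"
    unfolding m_def using ex_bij_betw_nat_finite[of "Pow {..<n}"] by auto
  \<comment> \<open>For \<open>j < m\<close> the cell collects the points outside \<open>D\<close>
    that lie in exactly those \<open>B i\<close> with \<open>i \<in> h j\<close>, with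
    \<open>h\<close> enumerating all patterns; the last index \<open>m\<close> is reserved for
    \<open>D\<close>.\<close>
  define C where "C j = (if j < m then {z \<in> space \<mu> - D. \<forall>i<n. z \<in> B i \<longleftrightarrow> i \<in> h j} else D)" for j
  have [measurable]: "D \<in> sets \<mu>" by fact
  have C[measurable]: "C j \<in> sets \<mu>" for j
  proof (cases "j < m")
    case True
    have "C j = (space \<mu> - D) \<inter> {z \<in> space \<mu>. \<forall>i\<in>{..<n}. z \<in> B i \<longleftrightarrow> i \<in> h j}"
      using True by (auto simp: C_def)
    also have "\<dots> \<in> sets \<mu>"
    proof (intro sets.Int sets.sets_Collect_finite_All)
      fix i assume "i \<in> {..<n}"
      then have "B i \<in> sets \<mu>" using B by simp
      moreover have "{z \<in> space \<mu>. z \<in> B i \<longleftrightarrow> i \<in> h j} = (if i \<in> h j then B i else space \<mu> - B i)"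
        using sets.sets_into_space[OF \<open>B i \<in> sets \<mu>\<close>] by auto
      ultimately show "{z \<in> space \<mu>. z \<in> B i \<longleftrightarrow> i \<in> h j} \<in> sets \<mu>" by simp
    qed auto
    finally show ?thesis .
  qed (simp add: C_def D)
  have disj: "C i \<inter> C j = {}" if "i < m" "j < m" "i \<noteq> j" for i j
  proof (rule ccontr)
    assume "C i \<inter> C j \<noteq> {}"
    then obtain z where "z \<in> C i" "z \<in> C j" by auto
    then have "\<forall>k<n. k \<in> h i \<longleftrightarrow> k \<in> h j" using that by (simp add: C_def)
    moreover have "h i \<subseteq> {..<n}" "h j \<subseteq> {..<n}" using h that by (auto simp: bij_betw_def)
    ultimately have "h i = h j" by auto
    then show False using h that by (auto simp: bij_betw_def inj_on_def)
  qed
  have "C i \<inter> C m = {}" if "i < m" for i using that by (auto simp: C_def)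
  then have dfam: "disjoint_family_on C {..<Suc m}"
    using disj unfolding disjoint_family_on_def by (metis Int_commute lessThan_iff less_Suc_eq)
  have "\<forall>n (B :: nat \<Rightarrow> 'e set). (\<forall>i<n. B i \<in> sets \<mu>) \<and> disjoint_family_on B {..<n} \<longrightarrow>
        indep_vars (\<lambda>_. borel) (\<lambda>i \<omega>. emeasure (N \<omega>) (B i)) {..<n}"
    using N unfolding poisson_random_measure_def by (elim conjE)
  then have ind: "indep_vars (\<lambda>_. borel) (\<lambda>i \<omega>. emeasure (N \<omega>) (C i)) {..<Suc m}"
    using dfam C by blast
  \<comment> \<open>The index set is split into the cells \<open>{..<m}\<close> and the single index
    \<open>m\<close>, that is, the noise on the \<open>B i\<close> and the noise on
    \<open>D\<close>.\<close>
  have iv: "indep_var (PiM {..<m} (\<lambda>_. borel)) (\<lambda>\<omega>. restrict (\<lambda>i. emeasure (N \<omega>) (C i)) {..<m})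
      (PiM {m} (\<lambda>_. borel)) (\<lambda>\<omega>. restrict (\<lambda>i. emeasure (N \<omega>) (C i)) {m})"
    by (rule indep_var_restrict[OF ind]) auto
  define I where "I i = {j \<in> {..<m}. i \<in> h j}" for i
  have sN: "sets (N \<omega>) = sets \<mu>" if "\<omega> \<in> space M" for \<omega>
    using N that by (simp add: poisson_random_measure_def)
  have NB: "emeasure (N \<omega>) (B i) = (\<Sum>j\<in>I i. emeasure (N \<omega>) (C j))" if "\<omega> \<in> space M" "i < n" for \<omega> i
  proof -
    have "(\<Union>j\<in>I i. C j) = B i"
    proof (intro equalityI subsetI)
      fix z assume z: "z \<in> B i"
      define k where "k = {i\<in>{..<n}. z \<in> B i}"
      have "k \<in> h ` {0..<m}" using h by (auto simp: bij_betw_def k_def)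
      then obtain j where j: "j < m" "h j = k" by auto
      have "z \<in> space \<mu> - D" using B[OF that(2)] z sets.sets_into_space by fastforce
      then show "z \<in> (\<Union>j\<in>I i. C j)"
        using j z that(2) by (intro UN_I[of j]) (auto simp: I_def C_def k_def)
    qed (use that in \<open>auto simp: I_def C_def\<close>)
    moreover have "(\<Sum>j\<in>I i. emeasure (N \<omega>) (C j)) = emeasure (N \<omega>) (\<Union>j\<in>I i. C j)"
      using sN[OF that(1)] C disj
      by (intro sum_emeasure) (auto simp: I_def disjoint_family_on_def)
    ultimately show ?thesis by simp
  qed
  let ?P = "PiM {..<m} (\<lambda>_. borel :: ennreal measure)"
  let ?S = "{f \<in> space ?P. \<forall>i\<in>{..<n}. (\<Sum>j\<in>I i. f j) \<in> A i}"
  let ?T = "{f \<in> space (PiM {m} (\<lambda>_. borel :: ennreal measure)). f m \<in> Y}"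
  have S: "?S \<in> sets ?P"
  proof (intro sets.sets_Collect_finite_All)
    fix i assume "i \<in> {..<n}"
    then have [measurable]: "A i \<in> sets borel" using A by simp
    have "(\<lambda>f. \<Sum>j\<in>I i. f j) \<in> borel_measurable ?P"
      by (intro borel_measurable_sum measurable_component_singleton) (auto simp: I_def)
    then show "{f \<in> space ?P. (\<Sum>j\<in>I i. f j) \<in> A i} \<in> sets ?P" by measurable
  qed auto
  have T: "?T \<in> sets (PiM {m} (\<lambda>_. borel))"
    using Y by measurable
  have e1: "(\<lambda>\<omega>. restrict (\<lambda>i. emeasure (N \<omega>) (C i)) {..<m}) -` ?S \<inter> space M
      = {\<omega> \<in> space M. \<forall>i<n. emeasure (N \<omega>) (B i) \<in> A i}"
  proof -
    have "(\<Sum>j\<in>I i. restrict (\<lambda>i. emeasure (N \<omega>) (C i)) {..<m} j) = emeasure (N \<omega>) (B i)"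
      if "\<omega> \<in> space M" "i < n" for \<omega> i
      unfolding NB[OF that] by (intro sum.cong) (auto simp: I_def)
    then show ?thesis by (auto simp: space_PiM)
  qed
  have e2: "(\<lambda>\<omega>. restrict (\<lambda>i. emeasure (N \<omega>) (C i)) {m}) -` ?T \<inter> space M
      = {\<omega> \<in> space M. emeasure (N \<omega>) D \<in> Y}"
    by (auto simp: space_PiM C_def)
  have "(\<lambda>\<omega>. (restrict (\<lambda>i. emeasure (N \<omega>) (C i)) {..<m}, restrict (\<lambda>i. emeasure (N \<omega>) (C i)) {m}))
        -` (?S \<times> ?T) \<inter> space M =
      ((\<lambda>\<omega>. restrict (\<lambda>i. emeasure (N \<omega>) (C i)) {..<m}) -` ?S \<inter> space M) \<inter>
      ((\<lambda>\<omega>. restrict (\<lambda>i. emeasure (N \<omega>) (C i)) {m}) -` ?T \<inter> space M)"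
    by auto
  with indep_varD[OF iv S T] show ?thesis
    unfolding e1 e2 by simp
qed

lemma emeasure_poisson_measurable:
  assumes "poisson_random_measure M \<mu> N" "B \<in> sets \<mu>"
  shows "(\<lambda>\<omega>. emeasure (N \<omega>) B) \<in> borel_measurable M"
  using assms by (simp add: poisson_random_measure_def)

lemma space_noise_filtration [simp]: "space (noise_filtration M N t) = space M"
  unfolding noise_filtration_def by (rule space_measure_of) (auto dest: sets.sets_into_space)

lemma sets_noise_filtration:
  "sets (noise_filtration M N t) = sigma_sets (space M)
     ({{\<omega> \<in> space M. emeasure (N \<omega>) B \<in> A} | B A.
         B \<in> sets borel \<and> B \<subseteq> {0..t} \<times> UNIV \<and> A \<in> sets borel} \<union> null_sets M)"
  unfolding noise_filtration_def by (rule sets_measure_of) (auto dest: sets.sets_into_space)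

lemma sets_noise_filtration_mono:
  assumes "s \<le> t"
  shows "sets (noise_filtration M N s) \<subseteq> sets (noise_filtration M N t)"
  unfolding sets_noise_filtration
proof (rule sigma_sets_mono', rule Un_mono)
  have "{0..s} \<subseteq> {0..t}" using assms by auto
  then show "{{\<omega> \<in> space M. emeasure (N \<omega>) B \<in> A} | B A.
         B \<in> sets borel \<and> B \<subseteq> {0..s} \<times> UNIV \<and> A \<in> sets borel} \<subseteq> {{\<omega> \<in> space M. emeasure (N \<omega>) B \<in> A} | B A.
         B \<in> sets borel \<and> B \<subseteq> {0..t} \<times> UNIV \<and> A \<in> sets borel}"
    by (intro Collect_mono) blast
qed simp

lemma sets_noise_filtration_subset:
  fixes \<nu> :: "'a::euclidean_space measure"
  assumes \<nu>: "sets \<nu> = sets borel" and N: "poisson_random_measure M (noise_intensity \<nu>) N"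
  shows "sets (noise_filtration M N t) \<subseteq> sets M"
  unfolding sets_noise_filtration
proof (rule sets.sigma_sets_subset, safe)
  fix B :: "(real \<times> 'a \<times> 'a) set" and A :: "ennreal set"
  assume "B \<in> sets borel" "B \<subseteq> {0..t} \<times> UNIV" and [measurable]: "A \<in> sets borel"
  then have "B \<in> sets (noise_intensity \<nu>)" by (intro sets_noise_intensityI[OF \<nu>]) auto
  note [measurable] = emeasure_poisson_measurable[OF N this]
  show "{\<omega> \<in> space M. emeasure (N \<omega>) B \<in> A} \<in> sets M" by measurable
qed auto

text \<open>The events that generate the filtration are not closed under intersection. Finite
  cylinders together with the null sets are, and they generate a sigma-algebra containing the
  filtration at time \<open>a\<close>; independence is checked on cylinders by the previous lemma,
  is trivial for null sets, and extends from this pi-system.\<close>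

lemma noise_filtration_indep:
  fixes \<nu> :: "'a::euclidean_space measure"
  assumes \<nu>: "sets \<nu> = sets borel" and N: "poisson_random_measure M (noise_intensity \<nu>) N"
    and F: "F \<in> sets (noise_filtration M N a)"
    and D: "D \<in> sets (noise_intensity \<nu>)" "D \<inter> {0..a} \<times> UNIV = {}" and Y: "Y \<in> sets borel"
  shows "measure M (F \<inter> {\<omega> \<in> space M. emeasure (N \<omega>) D \<in> Y}) = measure M F * measure M {\<omega> \<in> space M. emeasure (N \<omega>) D \<in> Y}"
proof -
  interpret prob_space M using N by (simp add: poisson_random_measure_def)
  let ?E = "{\<omega> \<in> space M. emeasure (N \<omega>) D \<in> Y}"
  note [measurable] = emeasure_poisson_measurable[OF N D(1)] Y
  have E: "?E \<in> sets M" by measurable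
  define cyl where "cyl n B A = {\<omega> \<in> space M. \<forall>i<n. emeasure (N \<omega>) (B i) \<in> A i}"
    for n and B :: "nat \<Rightarrow> (real \<times> 'a \<times> 'a) set" and A :: "nat \<Rightarrow> ennreal set"
  define ok where "ok n B A \<longleftrightarrow> (\<forall>i<n. B i \<in> sets borel \<and> B i \<subseteq> {0..a} \<times> UNIV \<and> A i \<in> sets borel)"
    for n and B :: "nat \<Rightarrow> (real \<times> 'a \<times> 'a) set" and A :: "nat \<Rightarrow> ennreal set"
  have okB: "B i \<in> sets (noise_intensity \<nu>)" "B i \<inter> D = {}" "A i \<in> sets borel" if "ok n B A" "i < n" for n B A i
  proof -
    have "B i \<in> sets borel" "B i \<subseteq> {0..a} \<times> UNIV" and Ai: "A i \<in> sets borel" using that by (auto simp: ok_def)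
    then show "B i \<in> sets (noise_intensity \<nu>)" "B i \<inter> D = {}"
      using D(2) by (auto intro!: sets_noise_intensityI[OF \<nu>])
    show "A i \<in> sets borel" by fact
  qed
  have cyl_sets: "cyl n B A \<in> sets M" if "ok n B A" for n B A
  proof -
    have "{\<omega> \<in> space M. \<forall>i\<in>{..<n}. emeasure (N \<omega>) (B i) \<in> A i} \<in> sets M"
    proof (intro sets.sets_Collect_finite_All)
      fix i assume "i \<in> {..<n}"
      then have i: "i < n" by simp
      from measurable_sets[OF emeasure_poisson_measurable[OF N okB(1)[OF that i]] okB(3)[OF that i]]
      show "{\<omega> \<in> space M. emeasure (N \<omega>) (B i) \<in> A i} \<in> sets M"
        by (simp add: vimage_def Int_def conj_commute)
    qed simp
    also have "{\<omega> \<in> space M. \<forall>i\<in>{..<n}. emeasure (N \<omega>) (B i) \<in> A i} = cyl n B A" by (auto simp: cyl_def)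
    finally show ?thesis .
  qed
  define CY where "CY = {cyl n B A | n B A. ok n B A} \<union> null_sets M"
  have sub: "CY \<subseteq> sets M" using cyl_sets by (auto simp: CY_def)
  have int: "Int_stable CY"
  proof (rule Int_stableI)
    fix U V assume UV: "U \<in> CY" "V \<in> CY"
    show "U \<inter> V \<in> CY"
    proof (cases "U \<in> null_sets M \<or> V \<in> null_sets M")
      case True
      moreover have "U \<in> sets M" "V \<in> sets M" using UV sub by auto
      ultimately have "U \<inter> V \<in> null_sets M" using null_set_Int1 null_set_Int2 by metis
      then show ?thesis by (simp add: CY_def)
    next
      case False
      then obtain n B A k B' A' where U: "U = cyl n B A" "ok n B A" and V: "V = cyl k B' A'" "ok k B' A'"
        using UV by (auto simp: CY_def)
      \<comment> \<open>Two cylinders are intersected by concatenating their lists of sets, the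
        second list shifted by \<open>n\<close>.\<close>
      let ?B = "\<lambda>i. if i < n then B i else B' (i - n)" and ?A = "\<lambda>i. if i < n then A i else A' (i - n)"
      have "ok (n + k) ?B ?A" using U(2) V(2) by (auto simp: ok_def)
      moreover have "U \<inter> V = cyl (n + k) ?B ?A"
      proof (intro equalityI subsetI)
        fix \<omega> assume w: "\<omega> \<in> cyl (n + k) ?B ?A"
        have "emeasure (N \<omega>) (B i) \<in> A i" if "i < n" for i
          using w that unfolding cyl_def by (elim CollectE conjE allE[of _ i]) simp
        moreover have "emeasure (N \<omega>) (B' i) \<in> A' i" if "i < k" for i
          using w that unfolding cyl_def by (elim CollectE conjE allE[of _ "n + i"]) simp
        ultimately show "\<omega> \<in> U \<inter> V" using w unfolding U(1) V(1) by (auto simp: cyl_def)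
      qed (auto simp: U(1) V(1) cyl_def)
      ultimately show ?thesis by (auto simp: CY_def)
    qed
  qed
  have ind: "indep_set CY {?E}"
    unfolding indep_sets2_eq
  proof (intro conjI ballI)
    fix U V assume UV: "U \<in> CY" "V \<in> {?E}"
    show "prob (U \<inter> V) = prob U * prob V"
    proof (cases "U \<in> null_sets M")
      case True
      moreover have "V \<in> sets M" using UV E by simp
      ultimately have "U \<inter> V \<in> null_sets M" by (rule null_set_Int2)
      then show ?thesis using True by (simp add: measure_def null_setsD1)
    next
      case False
      then obtain n B A where U: "U = cyl n B A" "ok n B A" using UV by (auto simp: CY_def)
      then show ?thesis
        using poisson_indep_disjoint[OF N, of n B D A Y] okB[OF U(2)] D(1) Y UV(2)
        by (simp add: cyl_def)
    qed
  qed (use sub E in auto)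
  have "indep_set (sigma_sets (space M) CY) (sigma_sets (space M) {?E})"
    by (rule indep_set_sigma_sets[OF ind int]) (auto simp: Int_stable_def)
  then have "prob (U \<inter> ?E) = prob U * prob ?E" if "U \<in> sigma_sets (space M) CY" for U
    using that unfolding indep_sets2_eq by auto
  moreover have "F \<in> sigma_sets (space M) CY"
  proof -
    have "F \<in> sigma_sets (space M) ({{\<omega> \<in> space M. emeasure (N \<omega>) B \<in> A} | B A.
         B \<in> sets borel \<and> B \<subseteq> {0..a} \<times> UNIV \<and> A \<in> sets borel} \<union> null_sets M)"
      using F unfolding sets_noise_filtration .
    moreover have "\<dots> \<subseteq> sigma_sets (space M) CY"
    proof (rule sigma_sets_mono', safe)
      fix B :: "(real \<times> 'a \<times> 'a) set" and A :: "ennreal set"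
      assume "B \<in> sets borel" "B \<subseteq> {0..a} \<times> UNIV" "A \<in> sets borel"
      then have "ok 1 (\<lambda>_. B) (\<lambda>_. A)" by (simp add: ok_def)
      moreover have "{\<omega> \<in> space M. emeasure (N \<omega>) B \<in> A} = cyl 1 (\<lambda>_. B) (\<lambda>_. A)" by (simp add: cyl_def)
      ultimately show "{\<omega> \<in> space M. emeasure (N \<omega>) B \<in> A} \<in> CY" unfolding CY_def by blast
    qed (simp add: CY_def)
    ultimately show ?thesis by blast
  qed
  ultimately show ?thesis by blast
qed


section \<open>The mean of a Poisson count on an independent event\<close>

lemma poisson_weighted_sums:
  "(\<lambda>k. real k * (c * (exp (- m) * m ^ k / fact k))) sums (c * m)" for m :: real
proof -
  have "(\<lambda>k. m ^ k / fact k) sums exp m"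
    using exp_converges[of m] by (simp add: divide_inverse mult.commute)
  from sums_mult[OF this, of "c * exp (- m) * m"]
  have "(\<lambda>k. c * exp (- m) * m * (m ^ k / fact k)) sums (c * m)"
    by (simp add: exp_minus mult_ac)
  also have "(\<lambda>k. c * exp (- m) * m * (m ^ k / fact k)) =
      (\<lambda>k. real (Suc k) * (c * (exp (- m) * m ^ Suc k / fact (Suc k))))"
    by (rule ext) (simp add: divide_simps)
  finally show ?thesis by (subst (asm) sums_Suc_iff) simp
qed

text \<open>The prescribed probabilities sum to one, so no mass is left for any other value; in
  particular the count is almost surely finite.\<close>

lemma poisson_AE_nat:
  assumes N: "poisson_random_measure M \<mu> N" and D: "D \<in> sets \<mu>" "emeasure \<mu> D < \<infinity>"
  shows "AE \<omega> in M. \<exists>k::nat. emeasure (N \<omega>) D = of_nat k"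
proof -
  interpret prob_space M using N by (simp add: poisson_random_measure_def)
  note [measurable] = emeasure_poisson_measurable[OF N D(1)]
  let ?E = "\<lambda>k::nat. {\<omega> \<in> space M. emeasure (N \<omega>) D = of_nat k}"
  have "(\<lambda>k. measure M (?E k)) sums measure M (\<Union>k. ?E k)"
    by (rule finite_measure_UNION) (auto simp: disjoint_family_on_def)
  moreover have "measure M (?E k) = exp (- measure \<mu> D) * measure \<mu> D ^ k / fact k" for k
    using N D by (simp add: poisson_random_measure_def)
  moreover have "(\<lambda>k. exp (- measure \<mu> D) * measure \<mu> D ^ k / fact k) sums 1"
    using sums_mult[OF exp_converges[of "measure \<mu> D"], of "exp (- measure \<mu> D)"]
    by (simp add: exp_minus divide_inverse mult_ac)
  ultimately have "measure M (\<Union>k. ?E k) = 1" by (auto dest: sums_unique2)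
  then have "AE \<omega> in M. \<omega> \<in> (\<Union>k. ?E k)" by (subst (asm) prob_eq_1) auto
  then show ?thesis by eventually_elim auto
qed

text \<open>Almost surely the count is the sum over \<open>k\<close> of \<open>k\<close> times the
  indicator of the event that it equals \<open>k\<close>. Independence is then applied to each of
  these events, with \<open>Y\<close> a singleton, and what remains is the series for the Poisson
  mean, weighted by the probability of \<open>F\<close>.\<close>

lemma poisson_nn_integral:
  assumes N: "poisson_random_measure M \<mu> N" and D: "D \<in> sets \<mu>" "emeasure \<mu> D < \<infinity>"
    and F: "F \<in> sets M"
    and indep: "\<And>Y. Y \<in> sets borel \<Longrightarrow> measure M (F \<inter> {\<omega> \<in> space M. emeasure (N \<omega>) D \<in> Y})
           = measure M F * measure M {\<omega> \<in> space M. emeasure (N \<omega>) D \<in> Y}"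
  shows "(\<integral>\<^sup>+\<omega>. indicator F \<omega> * emeasure (N \<omega>) D \<partial>M) = emeasure M F * emeasure \<mu> D"
proof -
  interpret prob_space M using N by (simp add: poisson_random_measure_def)
  note [measurable] = emeasure_poisson_measurable[OF N D(1)] F
  let ?m = "measure \<mu> D"
  let ?E = "\<lambda>k::nat. {\<omega> \<in> space M. emeasure (N \<omega>) D = of_nat k}"
  have "AE \<omega> in M. indicator F \<omega> * emeasure (N \<omega>) D = (\<Sum>k. of_nat k * indicator (F \<inter> ?E k) \<omega>)"
    using poisson_AE_nat[OF N D] AE_space
  proof eventually_elim
    case (elim \<omega>)
    from elim(1) obtain k :: nat where k: "emeasure (N \<omega>) D = of_nat k" ..
    have ind: "indicator (F \<inter> ?E j) \<omega> = (if j = k then indicator F \<omega> else 0 :: ennreal)" for j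
      using elim(2) by (simp add: k indicator_def eq_commute)
    have "(\<Sum>j. of_nat j * indicator (F \<inter> ?E j) \<omega>) = (\<Sum>j\<in>{k}. of_nat j * indicator (F \<inter> ?E j) \<omega> :: ennreal)"
      by (rule suminf_finite) (simp_all only: ind finite.intros singleton_iff if_False mult_zero_right)
    also have "\<dots> = of_nat k * indicator F \<omega>" by (simp only: ind sum.insert sum.empty finite.emptyI empty_iff if_True not_False_eq_True simp_thms add_0_right)
    finally show ?case unfolding k by (simp only: mult.commute)
  qed
  then have "(\<integral>\<^sup>+\<omega>. indicator F \<omega> * emeasure (N \<omega>) D \<partial>M) = (\<integral>\<^sup>+\<omega>. (\<Sum>k. of_nat k * indicator (F \<inter> ?E k) \<omega>) \<partial>M)"
    by (rule nn_integral_cong_AE)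
  also have "\<dots> = (\<Sum>k. \<integral>\<^sup>+\<omega>. of_nat k * indicator (F \<inter> ?E k) \<omega> \<partial>M)"
    by (rule nn_integral_suminf) measurable
  also have "\<dots> = (\<Sum>k. ennreal (real k * (prob F * (exp (- ?m) * ?m ^ k / fact k))))"
  proof (rule suminf_cong)
    fix k
    have "prob (F \<inter> ?E k) = prob F * prob (?E k)" using indep[of "{of_nat k}"] by simp
    also have "prob (?E k) = exp (- ?m) * ?m ^ k / fact k"
      using N D by (simp add: poisson_random_measure_def)
    finally have "emeasure M (F \<inter> ?E k) = ennreal (prob F * (exp (- ?m) * ?m ^ k / fact k))"
      by (simp add: emeasure_eq_measure)
    moreover have "(\<integral>\<^sup>+\<omega>. of_nat k * indicator (F \<inter> ?E k) \<omega> \<partial>M) = of_nat k * emeasure M (F \<inter> ?E k)"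
      by (rule nn_integral_cmult_indicator) measurable
    ultimately show "(\<integral>\<^sup>+\<omega>. of_nat k * indicator (F \<inter> ?E k) \<omega> \<partial>M) = ennreal (real k * (prob F * (exp (- ?m) * ?m ^ k / fact k)))"
    proof -
      assume e: "emeasure M (F \<inter> ?E k) = ennreal (prob F * (exp (- ?m) * ?m ^ k / fact k))"
        and i: "(\<integral>\<^sup>+\<omega>. of_nat k * indicator (F \<inter> ?E k) \<omega> \<partial>M) = of_nat k * emeasure M (F \<inter> ?E k)"
      show ?thesis
        unfolding i e by (subst ennreal_mult) (auto simp: ennreal_of_nat_eq_real_of_nat)
    qed
  qed
  also have "\<dots> = ennreal (prob F * ?m)"
    by (rule suminf_ennreal_eq[OF _ poisson_weighted_sums]) simp
  also have "\<dots> = emeasure M F * emeasure \<mu> D"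
  proof -
    have "emeasure \<mu> D = ennreal ?m" using D(2) by (intro emeasure_eq_ennreal_measure) auto
    then show ?thesis by (simp only: emeasure_eq_measure ennreal_mult measure_nonneg)
  qed
  finally show ?thesis .
qed

section \<open>The compensation formula\<close>


lemma predictable_sigma_space_sets:
  assumes "\<And>a. space (F a) = \<Omega>"
  shows "space (predictable_sigma \<Omega> F) = {0<..} \<times> \<Omega>"
    "sets (predictable_sigma \<Omega> F) =
       sigma_sets ({0<..} \<times> \<Omega>) {{a<..b} \<times> A | a b A. 0 \<le> a \<and> a \<le> b \<and> A \<in> sets (F a)}"
proof -
  have "{{a<..b} \<times> A | a b A. 0 \<le> a \<and> a \<le> b \<and> A \<in> sets (F a)} \<subseteq> Pow ({0<..} \<times> \<Omega>)"
    using sets.sets_into_space[where M="F _"] assms by fastforce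
  then show "space (predictable_sigma \<Omega> F) = {0<..} \<times> \<Omega>"
    "sets (predictable_sigma \<Omega> F) =
       sigma_sets ({0<..} \<times> \<Omega>) {{a<..b} \<times> A | a b A. 0 \<le> a \<and> a \<le> b \<and> A \<in> sets (F a)}"
    unfolding predictable_sigma_def by (auto intro: space_measure_of sets_measure_of)
qed

abbreviation noise_predictable ::
  "'w measure \<Rightarrow> ('w \<Rightarrow> (real \<times> 'a::euclidean_space \<times> 'a) measure) \<Rightarrow> ((real \<times> 'w) \<times> 'b::topological_space) measure" where
  "noise_predictable M N \<equiv> predictable_sigma (space M) (noise_filtration M N) \<Otimes>\<^sub>M borel"

text \<open>The set \<open>A\<close> is known at the left endpoint \<open>a\<close>, which the time
  interval excludes. This is the reason why the noise charged by such a rectangle is independent of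
  \<open>A\<close>.\<close>

definition predictable_rectangles ::
  "'w measure \<Rightarrow> ('w \<Rightarrow> (real \<times> 'a::euclidean_space \<times> 'a) measure) \<Rightarrow> ((real \<times> 'w) \<times> 'b::topological_space) set set" where
  "predictable_rectangles M N =
     {R \<times> C | R C. R \<in> {{a<..b} \<times> A | a b A. 0 \<le> a \<and> a \<le> b \<and> A \<in> sets (noise_filtration M N a)} \<and> C \<in> sets borel}"

lemma predictable_rectanglesE:
  assumes "G \<in> predictable_rectangles M N"
  obtains a b A C where "G = ({a<..b} \<times> A) \<times> C" "0 \<le> a" "a \<le> b" "A \<in> sets (noise_filtration M N a)" "C \<in> sets borel"
  using assms unfolding predictable_rectangles_def by blast

lemma predictable_rectanglesI:
  assumes "0 \<le> a" "a \<le> b" "A \<in> sets (noise_filtration M N a)" "C \<in> sets borel"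
  shows "({a<..b} \<times> A) \<times> C \<in> predictable_rectangles M N"
  using assms unfolding predictable_rectangles_def by blast

lemma space_noise_predictable:
  "space (noise_predictable M N) = ({0<..} \<times> space M) \<times> UNIV"
  by (simp add: space_pair_measure predictable_sigma_space_sets)

lemma sets_noise_predictable:
  "sets (noise_predictable M N) = sigma_sets (space (noise_predictable M N)) (predictable_rectangles M N)"
proof -
  let ?P = "predictable_sigma (space M) (noise_filtration M N)"
  let ?Ea = "{{a<..b} \<times> A | a b A. 0 \<le> a \<and> a \<le> b \<and> A \<in> sets (noise_filtration M N a)}"
  have top: "space M \<in> sets (noise_filtration M N a)" for a
    using sets.top[of "noise_filtration M N a"] by simp
  have sub: "?Ea \<subseteq> Pow (space ?P)"
    using sets.sets_into_space[where M="noise_filtration M N _"] by (fastforce simp: predictable_sigma_space_sets)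
  have "sets (?P \<Otimes>\<^sub>M borel) = sets (sigma (space ?P \<times> space borel) {a \<times> b | a b. a \<in> ?Ea \<and> b \<in> sets borel})"
  \<comment> \<open>Generation of a product sigma-algebra by rectangles needs a countable cover of
    each factor by generators; unbounded time is covered by the intervals from 0 to
    \<open>n\<close>.\<close>
  proof (rule sets_pair_eq[where Ca="range (\<lambda>n::nat. {0<..real n} \<times> space M)" and Cb="{UNIV}"])
    show "\<Union> (range (\<lambda>n::nat. {0<..real n} \<times> space M)) = space ?P"
      by (auto simp: predictable_sigma_space_sets intro: real_arch_simple)
    show "range (\<lambda>n::nat. {0<..real n} \<times> space M) \<subseteq> ?Ea"
    proof
      fix R assume "R \<in> range (\<lambda>n::nat. {0<..real n} \<times> space M)"
      then obtain n :: nat where "R = {0<..real n} \<times> space M" by auto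
      then show "R \<in> ?Ea" using top[of 0] by (intro CollectI exI[of _ 0] exI[of _ "real n"] exI[of _ "space M"]) auto
    qed
    show "sets ?P = sigma_sets (space ?P) ?Ea" by (simp add: predictable_sigma_space_sets)
    show "sets borel = sigma_sets (space borel) (sets borel)"
      by (rule sets.sigma_sets_eq[symmetric])
  qed (use sub in auto)
  also have "\<dots> = sigma_sets (space ?P \<times> space borel) {a \<times> b | a b. a \<in> ?Ea \<and> b \<in> sets borel}"
    using sub by (intro sets_measure_of) auto
  finally show ?thesis by (simp add: space_pair_measure predictable_rectangles_def)
qed

lemma predictable_rectangles_subset: "predictable_rectangles M N \<subseteq> Pow (space (noise_predictable M N))"
proof
  fix G assume "G \<in> predictable_rectangles M N"
  then obtain a b A C where "G = ({a<..b} \<times> A) \<times> C" "0 \<le> a" "A \<in> sets (noise_filtration M N a)"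
    by (rule predictable_rectanglesE)
  then show "G \<in> Pow (space (noise_predictable M N))"
    using sets.sets_into_space[of A "noise_filtration M N a"] by (auto simp: space_noise_predictable)
qed

lemma Int_stable_predictable_rectangles:
  fixes M :: "'w measure"
  shows "Int_stable (predictable_rectangles M N :: ((real \<times> 'w) \<times> 'b::topological_space) set set)"
proof (rule Int_stableI)
  fix G H :: "((real \<times> 'w) \<times> 'b) set" assume "G \<in> predictable_rectangles M N" "H \<in> predictable_rectangles M N"
  then obtain a b A C a' b' A' C' where
    G: "G = ({a<..b} \<times> A) \<times> C" "0 \<le> a" "a \<le> b" "A \<in> sets (noise_filtration M N a)" "C \<in> sets borel" and
    H: "H = ({a'<..b'} \<times> A') \<times> C'" "0 \<le> a'" "a' \<le> b'" "A' \<in> sets (noise_filtration M N a')" "C' \<in> sets borel"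
    by (metis predictable_rectanglesE)
  let ?a = "max a a'"
  \<comment> \<open>The right endpoint is raised to at least \<open>?a\<close>, so that disjoint
    time intervals give an empty interval with ordered endpoints. Both events are known at the later
    left endpoint because the filtration increases.\<close>
  have "G \<inter> H = ({?a<..max ?a (min b b')} \<times> (A \<inter> A')) \<times> (C \<inter> C')"
    unfolding G(1) H(1) by auto
  also have "\<dots> \<in> predictable_rectangles M N"
  proof (rule predictable_rectanglesI)
    show "A \<inter> A' \<in> sets (noise_filtration M N ?a)"
      using G(4) H(4) sets_noise_filtration_mono[of a ?a M N] sets_noise_filtration_mono[of a' ?a M N]
      by (intro sets.Int) auto
  qed (use G H in auto)
  finally show "G \<inter> H \<in> predictable_rectangles M N" .
qed

text \<open>Only the sigma-algebra of \<open>Q\<close> enters, so that \<open>Q\<close> can be the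
  intensity or a realisation of the noise. Time 0 is cut away because the predictable sigma-algebra
  lives on positive times.\<close>

lemma measurable_predictable_map:
  fixes \<nu> :: "'a::euclidean_space measure"
  assumes \<nu>: "sets \<nu> = sets borel" and N: "poisson_random_measure M (noise_intensity \<nu>) N"
    and Q: "sets Q = sets (noise_intensity \<nu>)"
  shows "(\<lambda>(\<omega>, z). ((fst z, \<omega>), snd z)) \<in>
    restrict_space (M \<Otimes>\<^sub>M Q) (space M \<times> {0<..} \<times> UNIV) \<rightarrow>\<^sub>M noise_predictable M N"
proof (rule measurable_sigma_sets[OF sets_noise_predictable predictable_rectangles_subset])
  have spQ: "space Q = {0..} \<times> UNIV"
    using sets_eq_imp_space_eq[OF Q] space_noise_intensity[OF \<nu>] by simp
  have spR: "space (restrict_space (M \<Otimes>\<^sub>M Q) (space M \<times> {0<..} \<times> UNIV)) = space M \<times> {0<..} \<times> UNIV"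
    by (auto simp: space_restrict_space space_pair_measure spQ)
  show "(\<lambda>(\<omega>, z). ((fst z, \<omega>), snd z)) \<in> space (restrict_space (M \<Otimes>\<^sub>M Q) (space M \<times> {0<..} \<times> UNIV))
      \<rightarrow> space (noise_predictable M N)"
    unfolding spR space_noise_predictable by auto
  fix G :: "((real \<times> _) \<times> ('a \<times> 'a)) set" assume "G \<in> predictable_rectangles M N"
  then obtain a b A C where G: "G = ({a<..b} \<times> A) \<times> C" "0 \<le> a" "A \<in> sets (noise_filtration M N a)" "C \<in> sets borel"
    by (rule predictable_rectanglesE)
  have A: "A \<in> sets M" using G(3) sets_noise_filtration_subset[OF \<nu> N] by blast
  have "{a<..b} \<times> C \<in> sets (borel \<Otimes>\<^sub>M borel)" using G(4) by (intro pair_measureI) auto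
  then have "{a<..b} \<times> C \<in> sets borel" by (simp only: borel_prod)
  then have D: "{a<..b} \<times> C \<in> sets Q"
    unfolding Q using G(2) by (intro sets_noise_intensityI[OF \<nu>]) auto
  have "(\<lambda>(\<omega>, z). ((fst z, \<omega>), snd z)) -` G \<inter> (space M \<times> {0<..} \<times> UNIV) = (A \<times> ({a<..b} \<times> C)) \<inter> (space M \<times> {0<..} \<times> UNIV)"
    unfolding G(1) by auto
  also have "\<dots> \<in> sets (restrict_space (M \<Otimes>\<^sub>M Q) (space M \<times> {0<..} \<times> UNIV))"
    using A D by (auto simp: sets_restrict_space Int_commute)
  finally show "(\<lambda>(\<omega>, z). ((fst z, \<omega>), snd z)) -` G \<inter> space (restrict_space (M \<Otimes>\<^sub>M Q) (space M \<times> {0<..} \<times> UNIV))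
      \<in> sets (restrict_space (M \<Otimes>\<^sub>M Q) (space M \<times> {0<..} \<times> UNIV))" unfolding spR .
qed

lemma measurable_predictable_joint:
  fixes \<nu> :: "'a::euclidean_space measure" and g :: "(real \<times> 'w) \<times> ('a \<times> 'a) \<Rightarrow> ennreal"
  assumes \<nu>: "sets \<nu> = sets borel" and N: "poisson_random_measure M (noise_intensity \<nu>) N"
    and Q: "sets Q = sets (noise_intensity \<nu>)"
    and g: "g \<in> borel_measurable (noise_predictable M N)"
  shows "(\<lambda>(\<omega>, z). g ((fst z, \<omega>), snd z) * indicator ({0<..} \<times> UNIV) z) \<in> borel_measurable (M \<Otimes>\<^sub>M Q)"
proof -
  let ?S = "space M \<times> {0<..} \<times> UNIV"
  have spQ: "space Q = {0..} \<times> UNIV"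
    using sets_eq_imp_space_eq[OF Q] space_noise_intensity[OF \<nu>] by simp
  have "{0<..} \<times> UNIV \<in> sets Q"
    unfolding Q by (intro sets_noise_intensityI[OF \<nu>]) (auto intro!: borel_open open_Times)
  then have "?S \<in> sets (M \<Otimes>\<^sub>M Q)" by auto
  then have S: "?S \<inter> space (M \<Otimes>\<^sub>M Q) \<in> sets (M \<Otimes>\<^sub>M Q)" by auto
  have "(\<lambda>x. g ((\<lambda>(\<omega>, z). ((fst z, \<omega>), snd z)) x)) \<in> borel_measurable (restrict_space (M \<Otimes>\<^sub>M Q) ?S)"
    by (rule measurable_compose[OF measurable_predictable_map[OF \<nu> N Q] g])
  from this[unfolded borel_measurable_restrict_space_iff_ennreal[OF S]]
  show ?thesis
    by (rule measurable_cong[THEN iffD1, rotated])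
       (auto simp: space_pair_measure indicator_def)
qed

lemma predictable_section_measurable:
  fixes \<nu> :: "'a::euclidean_space measure"
  assumes \<nu>: "sets \<nu> = sets borel" and N: "poisson_random_measure M (noise_intensity \<nu>) N"
    and Q: "sets Q = sets (noise_intensity \<nu>)" and \<omega>: "\<omega> \<in> space M" and E: "E \<subseteq> {0<..} \<times> UNIV"
  shows "(\<lambda>z. ((fst z, \<omega>), snd z)) \<in> restrict_space Q E \<rightarrow>\<^sub>M noise_predictable M N"
proof -
  have "(\<lambda>z. (\<omega>, z)) \<in> restrict_space Q E \<rightarrow>\<^sub>M restrict_space (M \<Otimes>\<^sub>M Q) (space M \<times> {0<..} \<times> UNIV)"
    using \<omega> E by (intro measurable_restrict_space2 measurable_restrict_space1) (auto simp: space_restrict_space)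
  from measurable_compose[OF this measurable_predictable_map[OF \<nu> N Q]] show ?thesis by simp
qed


lemma emeasure_predictable_section:
  fixes \<nu> :: "'a::euclidean_space measure" and G :: "((real \<times> 'w) \<times> 'a \<times> 'a) set"
  assumes \<nu>: "sets \<nu> = sets borel" and N: "poisson_random_measure M (noise_intensity \<nu>) N"
    and Q: "sets Q = sets (noise_intensity \<nu>)" and \<omega>: "\<omega> \<in> space M"
    and E: "E \<subseteq> {0<..} \<times> UNIV" "E \<in> sets Q"
    and G: "G \<in> sets (noise_predictable M N)"
  shows "emeasure (distr (restrict_space Q E) (noise_predictable M N) (\<lambda>z. ((fst z, \<omega>), snd z))) G
    = emeasure Q {z \<in> E. ((fst z, \<omega>), snd z) \<in> G}"
proof -
  have sp: "space (restrict_space Q E) = E"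
    using sets.sets_into_space[OF E(2)] by (auto simp: space_restrict_space)
  have "emeasure (distr (restrict_space Q E) (noise_predictable M N) (\<lambda>z. ((fst z, \<omega>), snd z))) G
      = emeasure (restrict_space Q E) ((\<lambda>z. ((fst z, \<omega>), snd z)) -` G \<inter> E)"
    using emeasure_distr[OF predictable_section_measurable[OF \<nu> N Q \<omega> E(1)] G] unfolding sp .
  also have "\<dots> = emeasure Q ((\<lambda>z. ((fst z, \<omega>), snd z)) -` G \<inter> E)"
    using E(2) by (intro emeasure_restrict_space) auto
  also have "(\<lambda>z. ((fst z, \<omega>), snd z)) -` G \<inter> E = {z \<in> E. ((fst z, \<omega>), snd z) \<in> G}" by auto
  finally show ?thesis .
qed

lemma nn_integral_predictable_section:
  fixes \<nu> :: "'a::euclidean_space measure" and g :: "((real \<times> 'w) \<times> 'a \<times> 'a) \<Rightarrow> ennreal"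
  assumes \<nu>: "sets \<nu> = sets borel" and N: "poisson_random_measure M (noise_intensity \<nu>) N"
    and Q: "sets Q = sets (noise_intensity \<nu>)" and \<omega>: "\<omega> \<in> space M"
    and E: "E \<subseteq> {0<..} \<times> UNIV" "E \<in> sets Q"
    and g: "g \<in> borel_measurable (noise_predictable M N)"
  shows "(\<integral>\<^sup>+y. g y \<partial>distr (restrict_space Q E) (noise_predictable M N) (\<lambda>z. ((fst z, \<omega>), snd z)))
    = (\<integral>\<^sup>+z. g ((fst z, \<omega>), snd z) * indicator E z \<partial>Q)"
  using E(2) g
  by (subst nn_integral_distr[OF predictable_section_measurable[OF \<nu> N Q \<omega> E(1)]])
     (auto intro!: nn_integral_restrict_space)

text \<open>The noise and its intensity, both restricted to \<open>E\<close>, are transported to the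
  predictable space by attaching the sample point to each point. The two resulting kernels have
  equal mean mass on a predictable rectangle, because the noise after time \<open>a\<close> is
  independent of the past up to \<open>a\<close>. Uniqueness from the pi-system then gives equal
  means for every predictable integrand.\<close>

lemma compensation_local:
  fixes \<nu> :: "'a::euclidean_space measure" and g :: "((real \<times> 'w) \<times> 'a \<times> 'a) \<Rightarrow> ennreal"
  assumes \<nu>: "sets \<nu> = sets borel" and N: "poisson_random_measure M (noise_intensity \<nu>) N"
    and E: "E \<subseteq> {0<..} \<times> UNIV" "E \<in> sets borel" "emeasure (noise_intensity \<nu>) E < \<infinity>"
    and W: "W \<in> sets M" "AE \<omega> in M. \<omega> \<in> W" "\<And>\<omega>. \<omega> \<in> W \<Longrightarrow> emeasure (N \<omega>) E < \<infinity>"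
    and g: "g \<in> borel_measurable (noise_predictable M N)"
  shows "(\<lambda>\<omega>. (\<integral>\<^sup>+z. g ((fst z, \<omega>), snd z) * indicator E z \<partial>N \<omega>) * indicator W \<omega>) \<in> borel_measurable M"
    "(\<integral>\<^sup>+\<omega>. (\<integral>\<^sup>+z. g ((fst z, \<omega>), snd z) * indicator E z \<partial>N \<omega>) * indicator W \<omega> \<partial>M)
      = (\<integral>\<^sup>+\<omega>. \<integral>\<^sup>+z. g ((fst z, \<omega>), snd z) * indicator E z \<partial>noise_intensity \<nu> \<partial>M)"
proof -
  interpret prob_space M using N by (simp add: poisson_random_measure_def)
  let ?\<mu> = "noise_intensity \<nu>" and ?S = "noise_predictable M N :: ((real \<times> 'w) \<times> 'a \<times> 'a) measure"
  define T where "T Q \<omega> = distr (restrict_space Q E) ?S (\<lambda>z. ((fst z, \<omega>), snd z))" for Q \<omega>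
  \<comment> \<open>Uniqueness of kernels asks for finite mass at every sample point; the noise
    kernel is therefore replaced by the null measure off the almost sure event
    \<open>W\<close>.\<close>
  define K1 where "K1 \<omega> = (if \<omega> \<in> W then T (N \<omega>) \<omega> else null_measure ?S)" for \<omega>
  define K2 where "K2 = T ?\<mu>"
  have E\<mu>: "E \<in> sets ?\<mu>" using E by (intro sets_noise_intensityI[OF \<nu>]) auto
  have sN: "sets (N \<omega>) = sets ?\<mu>" if "\<omega> \<in> space M" for \<omega>
    using N that by (simp add: poisson_random_measure_def)
  have WM: "\<omega> \<in> space M" if "\<omega> \<in> W" for \<omega> using that sets.sets_into_space[OF W(1)] by auto
  have k1: "emeasure (K1 \<omega>) G = emeasure (N \<omega>) {z \<in> E. ((fst z, \<omega>), snd z) \<in> G} * indicator W \<omega>"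
    if "\<omega> \<in> space M" "G \<in> sets ?S" for \<omega> G
    using emeasure_predictable_section[OF \<nu> N sN[OF that(1)] that(1) E(1) _ that(2)] E\<mu> sN[OF that(1)]
    by (simp add: K1_def T_def)
  have k2: "emeasure (K2 \<omega>) G = emeasure ?\<mu> {z \<in> E. ((fst z, \<omega>), snd z) \<in> G}"
    if "\<omega> \<in> space M" "G \<in> sets ?S" for \<omega> G
    unfolding K2_def T_def by (rule emeasure_predictable_section[OF \<nu> N refl that(1) E(1) E\<mu> that(2)])
  \<comment> \<open>The computation common to the whole space and to rectangles: the section of
    \<open>G\<close> inside \<open>E\<close> is a fixed set \<open>D\<close> on an event
    \<open>A\<close> independent of the count of \<open>D\<close>, and is empty off
    \<open>A\<close>.\<close>
  have key: "(\<lambda>\<omega>. emeasure (K1 \<omega>) G) \<in> borel_measurable M \<and> (\<lambda>\<omega>. emeasure (K2 \<omega>) G) \<in> borel_measurable M \<and>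
      (\<integral>\<^sup>+\<omega>. emeasure (K1 \<omega>) G \<partial>M) = (\<integral>\<^sup>+\<omega>. emeasure (K2 \<omega>) G \<partial>M) \<and> (\<integral>\<^sup>+\<omega>. emeasure (K1 \<omega>) G \<partial>M) < \<infinity>"
    if G: "G \<in> sets ?S" and A: "A \<in> sets M" and D: "D \<in> sets ?\<mu>" "D \<subseteq> E"
      and eq: "\<And>\<omega>. \<omega> \<in> space M \<Longrightarrow> {z \<in> E. ((fst z, \<omega>), snd z) \<in> G} = (if \<omega> \<in> A then D else {})"
      and indep: "\<And>Y. Y \<in> sets borel \<Longrightarrow> measure M (A \<inter> {\<omega> \<in> space M. emeasure (N \<omega>) D \<in> Y})
           = measure M A * measure M {\<omega> \<in> space M. emeasure (N \<omega>) D \<in> Y}" for G A D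
  proof -
    note [measurable] = emeasure_poisson_measurable[OF N D(1)] A W(1)
    have Dfin: "emeasure ?\<mu> D < \<infinity>"
      by (rule le_less_trans[OF emeasure_mono[OF D(2) E\<mu>] E(3)])
    have e1: "emeasure (K1 \<omega>) G = indicator A \<omega> * emeasure (N \<omega>) D * indicator W \<omega>" if "\<omega> \<in> space M" for \<omega>
      unfolding k1[OF that G] eq[OF that] by simp
    have e2: "emeasure (K2 \<omega>) G = indicator A \<omega> * emeasure ?\<mu> D" if "\<omega> \<in> space M" for \<omega>
      unfolding k2[OF that G] eq[OF that] by simp
    have "(\<integral>\<^sup>+\<omega>. emeasure (K1 \<omega>) G \<partial>M) = (\<integral>\<^sup>+\<omega>. indicator A \<omega> * emeasure (N \<omega>) D \<partial>M)"
    proof (rule nn_integral_cong_AE)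
      show "AE \<omega> in M. emeasure (K1 \<omega>) G = indicator A \<omega> * emeasure (N \<omega>) D"
        using W(2) AE_space by eventually_elim (simp add: e1)
    qed
    also have "\<dots> = emeasure M A * emeasure ?\<mu> D"
      by (rule poisson_nn_integral[OF N D(1) Dfin A indep])
    finally have i1: "(\<integral>\<^sup>+\<omega>. emeasure (K1 \<omega>) G \<partial>M) = emeasure M A * emeasure ?\<mu> D" .
    have i2: "(\<integral>\<^sup>+\<omega>. emeasure (K2 \<omega>) G \<partial>M) = emeasure M A * emeasure ?\<mu> D"
      using A by (simp add: e2 nn_integral_multc cong: nn_integral_cong)
    have "emeasure M A * emeasure ?\<mu> D < \<infinity>"
      using Dfin by (simp add: ennreal_mult_less_top emeasure_eq_measure)
    moreover have "(\<lambda>\<omega>. emeasure (K1 \<omega>) G) \<in> borel_measurable M \<longleftrightarrow>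
        (\<lambda>\<omega>. indicator A \<omega> * emeasure (N \<omega>) D * indicator W \<omega>) \<in> borel_measurable M"
      by (rule measurable_cong[OF e1])
    moreover have "(\<lambda>\<omega>. emeasure (K2 \<omega>) G) \<in> borel_measurable M \<longleftrightarrow>
        (\<lambda>\<omega>. indicator A \<omega> * emeasure ?\<mu> D) \<in> borel_measurable M"
      by (rule measurable_cong[OF e2])
    ultimately show ?thesis unfolding i1 i2 by simp
  qed
  have key': "(\<lambda>\<omega>. emeasure (K1 \<omega>) G) \<in> borel_measurable M \<and> (\<lambda>\<omega>. emeasure (K2 \<omega>) G) \<in> borel_measurable M \<and>
      (\<integral>\<^sup>+\<omega>. emeasure (K1 \<omega>) G \<partial>M) = (\<integral>\<^sup>+\<omega>. emeasure (K2 \<omega>) G \<partial>M) \<and> (\<integral>\<^sup>+\<omega>. emeasure (K1 \<omega>) G \<partial>M) < \<infinity>"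
    if "G \<in> insert (space ?S) (predictable_rectangles M N)" for G
  \<comment> \<open>The whole space needs its own case: its time interval is unbounded, so it is no
    predictable rectangle. There \<open>A\<close> is the sure event and \<open>D\<close> is
    \<open>E\<close>.\<close>
  proof (cases "G = space ?S")
    case True
    show ?thesis
    proof (rule key)
      show "{z \<in> E. ((fst z, \<omega>), snd z) \<in> G} = (if \<omega> \<in> space M then E else {})" if "\<omega> \<in> space M" for \<omega>
        using that E(1) unfolding True space_noise_predictable by auto
      show "measure M (space M \<inter> {\<omega> \<in> space M. emeasure (N \<omega>) E \<in> Y})
           = measure M (space M) * measure M {\<omega> \<in> space M. emeasure (N \<omega>) E \<in> Y}" for Y
        by (simp add: prob_space Int_absorb1)
    qed (use True E\<mu> in auto)
  next
    case False
    then have G: "G \<in> predictable_rectangles M N" using that by simp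
    then obtain a b A C where R: "G = ({a<..b} \<times> A) \<times> C" "0 \<le> a" "A \<in> sets (noise_filtration M N a)" "C \<in> sets borel"
      by (rule predictable_rectanglesE)
    have "{a<..b} \<times> C \<in> sets (borel \<Otimes>\<^sub>M borel)" using R(4) by (intro pair_measureI) auto
    then have "{a<..b} \<times> C \<in> sets borel" by (simp only: borel_prod)
    then have D: "E \<inter> ({a<..b} \<times> C) \<in> sets ?\<mu>"
      using E by (intro sets_noise_intensityI[OF \<nu>]) auto
    show ?thesis
    proof (rule key[OF _ _ D])
      show "G \<in> sets ?S" unfolding sets_noise_predictable using G by (rule sigma_sets.Basic)
      show "A \<in> sets M" using R(3) sets_noise_filtration_subset[OF \<nu> N] by blast
      show "{z \<in> E. ((fst z, \<omega>), snd z) \<in> G} = (if \<omega> \<in> A then E \<inter> ({a<..b} \<times> C) else {})" for \<omega>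
        unfolding R(1) by auto
      \<comment> \<open>The set \<open>D\<close> has no points with time in \<open>[0, a]\<close>,
        as \<open>a\<close> is excluded from the interval; hence its count is independent of the
        past of \<open>a\<close>.\<close>
      show "measure M (A \<inter> {\<omega> \<in> space M. emeasure (N \<omega>) (E \<inter> ({a<..b} \<times> C)) \<in> Y})
           = measure M A * measure M {\<omega> \<in> space M. emeasure (N \<omega>) (E \<inter> ({a<..b} \<times> C)) \<in> Y}" if "Y \<in> sets borel" for Y
        by (rule noise_filtration_indep[OF \<nu> N R(3) D _ that]) auto
    qed simp
  qed
  have sK: "sets (K1 \<omega>) = sets ?S" "sets (K2 \<omega>) = sets ?S" for \<omega>
    by (auto simp: K1_def K2_def T_def)
  have Etop: "{z \<in> E. ((fst z, \<omega>), snd z) \<in> space ?S} = E" if "\<omega> \<in> space M" for \<omega>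
    using that E(1) unfolding space_noise_predictable by auto
  have unique: "(\<lambda>\<omega>. emeasure (K1 \<omega>) G) \<in> borel_measurable M \<and> (\<lambda>\<omega>. emeasure (K2 \<omega>) G) \<in> borel_measurable M \<and>
      (\<integral>\<^sup>+\<omega>. emeasure (K1 \<omega>) G \<partial>M) = (\<integral>\<^sup>+\<omega>. emeasure (K2 \<omega>) G \<partial>M)" if "G \<in> sets ?S" for G
  proof (rule kernel_emeasure_unique[OF Int_stable_predictable_rectangles predictable_rectangles_subset
        sets_noise_predictable sK(1) _ sK(2)])
    show "emeasure (K1 \<omega>) (space ?S) < \<infinity>" if "\<omega> \<in> space M" for \<omega>
      unfolding k1[OF that sets.top] Etop[OF that] using W(3)[of \<omega>] by (cases "\<omega> \<in> W") auto
    show "emeasure (K2 \<omega>) (space ?S) < \<infinity>" if "\<omega> \<in> space M" for \<omega>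
      unfolding k2[OF that sets.top] Etop[OF that] by (rule E(3))
    show "(\<integral>\<^sup>+\<omega>. emeasure (K1 \<omega>) (space ?S) \<partial>M) < \<infinity>" using key'[OF insertI1] by blast
  qed (use key' that in blast)+
  have u: "(\<lambda>\<omega>. \<integral>\<^sup>+y. g y \<partial>K1 \<omega>) \<in> borel_measurable M \<and> (\<lambda>\<omega>. \<integral>\<^sup>+y. g y \<partial>K2 \<omega>) \<in> borel_measurable M \<and>
      (\<integral>\<^sup>+\<omega>. \<integral>\<^sup>+y. g y \<partial>K1 \<omega> \<partial>M) = (\<integral>\<^sup>+\<omega>. \<integral>\<^sup>+y. g y \<partial>K2 \<omega> \<partial>M)"
    by (rule kernel_nn_integral_unique[OF sK unique g])
  have i1: "(\<integral>\<^sup>+y. g y \<partial>K1 \<omega>) = (\<integral>\<^sup>+z. g ((fst z, \<omega>), snd z) * indicator E z \<partial>N \<omega>) * indicator W \<omega>"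
    if "\<omega> \<in> space M" for \<omega>
    using nn_integral_predictable_section[OF \<nu> N sN[OF that] that E(1) _ g] E\<mu> sN[OF that]
    by (cases "\<omega> \<in> W") (simp_all add: K1_def T_def nn_integral_null_measure)
  have i2: "(\<integral>\<^sup>+y. g y \<partial>K2 \<omega>) = (\<integral>\<^sup>+z. g ((fst z, \<omega>), snd z) * indicator E z \<partial>?\<mu>)"
    if "\<omega> \<in> space M" for \<omega>
    unfolding K2_def T_def by (rule nn_integral_predictable_section[OF \<nu> N refl that E(1) E\<mu> g])
  show "(\<lambda>\<omega>. (\<integral>\<^sup>+z. g ((fst z, \<omega>), snd z) * indicator E z \<partial>N \<omega>) * indicator W \<omega>) \<in> borel_measurable M"
  proof -
    have "(\<lambda>\<omega>. \<integral>\<^sup>+y. g y \<partial>K1 \<omega>) \<in> borel_measurable M \<longleftrightarrow>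
        (\<lambda>\<omega>. (\<integral>\<^sup>+z. g ((fst z, \<omega>), snd z) * indicator E z \<partial>N \<omega>) * indicator W \<omega>) \<in> borel_measurable M"
      by (rule measurable_cong[OF i1])
    then show ?thesis using u by blast
  qed
  have "(\<integral>\<^sup>+\<omega>. (\<integral>\<^sup>+z. g ((fst z, \<omega>), snd z) * indicator E z \<partial>N \<omega>) * indicator W \<omega> \<partial>M) = (\<integral>\<^sup>+\<omega>. \<integral>\<^sup>+y. g y \<partial>K1 \<omega> \<partial>M)"
    by (rule nn_integral_cong) (simp add: i1)
  also have "\<dots> = (\<integral>\<^sup>+\<omega>. \<integral>\<^sup>+y. g y \<partial>K2 \<omega> \<partial>M)" using u by auto
  also have "\<dots> = (\<integral>\<^sup>+\<omega>. \<integral>\<^sup>+z. g ((fst z, \<omega>), snd z) * indicator E z \<partial>?\<mu> \<partial>M)"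
    by (rule nn_integral_cong) (simp add: i2)
  finally show "(\<integral>\<^sup>+\<omega>. (\<integral>\<^sup>+z. g ((fst z, \<omega>), snd z) * indicator E z \<partial>N \<omega>) * indicator W \<omega> \<partial>M)
      = (\<integral>\<^sup>+\<omega>. \<integral>\<^sup>+z. g ((fst z, \<omega>), snd z) * indicator E z \<partial>?\<mu> \<partial>M)" .
qed


section \<open>From finite intensity to all positive times\<close>

lemma noise_exhaustion:
  fixes \<nu> :: "'a::euclidean_space measure"
  assumes \<nu>: "sets \<nu> = sets borel" and sf: "sigma_finite_measure \<nu>"
  obtains E :: "nat \<Rightarrow> (real \<times> 'a \<times> 'a) set" where "incseq E" "\<And>n. E n \<in> sets borel"
    "\<And>n. emeasure (noise_intensity \<nu>) (E n) < \<infinity>" "(\<Union>n. E n) = {0<..} \<times> UNIV"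
proof -
  interpret \<nu>: sigma_finite_measure \<nu> by fact
  interpret pp: sigma_finite_measure "(lborel :: 'a measure) \<Otimes>\<^sub>M \<nu>"
    by (rule sigma_finite_pair_measure[OF lborel.sigma_finite_measure_axioms sf])
  have sets_pair: "sets ((lborel :: 'a measure) \<Otimes>\<^sub>M \<nu>) = sets borel"
    using sets_pair_measure_cong[OF sets_lborel \<nu>] by (simp only: borel_prod)
  obtain C :: "nat \<Rightarrow> ('a \<times> 'a) set" where C: "range C \<subseteq> sets (lborel \<Otimes>\<^sub>M \<nu>)" "(\<Union>i. C i) = space (lborel \<Otimes>\<^sub>M \<nu>)"
    "\<And>i. emeasure (lborel \<Otimes>\<^sub>M \<nu>) (C i) \<noteq> \<infinity>" "incseq C"
    using pp.sigma_finite_incseq by metis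
  show ?thesis
  proof
    \<comment> \<open>Bounded time intervals times an exhaustion of the product of space and marks
      by sets of finite measure. Both factors increase, as the later monotone convergence requires,
      and time 0 stays excluded.\<close>
    let ?E = "\<lambda>n. {0<..real n} \<times> C n"
    show "incseq ?E" using C(4) by (fastforce simp: incseq_def)
    show "?E n \<in> sets borel" for n
    proof -
      have "C n \<in> sets borel" using C(1) sets_pair by auto
      then have "?E n \<in> sets (borel \<Otimes>\<^sub>M borel)" by (intro pair_measureI) auto
      then show ?thesis by (simp only: borel_prod)
    qed
    have "emeasure (noise_intensity \<nu>) (?E n) = emeasure (restrict_space lborel {0..}) {0<..real n} * emeasure (lborel \<Otimes>\<^sub>M \<nu>) (C n)" for n
      unfolding noise_intensity_def using C(1)
      by (intro pp.emeasure_pair_measure_Times) (auto simp: sets_restrict_space_iff)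
    also have "\<dots> n = ennreal (real n) * emeasure (lborel \<Otimes>\<^sub>M \<nu>) (C n)" for n
      by (subst emeasure_restrict_space) auto
    also have "\<dots> n < \<infinity>" for n
      using C(3)[of n] by (simp add: ennreal_mult_less_top less_top)
    finally show "emeasure (noise_intensity \<nu>) (?E n) < \<infinity>" for n .
    show "(\<Union>n. ?E n) = {0<..} \<times> UNIV"
    proof (intro equalityI subsetI)
      fix z :: "real \<times> 'a \<times> 'a" assume "z \<in> {0<..} \<times> UNIV"
      then obtain s c where z: "z = (s, c)" "0 < s" by auto
      have "c \<in> (\<Union>i. C i)" unfolding C(2) using sets_eq_imp_space_eq[OF sets_pair] by simp
      then obtain i where i: "c \<in> C i" by auto
      obtain j :: nat where j: "s \<le> real j" using real_arch_simple by auto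
      have "c \<in> C (max i j)" using incseqD[OF C(4), of i "max i j"] i by auto
      then show "z \<in> (\<Union>n. ?E n)" using z j by (intro UN_I[of "max i j"]) auto
    qed auto
  qed
qed

lemma nn_integral_noise_intensity:
  fixes \<nu> :: "'a::euclidean_space measure"
  assumes \<nu>: "sets \<nu> = sets borel" and sf: "sigma_finite_measure \<nu>"
    and \<phi>: "\<phi> \<in> borel_measurable (noise_intensity \<nu>)" and zero: "\<And>z. fst z \<le> 0 \<Longrightarrow> \<phi> z = 0"
  shows "(\<integral>\<^sup>+z. \<phi> z \<partial>noise_intensity \<nu>) = (\<integral>\<^sup>+s\<in>{0<..}. (\<integral>\<^sup>+y. \<integral>\<^sup>+h. \<phi> (s, y, h) \<partial>\<nu> \<partial>lborel) \<partial>lborel)"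
proof -
  interpret \<nu>: sigma_finite_measure \<nu> by fact
  interpret pp: sigma_finite_measure "(lborel :: 'a measure) \<Otimes>\<^sub>M \<nu>"
    by (rule sigma_finite_pair_measure[OF lborel.sigma_finite_measure_axioms sf])
  let ?R = "restrict_space lborel {0..} :: real measure"
  have m: "\<phi> \<in> borel_measurable (?R \<Otimes>\<^sub>M (lborel \<Otimes>\<^sub>M \<nu>))" using \<phi> by (simp add: noise_intensity_def)
  have "(\<integral>\<^sup>+z. \<phi> z \<partial>noise_intensity \<nu>) = (\<integral>\<^sup>+s. \<integral>\<^sup>+z. \<phi> (s, z) \<partial>(lborel \<Otimes>\<^sub>M \<nu>) \<partial>?R)"
    unfolding noise_intensity_def by (rule pp.nn_integral_fst[OF m, symmetric])
  also have "\<dots> = (\<integral>\<^sup>+s. \<integral>\<^sup>+y. \<integral>\<^sup>+h. \<phi> (s, y, h) \<partial>\<nu> \<partial>lborel \<partial>?R)"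
    by (intro nn_integral_cong \<nu>.nn_integral_fst[symmetric] measurable_compose[OF measurable_Pair1' m]) simp
  also have "\<dots> = (\<integral>\<^sup>+s\<in>{0..}. (\<integral>\<^sup>+y. \<integral>\<^sup>+h. \<phi> (s, y, h) \<partial>\<nu> \<partial>lborel) \<partial>lborel)"
    by (rule nn_integral_restrict_space) simp
  also have "\<dots> = (\<integral>\<^sup>+s\<in>{0<..}. (\<integral>\<^sup>+y. \<integral>\<^sup>+h. \<phi> (s, y, h) \<partial>\<nu> \<partial>lborel) \<partial>lborel)"
    by (rule nn_integral_cong) (auto simp: zero split: split_indicator)
  finally show ?thesis .
qed

text \<open>The formula says that a predictable integrand has the same mean against the noise as
  against its intensity. It is phrased through a measurable \<open>H\<close> because the integral
  against \<open>N\<close> is only shown to be measurable on the event where all sets of the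
  exhaustion have finite count; \<open>H\<close> is its version that vanishes elsewhere.\<close>

lemma compensation_formula:
  fixes \<nu> :: "'a::euclidean_space measure" and f :: "real \<Rightarrow> 'a \<times> 'a \<Rightarrow> 'w \<Rightarrow> real"
  assumes \<nu>: "sets \<nu> = sets borel" and sf: "sigma_finite_measure \<nu>"
    and N: "poisson_random_measure M (noise_intensity \<nu>) N"
    and f: "predictable_field M N f"
  obtains H where "H \<in> borel_measurable M"
    "AE \<omega> in M. (\<integral>\<^sup>+z. ennreal \<bar>f (fst z) (snd z) \<omega>\<bar> * indicator ({0<..} \<times> UNIV) z \<partial>N \<omega>) = H \<omega>"
    "(\<integral>\<^sup>+\<omega>. H \<omega> \<partial>M) = (\<integral>\<^sup>+s\<in>{0<..}. (\<integral>\<^sup>+y. \<integral>\<^sup>+h. \<integral>\<^sup>+\<omega>. ennreal \<bar>f s (y, h) \<omega>\<bar> \<partial>M \<partial>\<nu> \<partial>lborel) \<partial>lborel)"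
proof -
  interpret prob_space M using N by (simp add: poisson_random_measure_def)
  let ?\<mu> = "noise_intensity \<nu>"
  define g where "g = (\<lambda>((s, \<omega>), z). ennreal \<bar>f s z \<omega>\<bar>)"
  have g: "g \<in> borel_measurable (noise_predictable M N)"
  proof -
    have "(\<lambda>x. ennreal \<bar>(\<lambda>((s, \<omega>), z). f s z \<omega>) x\<bar>) \<in> borel_measurable (noise_predictable M N)"
      using f unfolding predictable_field_def by measurable
    also have "(\<lambda>x. ennreal \<bar>(\<lambda>((s, \<omega>), z). f s z \<omega>) x\<bar>) = g" by (auto simp: g_def fun_eq_iff)
    finally show ?thesis .
  qed
  have sN: "sets (N \<omega>) = sets ?\<mu>" if "\<omega> \<in> space M" for \<omega>
    using N that by (simp add: poisson_random_measure_def)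
  obtain E where E: "incseq E" "\<And>n. E n \<in> sets borel" "\<And>n. emeasure ?\<mu> (E n) < \<infinity>" "(\<Union>n. E n) = {0<..} \<times> UNIV"
    using noise_exhaustion[OF \<nu> sf] by blast
  have Esub: "E n \<subseteq> {0<..} \<times> UNIV" for n using E(4) by blast
  have E\<mu>: "E n \<in> sets ?\<mu>" for n
    using Esub[of n] by (intro sets_noise_intensityI[OF \<nu>] E) auto
  define W where "W = {\<omega> \<in> space M. \<forall>n. emeasure (N \<omega>) (E n) < \<infinity>}"
  note [measurable] = emeasure_poisson_measurable[OF N E\<mu>]
  have W: "W \<in> sets M" unfolding W_def by measurable
  have AEW: "AE \<omega> in M. \<omega> \<in> W"
  proof -
    have "AE \<omega> in M. \<forall>n. emeasure (N \<omega>) (E n) < \<infinity>"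
      unfolding AE_all_countable
    proof
      fix n
      show "AE \<omega> in M. emeasure (N \<omega>) (E n) < \<infinity>"
        using poisson_AE_nat[OF N E\<mu> E(3)[of n]] by eventually_elim (elim exE, simp only: of_nat_less_top infinity_ennreal_def)
    qed
    with AE_space show ?thesis by eventually_elim (simp add: W_def)
  qed
  \<comment> \<open>The indicator supplies the value 0 at time 0, where predictability of
    \<open>g\<close> carries no information, so that integrals over all of \<open>Q\<close> make
    sense.\<close>
  let ?w = "\<lambda>\<omega> z. g ((fst z, \<omega>), snd z) * indicator ({0<..} \<times> UNIV) z"
  have split: "?w \<omega> z * indicator (E n) z = g ((fst z, \<omega>), snd z) * indicator (E n) z" for \<omega> z n
    using Esub[of n] by (auto split: split_indicator)
  have inc: "incseq (\<lambda>n z. ?w \<omega> z * indicator (E n) z)" for \<omega>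
    using E(1) by (auto simp: incseq_def le_fun_def split: split_indicator)
  have sup: "(SUP n. ?w \<omega> z * indicator (E n) z) = ?w \<omega> z" for \<omega> z
  proof (cases "z \<in> {0<..} \<times> UNIV")
    case True
    then obtain n where n: "z \<in> E n" using E(4) by blast
    show ?thesis
      by (rule antisym, rule SUP_least, simp add: indicator_def, rule SUP_upper2[of n]) (use n in auto)
  qed simp
  have joint: "(\<lambda>(\<omega>, z). ?w \<omega> z) \<in> borel_measurable (M \<Otimes>\<^sub>M Q)" if "sets Q = sets ?\<mu>" for Q
    by (rule measurable_predictable_joint[OF \<nu> N that g])
  have sect: "?w \<omega> \<in> borel_measurable Q" if "sets Q = sets ?\<mu>" "\<omega> \<in> space M" for Q \<omega>
    using measurable_compose[OF measurable_Pair1'[OF that(2)] joint[OF that(1)]] by simp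
  have conv: "(\<integral>\<^sup>+z. ?w \<omega> z \<partial>Q) = (SUP n. \<integral>\<^sup>+z. ?w \<omega> z * indicator (E n) z \<partial>Q)"
    if "sets Q = sets ?\<mu>" "\<omega> \<in> space M" for Q \<omega>
    using nn_integral_monotone_convergence_SUP[OF inc, of \<omega> Q] sect[OF that] E\<mu> that(1) unfolding sup by simp
  define H where "H n \<omega> = (\<integral>\<^sup>+z. ?w \<omega> z * indicator (E n) z \<partial>N \<omega>) * indicator W \<omega>" for n \<omega>
  have local: "H n \<in> borel_measurable M"
    "(\<integral>\<^sup>+\<omega>. H n \<omega> \<partial>M) = (\<integral>\<^sup>+\<omega>. \<integral>\<^sup>+z. ?w \<omega> z * indicator (E n) z \<partial>?\<mu> \<partial>M)" for n
    unfolding H_def split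
    by (rule compensation_local[OF \<nu> N Esub E(2,3) W AEW _ g], simp add: W_def)+
  have Hinc: "incseq H"
  proof -
    have "(\<integral>\<^sup>+z. ?w \<omega> z * indicator (E m) z \<partial>N \<omega>) \<le> (\<integral>\<^sup>+z. ?w \<omega> z * indicator (E n) z \<partial>N \<omega>)" if "m \<le> n" for m n \<omega>
      using inc[of \<omega>] that by (intro nn_integral_mono) (auto simp: incseq_def le_fun_def)
    then show ?thesis by (auto simp: incseq_def le_fun_def H_def intro!: mult_right_mono)
  qed
  interpret \<nu>: sigma_finite_measure \<nu> by fact
  interpret pp: sigma_finite_measure "(lborel :: 'a measure) \<Otimes>\<^sub>M \<nu>"
    by (rule sigma_finite_pair_measure[OF lborel.sigma_finite_measure_axioms sf])
  have "sigma_finite_measure (restrict_space lborel {0..} :: real measure)"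
    by (rule sigma_finite_measure_restrict_space[OF lborel.sigma_finite_measure_axioms]) simp
  then interpret \<mu>: sigma_finite_measure ?\<mu>
    unfolding noise_intensity_def by (rule sigma_finite_pair_measure) (rule pp.sigma_finite_measure_axioms)
  interpret M\<mu>: pair_sigma_finite M ?\<mu> ..
  have "(\<integral>\<^sup>+\<omega>. (SUP n. H n \<omega>) \<partial>M) = (SUP n. \<integral>\<^sup>+\<omega>. H n \<omega> \<partial>M)"
    by (rule nn_integral_monotone_convergence_SUP[OF Hinc local(1)])
  also have "\<dots> = (SUP n. \<integral>\<^sup>+\<omega>. \<integral>\<^sup>+z. ?w \<omega> z * indicator (E n) z \<partial>?\<mu> \<partial>M)" unfolding local(2) ..
  also have "\<dots> = (\<integral>\<^sup>+\<omega>. (SUP n. \<integral>\<^sup>+z. ?w \<omega> z * indicator (E n) z \<partial>?\<mu>) \<partial>M)"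
  proof (rule nn_integral_monotone_convergence_SUP[symmetric])
    show "incseq (\<lambda>n \<omega>. \<integral>\<^sup>+z. ?w \<omega> z * indicator (E n) z \<partial>?\<mu>)"
      using inc by (auto simp: incseq_def le_fun_def intro!: nn_integral_mono)
    show "(\<lambda>\<omega>. \<integral>\<^sup>+z. ?w \<omega> z * indicator (E n) z \<partial>?\<mu>) \<in> borel_measurable M" for n
    proof -
      have "(\<lambda>x. (\<lambda>(\<omega>, z). ?w \<omega> z) x * indicator (E n) (snd x)) \<in> borel_measurable (M \<Otimes>\<^sub>M ?\<mu>)"
        using joint[OF refl] E\<mu>[of n] by measurable
      from \<mu>.borel_measurable_nn_integral_fst[OF this] show ?thesis by simp
    qed
  qed
  also have "\<dots> = (\<integral>\<^sup>+\<omega>. \<integral>\<^sup>+z. ?w \<omega> z \<partial>?\<mu> \<partial>M)"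
    by (rule nn_integral_cong) (simp add: conv)
  \<comment> \<open>Tonelli moves the expectation inside, to match the order of integration in
    \<open>noise_integrable\<close>. It is here that sigma-finiteness of the intensity is
    applied.\<close>
  also have "\<dots> = (\<integral>\<^sup>+z. \<integral>\<^sup>+\<omega>. ?w \<omega> z \<partial>M \<partial>?\<mu>)"
    by (rule M\<mu>.Fubini'[symmetric]) (rule joint[OF refl])
  also have "\<dots> = (\<integral>\<^sup>+s\<in>{0<..}. (\<integral>\<^sup>+y. \<integral>\<^sup>+h. \<integral>\<^sup>+\<omega>. ?w \<omega> (s, y, h) \<partial>M \<partial>\<nu> \<partial>lborel) \<partial>lborel)"
  proof (rule nn_integral_noise_intensity[OF \<nu> sf])
    have "(\<lambda>(z, \<omega>). ?w \<omega> z) \<in> borel_measurable (?\<mu> \<Otimes>\<^sub>M M)"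
      using measurable_pair_swap[OF joint[OF refl]] by (simp add: split_beta')
    then show "(\<lambda>z. \<integral>\<^sup>+\<omega>. ?w \<omega> z \<partial>M) \<in> borel_measurable ?\<mu>"
      by (rule borel_measurable_nn_integral)
  qed (auto simp: indicator_def)
  also have "\<dots> = (\<integral>\<^sup>+s\<in>{0<..}. (\<integral>\<^sup>+y. \<integral>\<^sup>+h. \<integral>\<^sup>+\<omega>. ennreal \<bar>f s (y, h) \<omega>\<bar> \<partial>M \<partial>\<nu> \<partial>lborel) \<partial>lborel)"
    by (intro nn_integral_cong) (auto simp: g_def split: split_indicator)
  finally have I: "(\<integral>\<^sup>+\<omega>. (SUP n. H n \<omega>) \<partial>M) =
    (\<integral>\<^sup>+s\<in>{0<..}. (\<integral>\<^sup>+y. \<integral>\<^sup>+h. \<integral>\<^sup>+\<omega>. ennreal \<bar>f s (y, h) \<omega>\<bar> \<partial>M \<partial>\<nu> \<partial>lborel) \<partial>lborel)" .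
  show ?thesis
  proof
    show "(\<lambda>\<omega>. SUP n. H n \<omega>) \<in> borel_measurable M" using local(1) by measurable
    show "AE \<omega> in M. (\<integral>\<^sup>+z. ennreal \<bar>f (fst z) (snd z) \<omega>\<bar> * indicator ({0<..} \<times> UNIV) z \<partial>N \<omega>) = (SUP n. H n \<omega>)"
      using AEW AE_space
    proof eventually_elim
      case (elim \<omega>)
      have "(\<integral>\<^sup>+z. ennreal \<bar>f (fst z) (snd z) \<omega>\<bar> * indicator ({0<..} \<times> UNIV) z \<partial>N \<omega>) = (\<integral>\<^sup>+z. ?w \<omega> z \<partial>N \<omega>)"
        by (simp add: g_def)
      also have "\<dots> = (SUP n. H n \<omega>)"
        unfolding conv[OF sN[OF elim(2)] elim(2)] H_def using elim(1) by simp
      finally show ?case .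
    qed
  qed (rule I)
qed

section \<open>Sums over the atoms of the noise\<close>


text \<open>An inequality for two reasons: the integral also sees points that are not in
  \<open>F\<close>, and \<open>measure\<close> turns an atom of infinite mass into 0.\<close>

lemma sum_atoms_le_nn_integral:
  assumes F: "finite F" "F \<subseteq> S" and sing: "\<And>z. z \<in> F \<Longrightarrow> {z} \<in> sets Q" and \<phi>: "\<And>z. 0 \<le> \<phi> z"
  shows "ennreal (\<Sum>z\<in>F. measure Q {z} * \<phi> z) \<le> (\<integral>\<^sup>+z. ennreal (\<phi> z) * indicator S z \<partial>Q)"
proof -
  have le: "ennreal (measure Q A) \<le> emeasure Q A" for A
    by (simp add: measure_def ennreal_enn2real_if)
  have "ennreal (\<Sum>z\<in>F. measure Q {z} * \<phi> z) = (\<Sum>z\<in>F. ennreal (\<phi> z) * ennreal (measure Q {z}))"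
    using \<phi> by (simp add: sum_ennreal[symmetric] ennreal_mult mult.commute)
  also have "\<dots> \<le> (\<Sum>z\<in>F. ennreal (\<phi> z) * emeasure Q {z})"
    by (intro sum_mono mult_left_mono le) simp
  also have "\<dots> = (\<Sum>z\<in>F. \<integral>\<^sup>+y. ennreal (\<phi> z) * indicator {z} y \<partial>Q)"
    using sing by (simp add: nn_integral_cmult_indicator)
  also have "\<dots> = (\<integral>\<^sup>+y. (\<Sum>z\<in>F. ennreal (\<phi> z) * indicator {z} y) \<partial>Q)"
    using sing by (intro nn_integral_sum[symmetric]) auto
  also have "\<dots> \<le> (\<integral>\<^sup>+z. ennreal (\<phi> z) * indicator S z \<partial>Q)"
  proof (rule nn_integral_mono)
    fix y
    have "(\<Sum>z\<in>F. ennreal (\<phi> z) * indicator {z} y) = (if y \<in> F then ennreal (\<phi> y) else 0)"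
      using F(1) by (simp add: indicator_def if_distrib[of "\<lambda>c. _ * c"] cong: if_cong)
    then show "(\<Sum>z\<in>F. ennreal (\<phi> z) * indicator {z} y) \<le> ennreal (\<phi> y) * indicator S y"
      using F(2) by auto
  qed
  finally show ?thesis .
qed

lemma abs_summable_atoms:
  fixes f :: "'z \<Rightarrow> real"
  assumes A: "A \<subseteq> S" and sing: "\<And>z. z \<in> A \<Longrightarrow> {z} \<in> sets Q"
    and fin: "(\<integral>\<^sup>+z. ennreal \<bar>f z\<bar> * indicator S z \<partial>Q) < \<infinity>"
  shows "(\<lambda>z. norm (measure Q {z} * f z)) summable_on A"
    "ennreal \<bar>\<Sum>\<^sub>\<infinity>z\<in>A. measure Q {z} * f z\<bar> \<le> (\<integral>\<^sup>+z. ennreal \<bar>f z\<bar> * indicator S z \<partial>Q)"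
proof -
  let ?I = "\<integral>\<^sup>+z. ennreal \<bar>f z\<bar> * indicator S z \<partial>Q"
  have I: "?I = ennreal (enn2real ?I)" using fin by simp
  have sums: "(\<Sum>z\<in>F. norm (measure Q {z} * f z)) \<le> enn2real ?I" if F: "F \<subseteq> A" "finite F" for F
  proof -
    have "ennreal (\<Sum>z\<in>F. measure Q {z} * \<bar>f z\<bar>) \<le> ?I"
      using that A sing by (intro sum_atoms_le_nn_integral) auto
    then have "(\<Sum>z\<in>F. measure Q {z} * \<bar>f z\<bar>) \<le> enn2real ?I"
      by (subst (asm) I) (simp add: ennreal_le_iff)
    then show ?thesis by (simp add: abs_mult)
  qed
  show *: "(\<lambda>z. norm (measure Q {z} * f z)) summable_on A"
    by (rule nonneg_bdd_above_summable_on) (use sums in \<open>auto simp: bdd_above_def\<close>)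
  have "\<bar>\<Sum>\<^sub>\<infinity>z\<in>A. measure Q {z} * f z\<bar> \<le> (\<Sum>\<^sub>\<infinity>z\<in>A. norm (measure Q {z} * f z))"
    using norm_infsum_bound[OF *] by simp
  also have "\<dots> \<le> enn2real ?I"
    using sums by (intro infsum_le_finite_sums[OF *]) auto
  finally show "ennreal \<bar>\<Sum>\<^sub>\<infinity>z\<in>A. measure Q {z} * f z\<bar> \<le> ?I"
    by (subst I) (rule ennreal_leI)
qed

text \<open>Both sums can be taken over the atoms up to \<open>t2\<close>, because \<open>f1\<close>
  vanishes from \<open>t1\<close> on. They are then subtracted atom by atom, so that cancellation
  between \<open>f1\<close> and \<open>f2\<close> is kept. If the right-hand side is infinite the
  claim is trivial.\<close>

lemma noise_integral_difference:
  fixes f1 f2 :: "real \<Rightarrow> 'a::euclidean_space \<times> 'a \<Rightarrow> 'w \<Rightarrow> real"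
  assumes sing: "\<And>z. 0 < fst z \<Longrightarrow> {z} \<in> sets (N \<omega>)" and null: "{0} \<times> UNIV \<in> null_sets (N \<omega>)"
    and t: "t1 \<le> t2" and zero: "\<And>s z. t1 \<le> s \<Longrightarrow> f1 s z \<omega> = 0"
    and fin1: "(\<integral>\<^sup>+z. ennreal \<bar>f1 (fst z) (snd z) \<omega>\<bar> * indicator ({0<..} \<times> UNIV) z \<partial>N \<omega>) < \<infinity>"
    and fin2: "(\<integral>\<^sup>+z. ennreal \<bar>f2 (fst z) (snd z) \<omega>\<bar> * indicator ({0<..} \<times> UNIV) z \<partial>N \<omega>) < \<infinity>"
  shows "ennreal \<bar>noise_integral N t2 f2 \<omega> - noise_integral N t1 f1 \<omega>\<bar> \<le>
    (\<integral>\<^sup>+z. ennreal \<bar>f2 (fst z) (snd z) \<omega> - f1 (fst z) (snd z) \<omega>\<bar> * indicator ({0<..} \<times> UNIV) z \<partial>N \<omega>)"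
    (is "_ \<le> ?I")
proof (cases "?I < \<infinity>")
  case True
  define AT where "AT t = {(s, z). 0 \<le> s \<and> s \<le> t \<and> emeasure (N \<omega>) {(s, z)} > 0}" for t
  let ?S = "{0<..} \<times> UNIV :: (real \<times> 'a \<times> 'a) set"
  \<comment> \<open>\<open>noise_integral\<close> admits atoms at time 0, the integrals here do not;
    a null slice at time 0 contains no atom of positive mass, which reconciles the two.\<close>
  have sub: "AT t \<subseteq> ?S" for t
  proof
    fix x assume "x \<in> AT t"
    then obtain s z where x: "x = (s, z)" "0 \<le> s" "emeasure (N \<omega>) {(s, z)} > 0" by (auto simp: AT_def)
    have "s \<noteq> 0"
    proof
      assume "s = 0"
      then have "emeasure (N \<omega>) {(s, z)} \<le> emeasure (N \<omega>) ({0} \<times> UNIV)"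
        using null by (intro emeasure_mono) auto
      then show False using x(3) null_setsD1[OF null] by simp
    qed
    then show "x \<in> ?S" using x by auto
  qed
  have sg: "{z} \<in> sets (N \<omega>)" if "z \<in> AT t" for z t
    using sub[of t] that by (intro sing) auto
  have ni: "noise_integral N t f \<omega> = (\<Sum>\<^sub>\<infinity>z\<in>AT t. measure (N \<omega>) {z} * f (fst z) (snd z) \<omega>)" for t f
    unfolding noise_integral_def AT_def by (simp add: split_beta')
  have "noise_integral N t1 f1 \<omega> = (\<Sum>\<^sub>\<infinity>z\<in>AT t2. measure (N \<omega>) {z} * f1 (fst z) (snd z) \<omega>)"
  proof -
    have "s \<le> t1 \<and> s \<le> t2" if "f1 s z \<omega> \<noteq> 0" for s z using zero[of s z] t that by (cases "t1 \<le> s") auto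
    then show ?thesis unfolding ni using t by (intro infsum_cong_neutral) (auto simp: AT_def)
  qed
  then have "noise_integral N t2 f2 \<omega> - noise_integral N t1 f1 \<omega> =
      (\<Sum>\<^sub>\<infinity>z\<in>AT t2. measure (N \<omega>) {z} * f2 (fst z) (snd z) \<omega>) - (\<Sum>\<^sub>\<infinity>z\<in>AT t2. measure (N \<omega>) {z} * f1 (fst z) (snd z) \<omega>)"
    unfolding ni by simp
  also have "\<dots> = (\<Sum>\<^sub>\<infinity>z\<in>AT t2. measure (N \<omega>) {z} * (f2 (fst z) (snd z) \<omega> - f1 (fst z) (snd z) \<omega>))"
  \<comment> \<open>\<open>infsum\<close> of a family that is not summable is 0 by convention, so
    linearity needs the summability that \<open>fin1\<close> and \<open>fin2\<close>
    provide.\<close>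
  proof -
    have "(\<lambda>z. measure (N \<omega>) {z} * f2 (fst z) (snd z) \<omega>) summable_on AT t2"
      "(\<lambda>z. measure (N \<omega>) {z} * f1 (fst z) (snd z) \<omega>) summable_on AT t2"
      by (rule abs_summable_summable, rule abs_summable_atoms(1)[OF sub sg], assumption, rule fin2,
          rule abs_summable_summable, rule abs_summable_atoms(1)[OF sub sg], assumption, rule fin1)
    then have "(\<lambda>z. measure (N \<omega>) {z} * f2 (fst z) (snd z) \<omega>) summable_on AT t2"
      "(\<lambda>z. - (measure (N \<omega>) {z} * f1 (fst z) (snd z) \<omega>)) summable_on AT t2"
      by (simp_all only: summable_on_uminus)
    from infsum_add[OF this] show ?thesis
      by (simp add: infsum_uminus right_diff_distrib)
  qed
  finally show ?thesis using abs_summable_atoms(2)[OF sub sg True] by simp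
qed (simp add: not_less top_unique)


text \<open>By Markov's inequality each level set where \<open>J\<close> is at least
  \<open>1 / (n + 1)\<close> has finite measure, and positivity of \<open>J\<close> makes these sets
  a cover. This is the source of sigma-finiteness for \<open>nu\<close>: integrability of the
  minimum of 1 and the squared norm does not control the mass at the origin.\<close>

lemma sigma_finite_of_positive_integrable:
  fixes J :: "'a \<Rightarrow> real"
  assumes [measurable]: "J \<in> borel_measurable \<nu>" and pos: "\<And>h. 0 < J h" and fin: "(\<integral>\<^sup>+h. ennreal (J h) \<partial>\<nu>) < \<infinity>"
  shows "sigma_finite_measure \<nu>"
proof
  define A where "A n = {h \<in> space \<nu>. 1 \<le> ennreal (real (Suc n)) * ennreal (J h)}" for n
  have [measurable]: "A n \<in> sets \<nu>" for n unfolding A_def by measurable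
  have "emeasure \<nu> (A n) \<noteq> \<infinity>" for n
  proof -
    have "emeasure \<nu> (A n) \<le> ennreal (real (Suc n)) * (\<integral>\<^sup>+h. ennreal (J h) * indicator (space \<nu>) h \<partial>\<nu>)"
      unfolding A_def by (rule order_trans[OF _ nn_integral_Markov_inequality])
        (auto intro!: emeasure_mono)
    also have "(\<integral>\<^sup>+h. ennreal (J h) * indicator (space \<nu>) h \<partial>\<nu>) = (\<integral>\<^sup>+h. ennreal (J h) \<partial>\<nu>)"
      by (rule nn_integral_cong) simp
    also have "ennreal (real (Suc n)) * \<dots> < \<infinity>"
      using fin by (simp add: ennreal_mult_less_top)
    finally show ?thesis by simp
  qed
  moreover have "(\<Union>n. A n) = space \<nu>"
  proof (intro equalityI subsetI)
    fix h assume h: "h \<in> space \<nu>"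
    obtain n where "inverse (real (Suc n)) < J h" using reals_Archimedean[OF pos[of h]] by auto
    then have "1 \<le> real (Suc n) * J h" by (simp add: divide_simps mult.commute)
    then have "1 \<le> ennreal (real (Suc n) * J h)" using ennreal_leI[of 1] by simp
    then have "1 \<le> ennreal (real (Suc n)) * ennreal (J h)" using pos[of h] by (subst (asm) ennreal_mult) auto
    then show "h \<in> (\<Union>n. A n)" using h by (auto simp: A_def)
  qed (auto simp: A_def)
  ultimately show "\<exists>A. countable A \<and> A \<subseteq> sets \<nu> \<and> \<Union>A = space \<nu> \<and> (\<forall>a\<in>A. emeasure \<nu> a \<noteq> \<infinity>)"
    by (intro exI[of _ "range A"]) auto
qed

lemma predictable_field_random_variable:
  fixes \<nu> :: "'a::euclidean_space measure" and f :: "real \<Rightarrow> 'b::topological_space \<Rightarrow> 'w \<Rightarrow> real"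
  assumes \<nu>: "sets \<nu> = sets borel" and N: "poisson_random_measure M (noise_intensity \<nu>) N"
    and f: "predictable_field M N f" and s: "0 < s"
  shows "f s z \<in> borel_measurable M"
proof -
  have "(\<lambda>\<omega>. (s, \<omega>)) \<in> M \<rightarrow>\<^sub>M predictable_sigma (space M) (noise_filtration M N)"
  proof (rule measurable_sigma_sets[where \<Omega>="{0<..} \<times> space M"
        and A="{{a<..b} \<times> A | a b A. 0 \<le> a \<and> a \<le> b \<and> A \<in> sets (noise_filtration M N a)}"])
    show "{{a<..b} \<times> A | a b A. 0 \<le> a \<and> a \<le> b \<and> A \<in> sets (noise_filtration M N a)} \<subseteq> Pow ({0<..} \<times> space M)"
      using sets.sets_into_space[where M="noise_filtration M N _"] by fastforce
    fix G assume "G \<in> {{a<..b} \<times> A | a b A. 0 \<le> a \<and> a \<le> b \<and> A \<in> sets (noise_filtration M N a)}"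
    then obtain a b A where G: "G = {a<..b} \<times> A" "A \<in> sets (noise_filtration M N a)" by blast
    have A: "A \<in> sets M" using G(2) sets_noise_filtration_subset[OF \<nu> N] by blast
    have "(\<lambda>\<omega>. (s, \<omega>)) -` G \<inter> space M = (if s \<in> {a<..b} then A else {})"
      using sets.sets_into_space[OF A] unfolding G(1) by auto
    then show "(\<lambda>\<omega>. (s, \<omega>)) -` G \<inter> space M \<in> sets M" using A by simp
  qed (use s in \<open>auto simp: predictable_sigma_space_sets\<close>)
  then have "(\<lambda>\<omega>. ((s, \<omega>), z)) \<in> M \<rightarrow>\<^sub>M noise_predictable M N" by simp
  from measurable_compose[OF this f[unfolded predictable_field_def]] show ?thesis by simp
qed

lemma predictable_field_diff:
  assumes "predictable_field M N f" "predictable_field M N g"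
  shows "predictable_field M N (\<lambda>s z \<omega>. f s z \<omega> - g s z \<omega>)"
proof -
  have "(\<lambda>x. (\<lambda>((s, \<omega>), z). f s z \<omega>) x - (\<lambda>((s, \<omega>), z). g s z \<omega>) x) \<in>
      borel_measurable (predictable_sigma (space M) (noise_filtration M N) \<Otimes>\<^sub>M borel)"
    using assms unfolding predictable_field_def by measurable
  then show ?thesis unfolding predictable_field_def by (simp add: split_beta')
qed

lemma poisson_AE_null:
  assumes N: "poisson_random_measure M \<mu> N" and D: "D \<in> null_sets \<mu>"
  shows "AE \<omega> in M. emeasure (N \<omega>) D = 0"
proof -
  interpret prob_space M using N by (simp add: poisson_random_measure_def)
  have Ds: "D \<in> sets \<mu>" and D0: "emeasure \<mu> D = 0" using D by auto
  have "(\<integral>\<^sup>+\<omega>. indicator (space M) \<omega> * emeasure (N \<omega>) D \<partial>M) = emeasure M (space M) * emeasure \<mu> D"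
    using D0 by (intro poisson_nn_integral[OF N Ds]) (auto simp: prob_space Int_absorb1)
  then have "(\<integral>\<^sup>+\<omega>. emeasure (N \<omega>) D \<partial>M) = 0"
    using D0 by (simp add: nn_integral_cong[of M "\<lambda>\<omega>. indicator (space M) \<omega> * emeasure (N \<omega>) D" "\<lambda>\<omega>. emeasure (N \<omega>) D"])
  then show ?thesis
    by (subst (asm) nn_integral_0_iff_AE) (auto intro: emeasure_poisson_measurable[OF N Ds])
qed

lemma null_sets_noise_zero:
  fixes \<nu> :: "'a::euclidean_space measure"
  assumes \<nu>: "sets \<nu> = sets borel" and sf: "sigma_finite_measure \<nu>"
  shows "{0} \<times> UNIV \<in> null_sets (noise_intensity \<nu>)"
proof (rule null_setsI)
  show "{0} \<times> UNIV \<in> sets (noise_intensity \<nu>)"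
    by (intro sets_noise_intensityI[OF \<nu>]) (auto intro!: borel_closed closed_Times)
  interpret pp: sigma_finite_measure "(lborel :: 'a measure) \<Otimes>\<^sub>M \<nu>"
    by (rule sigma_finite_pair_measure[OF lborel.sigma_finite_measure_axioms sf])
  have sp: "space ((lborel :: 'a measure) \<Otimes>\<^sub>M \<nu>) = UNIV"
    using sets_eq_imp_space_eq[OF \<nu>] by (simp add: space_pair_measure)
  have "emeasure (noise_intensity \<nu>) ({0} \<times> UNIV) = emeasure (restrict_space lborel {0..}) {0::real} * emeasure ((lborel :: 'a measure) \<Otimes>\<^sub>M \<nu>) UNIV"
    unfolding noise_intensity_def using sets.top[of "(lborel :: 'a measure) \<Otimes>\<^sub>M \<nu>"] sp
    by (intro pp.emeasure_pair_measure_Times) (auto simp: sets_restrict_space_iff)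
  also have "emeasure (restrict_space lborel {0..}) {0::real} = 0"
    by (subst emeasure_restrict_space) auto
  finally show "emeasure (noise_intensity \<nu>) ({0} \<times> UNIV) = 0" by simp
qed

text \<open>Compensation is applied to the difference \<open>f2 - f1\<close> itself, which is again
  predictable; treating the two integrals separately would lose the cancellation. The separate
  formulas serve only to make both sums absolutely convergent almost surely.\<close>

lemma noise_integral_increment:
  fixes \<nu> :: "'a::euclidean_space measure" and f1 f2 :: "real \<Rightarrow> 'a \<times> 'a \<Rightarrow> 'w \<Rightarrow> real"
  assumes \<nu>: "sets \<nu> = sets borel" and sf: "sigma_finite_measure \<nu>"
    and N: "poisson_random_measure M (noise_intensity \<nu>) N"
    and t: "0 < t1" "t1 \<le> t2"
    and f1: "noise_integrable M \<nu> N t1 f1" "\<And>s z \<omega>. t1 \<le> s \<Longrightarrow> f1 s z \<omega> = 0"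
    and f2: "noise_integrable M \<nu> N t2 f2" "\<And>s z \<omega>. t2 \<le> s \<Longrightarrow> f2 s z \<omega> = 0"
  obtains H where "H \<in> borel_measurable M"
    "AE \<omega> in M. ennreal \<bar>noise_integral N t2 f2 \<omega> - noise_integral N t1 f1 \<omega>\<bar> \<le> H \<omega>"
    "(\<integral>\<^sup>+\<omega>. H \<omega> \<partial>M) = (\<integral>\<^sup>+s\<in>{0<..<t2}. (\<integral>\<^sup>+y. \<integral>\<^sup>+h. \<integral>\<^sup>+\<omega>. ennreal \<bar>f2 s (y, h) \<omega> - f1 s (y, h) \<omega>\<bar> \<partial>M \<partial>\<nu> \<partial>lborel) \<partial>lborel)"
proof -
  have fin: "AE \<omega> in M. (\<integral>\<^sup>+z. ennreal \<bar>f (fst z) (snd z) \<omega>\<bar> * indicator ({0<..} \<times> UNIV) z \<partial>N \<omega>) < \<infinity>"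
    if f: "noise_integrable M \<nu> N t f" "\<And>s z \<omega>. t \<le> s \<Longrightarrow> f s z \<omega> = 0" for t f
  proof -
    have pf: "predictable_field M N f" using f(1) by (simp add: noise_integrable_def)
    obtain H where H: "H \<in> borel_measurable M"
      "AE \<omega> in M. (\<integral>\<^sup>+z. ennreal \<bar>f (fst z) (snd z) \<omega>\<bar> * indicator ({0<..} \<times> UNIV) z \<partial>N \<omega>) = H \<omega>"
      "(\<integral>\<^sup>+\<omega>. H \<omega> \<partial>M) = (\<integral>\<^sup>+s\<in>{0<..}. (\<integral>\<^sup>+y. \<integral>\<^sup>+h. \<integral>\<^sup>+\<omega>. ennreal \<bar>f s (y, h) \<omega>\<bar> \<partial>M \<partial>\<nu> \<partial>lborel) \<partial>lborel)"
      using compensation_formula[OF \<nu> sf N pf] by blast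
    \<comment> \<open>\<open>f\<close> vanishes from time \<open>t\<close> on, so the integral over
      all positive times reduces to the one that \<open>noise_integrable\<close> controls.\<close>
    have "(\<integral>\<^sup>+\<omega>. H \<omega> \<partial>M) = (\<integral>\<^sup>+s\<in>{0<..t}. (\<integral>\<^sup>+y. \<integral>\<^sup>+h. \<integral>\<^sup>+\<omega>. ennreal \<bar>f s (y, h) \<omega>\<bar> \<partial>M \<partial>\<nu> \<partial>lborel) \<partial>lborel)"
      unfolding H(3) using f(2) by (intro nn_integral_cong) (auto split: split_indicator)
    also have "\<dots> < \<infinity>" using f(1) by (simp add: noise_integrable_def)
    finally have "AE \<omega> in M. H \<omega> \<noteq> \<infinity>"
      using H(1) by (intro nn_integral_noteq_infinite) auto
    with H(2) show ?thesis by eventually_elim (simp add: less_top)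
  qed
  have pf: "predictable_field M N (\<lambda>s z \<omega>. f2 s z \<omega> - f1 s z \<omega>)"
    using f1(1) f2(1) by (intro predictable_field_diff) (auto simp: noise_integrable_def)
  obtain H where H: "H \<in> borel_measurable M"
    "AE \<omega> in M. (\<integral>\<^sup>+z. ennreal \<bar>f2 (fst z) (snd z) \<omega> - f1 (fst z) (snd z) \<omega>\<bar> * indicator ({0<..} \<times> UNIV) z \<partial>N \<omega>) = H \<omega>"
    "(\<integral>\<^sup>+\<omega>. H \<omega> \<partial>M) = (\<integral>\<^sup>+s\<in>{0<..}. (\<integral>\<^sup>+y. \<integral>\<^sup>+h. \<integral>\<^sup>+\<omega>. ennreal \<bar>f2 s (y, h) \<omega> - f1 s (y, h) \<omega>\<bar> \<partial>M \<partial>\<nu> \<partial>lborel) \<partial>lborel)"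
    using compensation_formula[OF \<nu> sf N pf] by blast
  have fin1: "AE \<omega> in M. (\<integral>\<^sup>+z. ennreal \<bar>f1 (fst z) (snd z) \<omega>\<bar> * indicator ({0<..} \<times> UNIV) z \<partial>N \<omega>) < \<infinity>"
    by (rule fin[OF f1(1)]) (rule f1(2))
  have fin2: "AE \<omega> in M. (\<integral>\<^sup>+z. ennreal \<bar>f2 (fst z) (snd z) \<omega>\<bar> * indicator ({0<..} \<times> UNIV) z \<partial>N \<omega>) < \<infinity>"
    by (rule fin[OF f2(1)]) (rule f2(2))
  note null = null_sets_noise_zero[OF \<nu> sf]
  show ?thesis
  proof
    show "AE \<omega> in M. ennreal \<bar>noise_integral N t2 f2 \<omega> - noise_integral N t1 f1 \<omega>\<bar> \<le> H \<omega>"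
      using fin1 fin2 H(2) poisson_AE_null[OF N null] AE_space
    proof eventually_elim
      case (elim \<omega>)
      have sN: "sets (N \<omega>) = sets (noise_intensity \<nu>)"
        using N elim(5) by (simp add: poisson_random_measure_def)
      have "ennreal \<bar>noise_integral N t2 f2 \<omega> - noise_integral N t1 f1 \<omega>\<bar> \<le>
          (\<integral>\<^sup>+z. ennreal \<bar>f2 (fst z) (snd z) \<omega> - f1 (fst z) (snd z) \<omega>\<bar> * indicator ({0<..} \<times> UNIV) z \<partial>N \<omega>)"
      proof (rule noise_integral_difference)
        show "{z} \<in> sets (N \<omega>)" if "0 < fst z" for z
          unfolding sN using that by (intro sets_noise_intensityI[OF \<nu>]) (auto simp: mem_Times_iff)
        show "{0} \<times> UNIV \<in> null_sets (N \<omega>)"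
          using elim(4) null sN by (intro null_setsI) auto
      qed (use t(2) f1(2) elim(1,2) in blast)+
      then show ?case unfolding elim(3) .
    qed
    show "(\<integral>\<^sup>+\<omega>. H \<omega> \<partial>M) = (\<integral>\<^sup>+s\<in>{0<..<t2}. (\<integral>\<^sup>+y. \<integral>\<^sup>+h. \<integral>\<^sup>+\<omega>. ennreal \<bar>f2 s (y, h) \<omega> - f1 s (y, h) \<omega>\<bar> \<partial>M \<partial>\<nu> \<partial>lborel) \<partial>lborel)"
      unfolding H(3) using f1(2) f2(2) t by (intro nn_integral_cong) (auto split: split_indicator)
  qed (rule H(1))
qed

section \<open>Increments of the solution\<close>


text \<open>At a given \<open>s\<close> both integrands contain the same factor
  \<open>sigma (u s y) h\<close>, so their difference is the kernel difference times this factor.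
  Its mean is at most \<open>J h * (1 + Lip * C)\<close> by linear growth, and integrating
  \<open>J\<close> over the marks gives the constant \<open>(1 + Lip * C) * K\<close>.\<close>

lemma mild_integrand_difference_bound:
  fixes \<sigma> :: "real \<Rightarrow> 'a::euclidean_space \<Rightarrow> real"
  assumes J: "J \<in> borel_measurable \<nu>" "\<And>h. 0 \<le> J h" "(\<integral>\<^sup>+h. ennreal (J h) \<partial>\<nu>) \<le> ennreal K"
    and Lip: "0 \<le> Lip"
    and sigma: "\<And>h. \<bar>\<sigma> 0 h\<bar> \<le> J h" "\<And>r r' h. \<bar>\<sigma> r h - \<sigma> r' h\<bar> \<le> J h * Lip * \<bar>r - r'\<bar>"
    and p: "transition_density P X p"
    and M: "prob_space M" and u: "\<And>y. u s y \<in> borel_measurable M"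
    and C: "\<And>y. (\<integral>\<^sup>+\<omega>. ennreal \<bar>u s y \<omega>\<bar> \<partial>M) \<le> ennreal C" "0 \<le> C"
    and s: "s < t2"
  shows "(\<integral>\<^sup>+y. \<integral>\<^sup>+h. \<integral>\<^sup>+\<omega>. ennreal \<bar>mild_integrand p \<sigma> u t2 x s (y, h) \<omega> - mild_integrand p \<sigma> u t1 x s (y, h) \<omega>\<bar> \<partial>M \<partial>\<nu> \<partial>lborel)
    \<le> ennreal ((1 + Lip * C) * K) * (\<integral>\<^sup>+y. ennreal \<bar>p (t2 - s) x y - (if s < t1 then p (t1 - s) x y else 0)\<bar> \<partial>lborel)"
proof -
  interpret prob_space M by fact
  let ?k = "\<lambda>y. p (t2 - s) x y - (if s < t1 then p (t1 - s) x y else 0)"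
  have K: "ennreal (1 + Lip * C) * ennreal K = ennreal ((1 + Lip * C) * K)"
    using Lip C by (simp add: ennreal_mult')
  have k[measurable]: "?k \<in> borel_measurable borel"
    using transition_density_section_measurable[OF p, of _ x] s by (cases "s < t1") auto
  \<comment> \<open>Linear growth is the Lipschitz bound against \<open>r' = 0\<close> added to the
    bound at 0.\<close>
  have lin: "\<bar>\<sigma> r h\<bar> \<le> J h * (1 + Lip * \<bar>r\<bar>)" for r h
    using sigma(1)[of h] sigma(2)[of r h 0] by (simp add: algebra_simps)
  have inner: "(\<integral>\<^sup>+\<omega>. ennreal \<bar>mild_integrand p \<sigma> u t2 x s (y, h) \<omega> - mild_integrand p \<sigma> u t1 x s (y, h) \<omega>\<bar> \<partial>M)
      \<le> ennreal (\<bar>?k y\<bar> * (1 + Lip * C)) * ennreal (J h)" for y h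
  proof -
    have "(\<integral>\<^sup>+\<omega>. ennreal \<bar>mild_integrand p \<sigma> u t2 x s (y, h) \<omega> - mild_integrand p \<sigma> u t1 x s (y, h) \<omega>\<bar> \<partial>M)
        = (\<integral>\<^sup>+\<omega>. ennreal (\<bar>?k y\<bar> * \<bar>\<sigma> (u s y \<omega>) h\<bar>) \<partial>M)"
      using s by (intro nn_integral_cong) (auto simp: mild_integrand_def abs_mult[symmetric] left_diff_distrib)
    also have "\<dots> \<le> (\<integral>\<^sup>+\<omega>. ennreal (\<bar>?k y\<bar> * J h) + ennreal (\<bar>?k y\<bar> * J h * Lip) * ennreal \<bar>u s y \<omega>\<bar> \<partial>M)"
    proof (rule nn_integral_mono)
      fix \<omega>
      have "\<bar>?k y\<bar> * \<bar>\<sigma> (u s y \<omega>) h\<bar> \<le> \<bar>?k y\<bar> * (J h * (1 + Lip * \<bar>u s y \<omega>\<bar>))"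
        by (intro mult_left_mono lin) simp
      also have "\<dots> = \<bar>?k y\<bar> * J h + \<bar>?k y\<bar> * J h * Lip * \<bar>u s y \<omega>\<bar>" by (simp add: algebra_simps)
      finally have "ennreal (\<bar>?k y\<bar> * \<bar>\<sigma> (u s y \<omega>) h\<bar>) \<le> ennreal (\<bar>?k y\<bar> * J h + \<bar>?k y\<bar> * J h * Lip * \<bar>u s y \<omega>\<bar>)"
        by (rule ennreal_leI)
      also have "\<dots> = ennreal (\<bar>?k y\<bar> * J h) + ennreal (\<bar>?k y\<bar> * J h * Lip) * ennreal \<bar>u s y \<omega>\<bar>"
        using J(2)[of h] Lip by (subst ennreal_plus) (auto simp: ennreal_mult)
      finally show "ennreal (\<bar>?k y\<bar> * \<bar>\<sigma> (u s y \<omega>) h\<bar>) \<le> \<dots>" .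
    qed
    also have "\<dots> = ennreal (\<bar>?k y\<bar> * J h) + ennreal (\<bar>?k y\<bar> * J h * Lip) * (\<integral>\<^sup>+\<omega>. ennreal \<bar>u s y \<omega>\<bar> \<partial>M)"
      using u[of y] by (subst nn_integral_add) (auto simp: nn_integral_cmult emeasure_space_1)
    also have "\<dots> \<le> ennreal (\<bar>?k y\<bar> * J h) + ennreal (\<bar>?k y\<bar> * J h * Lip) * ennreal C"
      by (intro add_left_mono mult_left_mono C) simp
    also have "\<dots> = ennreal (\<bar>?k y\<bar> * J h + \<bar>?k y\<bar> * J h * Lip * C)"
      using J(2)[of h] Lip C(2) by (subst ennreal_plus) (auto simp: ennreal_mult)
    also have "\<bar>?k y\<bar> * J h + \<bar>?k y\<bar> * J h * Lip * C = (\<bar>?k y\<bar> * (1 + Lip * C)) * J h" by (simp add: algebra_simps)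
    also have "ennreal \<dots> = ennreal (\<bar>?k y\<bar> * (1 + Lip * C)) * ennreal (J h)"
      using J(2)[of h] Lip C(2) by (intro ennreal_mult) auto
    finally show ?thesis .
  qed
  have "(\<integral>\<^sup>+y. \<integral>\<^sup>+h. \<integral>\<^sup>+\<omega>. ennreal \<bar>mild_integrand p \<sigma> u t2 x s (y, h) \<omega> - mild_integrand p \<sigma> u t1 x s (y, h) \<omega>\<bar> \<partial>M \<partial>\<nu> \<partial>lborel)
    \<le> (\<integral>\<^sup>+y. \<integral>\<^sup>+h. ennreal (\<bar>?k y\<bar> * (1 + Lip * C)) * ennreal (J h) \<partial>\<nu> \<partial>lborel)"
    by (intro nn_integral_mono inner)
  also have "\<dots> = (\<integral>\<^sup>+y. ennreal (\<bar>?k y\<bar> * (1 + Lip * C)) * (\<integral>\<^sup>+h. ennreal (J h) \<partial>\<nu>) \<partial>lborel)"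
    using J(1) by (intro nn_integral_cong nn_integral_cmult) auto
  also have "\<dots> \<le> (\<integral>\<^sup>+y. ennreal (\<bar>?k y\<bar> * (1 + Lip * C)) * ennreal K \<partial>lborel)"
    by (intro nn_integral_mono mult_left_mono J(3)) simp
  also have "\<dots> = (\<integral>\<^sup>+y. ennreal ((1 + Lip * C) * K) * ennreal \<bar>?k y\<bar> \<partial>lborel)"
    using Lip C(2) unfolding K[symmetric] by (simp add: ennreal_mult mult_ac)
  also have "\<dots> = ennreal ((1 + Lip * C) * K) * (\<integral>\<^sup>+y. ennreal \<bar>?k y\<bar> \<partial>lborel)"
    by (rule nn_integral_cmult) simp
  finally show ?thesis .
qed

text \<open>The mild equation splits the increment into a deterministic and a random part. The same
  modulus controls both: with factor \<open>B / t1\<close> from averaging the semigroup over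
  intermediate times, and with factor \<open>(1 + Lip * C) * K\<close>, scaled by
  \<open>lam\<close>, from compensation.\<close>

lemma solution_increment_bound:
  fixes \<nu> :: "'a::euclidean_space measure" and u :: "real \<Rightarrow> 'a \<Rightarrow> 'w \<Rightarrow> real"
  assumes levy: "levy_process P X" and p: "transition_density P X p"
    and u0: "u0 \<in> borel_measurable borel" "\<And>y. 0 \<le> u0 y" "\<And>y. u0 y \<le> B"
    and \<nu>: "sets \<nu> = sets borel" and sf: "sigma_finite_measure \<nu>"
    and N: "poisson_random_measure M (noise_intensity \<nu>) N"
    and J: "J \<in> borel_measurable borel" "\<And>h. 0 \<le> J h" "(\<integral>\<^sup>+h. ennreal (J h) \<partial>\<nu>) \<le> ennreal K"
    and Lip: "0 \<le> Lip"
    and sigma: "\<And>h. \<bar>\<sigma> 0 h\<bar> \<le> J h" "\<And>r r' h. \<bar>\<sigma> r h - \<sigma> r' h\<bar> \<le> J h * Lip * \<bar>r - r'\<bar>"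
    and sol: "mild_solution M \<nu> N p lam \<sigma> u0 u"
    and C: "\<And>s y. 0 < s \<Longrightarrow> s \<le> T \<Longrightarrow> (\<integral>\<^sup>+\<omega>. ennreal \<bar>u s y \<omega>\<bar> \<partial>M) \<le> ennreal C" "0 \<le> C"
    and t: "0 < t1" "t1 \<le> t2" "t2 \<le> T"
  shows "(\<integral>\<^sup>+\<omega>. ennreal \<bar>u t2 x \<omega> - u t1 x \<omega>\<bar> \<partial>M)
    \<le> (ennreal (B / t1) + ennreal \<bar>lam\<bar> * ennreal ((1 + Lip * C) * K)) * density_modulus p x T (t2 - t1)"
proof -
  interpret prob_space M using N by (simp add: poisson_random_measure_def)
  let ?f = "\<lambda>t. mild_integrand p \<sigma> u t x"
  have pf: "predictable_field M N u"
    and ni: "noise_integrable M \<nu> N t (?f t)"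
    and eq: "AE \<omega> in M. u t x \<omega> = (\<integral>y. p t x y * u0 y \<partial>lborel) + lam * noise_integral N t (?f t) \<omega>"
    if "0 < t" for t
    using sol that by (auto simp: mild_solution_def)
  note um = predictable_field_random_variable[OF \<nu> N pf[OF t(1)]]
  have t2: "0 < t2" using t by simp
  have zero: "?f t s z \<omega> = 0" if "t \<le> s" for t s z \<omega>
    using that by (simp add: mild_integrand_def split_beta)
  obtain H where H: "H \<in> borel_measurable M"
    "AE \<omega> in M. ennreal \<bar>noise_integral N t2 (?f t2) \<omega> - noise_integral N t1 (?f t1) \<omega>\<bar> \<le> H \<omega>"
    "(\<integral>\<^sup>+\<omega>. H \<omega> \<partial>M) = (\<integral>\<^sup>+s\<in>{0<..<t2}. (\<integral>\<^sup>+y. \<integral>\<^sup>+h. \<integral>\<^sup>+\<omega>. ennreal \<bar>?f t2 s (y, h) \<omega> - ?f t1 s (y, h) \<omega>\<bar> \<partial>M \<partial>\<nu> \<partial>lborel) \<partial>lborel)"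
    using noise_integral_increment[OF \<nu> sf N t(1,2) ni[OF t(1)] _ ni[OF t2]] zero by blast
  have J\<nu>: "J \<in> borel_measurable \<nu>" using J(1) \<nu> by (simp cong: measurable_cong_sets)
  let ?c = "ennreal ((1 + Lip * C) * K)" and ?\<Phi> = "density_modulus p x T (t2 - t1)"
  have "(\<integral>\<^sup>+\<omega>. H \<omega> \<partial>M) \<le> (\<integral>\<^sup>+s\<in>{0<..<t2}. ?c * (\<integral>\<^sup>+y. ennreal \<bar>p (t2 - s) x y - (if s < t1 then p (t1 - s) x y else 0)\<bar> \<partial>lborel) \<partial>lborel)"
    unfolding H(3)
  proof (rule nn_integral_mono)
    fix s
    show "(\<integral>\<^sup>+y. \<integral>\<^sup>+h. \<integral>\<^sup>+\<omega>. ennreal \<bar>?f t2 s (y, h) \<omega> - ?f t1 s (y, h) \<omega>\<bar> \<partial>M \<partial>\<nu> \<partial>lborel) * indicator {0<..<t2} s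
      \<le> ?c * (\<integral>\<^sup>+y. ennreal \<bar>p (t2 - s) x y - (if s < t1 then p (t1 - s) x y else 0)\<bar> \<partial>lborel) * indicator {0<..<t2} s"
    proof (cases "s \<in> {0<..<t2}")
      case True
      have "(\<integral>\<^sup>+y. \<integral>\<^sup>+h. \<integral>\<^sup>+\<omega>. ennreal \<bar>?f t2 s (y, h) \<omega> - ?f t1 s (y, h) \<omega>\<bar> \<partial>M \<partial>\<nu> \<partial>lborel)
        \<le> ?c * (\<integral>\<^sup>+y. ennreal \<bar>p (t2 - s) x y - (if s < t1 then p (t1 - s) x y else 0)\<bar> \<partial>lborel)"
        using True t
        by (intro mild_integrand_difference_bound[OF J\<nu> J(2,3) Lip sigma p prob_space_axioms um C]) auto
      then show ?thesis using True by simp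
    qed simp
  qed
  also have "\<dots> \<le> ?c * ?\<Phi>" by (rule kernel_time_shift_bound[OF p t])
  finally have HI: "(\<integral>\<^sup>+\<omega>. H \<omega> \<partial>M) \<le> ?c * ?\<Phi>" .
  let ?d = "ennreal \<bar>(\<integral>y. p t2 x y * u0 y \<partial>lborel) - (\<integral>y. p t1 x y * u0 y \<partial>lborel)\<bar>"
  have "(\<integral>\<^sup>+\<omega>. ennreal \<bar>u t2 x \<omega> - u t1 x \<omega>\<bar> \<partial>M) \<le> (\<integral>\<^sup>+\<omega>. ?d + ennreal \<bar>lam\<bar> * H \<omega> \<partial>M)"
  proof (rule nn_integral_mono_AE)
    show "AE \<omega> in M. ennreal \<bar>u t2 x \<omega> - u t1 x \<omega>\<bar> \<le> ?d + ennreal \<bar>lam\<bar> * H \<omega>"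
      using eq[OF t2] eq[OF t(1)] H(2)
    proof eventually_elim
      case (elim \<omega>)
      let ?n = "noise_integral N t2 (?f t2) \<omega> - noise_integral N t1 (?f t1) \<omega>"
      have "\<bar>u t2 x \<omega> - u t1 x \<omega>\<bar> = \<bar>((\<integral>y. p t2 x y * u0 y \<partial>lborel) - (\<integral>y. p t1 x y * u0 y \<partial>lborel)) + lam * ?n\<bar>"
        unfolding elim(1,2) by (simp add: algebra_simps)
      also have "\<dots> \<le> \<bar>(\<integral>y. p t2 x y * u0 y \<partial>lborel) - (\<integral>y. p t1 x y * u0 y \<partial>lborel)\<bar> + \<bar>lam\<bar> * \<bar>?n\<bar>"
        unfolding abs_mult[symmetric] by (rule abs_triangle_ineq)
      finally have "ennreal \<bar>u t2 x \<omega> - u t1 x \<omega>\<bar> \<le> ennreal (\<dots>)" by (rule ennreal_leI)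
      also have "\<dots> = ?d + ennreal \<bar>lam\<bar> * ennreal \<bar>?n\<bar>"
        by (simp add: ennreal_mult)
      also have "\<dots> \<le> ?d + ennreal \<bar>lam\<bar> * H \<omega>"
        by (intro add_left_mono mult_left_mono elim(3)) simp
      finally show ?case .
    qed
  qed
  also have "\<dots> = ?d + ennreal \<bar>lam\<bar> * (\<integral>\<^sup>+\<omega>. H \<omega> \<partial>M)"
    using H(1) by (subst nn_integral_add) (auto simp: nn_integral_cmult emeasure_space_1)
  also have "\<dots> \<le> ennreal (B / t1) * ?\<Phi> + ennreal \<bar>lam\<bar> * (?c * ?\<Phi>)"
    by (intro add_mono mult_left_mono HI semigroup_time_shift_bound[OF levy p t u0]) simp
  also have "\<dots> = (ennreal (B / t1) + ennreal \<bar>lam\<bar> * ?c) * ?\<Phi>"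
    by (simp add: distrib_right mult.assoc)
  finally show ?thesis .
qed


section \<open>From the increment bound to continuity in mean\<close>

lemma ennreal_tendsto_of_dist_le:
  fixes F e :: "'a \<Rightarrow> ennreal" and l :: ennreal
  assumes up: "\<forall>\<^sub>F t in G. F t \<le> l + e t" and low: "\<forall>\<^sub>F t in G. l \<le> F t + e t"
    and e: "(e \<longlongrightarrow> 0) G" and l: "l < \<infinity>"
  shows "(F \<longlongrightarrow> l) G"
proof (rule tendsto_sandwich)
  \<comment> \<open>Closeness is stated by two sums because subtraction in \<open>ennreal\<close> is
    truncated at 0; finiteness of \<open>l\<close> permits the passage from
    \<open>l \<le> F t + e t\<close> to \<open>l - e t \<le> F t\<close>.\<close>
  show "\<forall>\<^sub>F t in G. l - e t \<le> F t"
    using low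
  proof eventually_elim
    case (elim t)
    moreover have "l \<noteq> \<top>" using l by simp
    ultimately show ?case by (simp add: ennreal_minus_le_iff add.commute)
  qed
  show "\<forall>\<^sub>F t in G. F t \<le> l + e t" by fact
  show "((\<lambda>t. l - e t) \<longlongrightarrow> l) G"
    using tendsto_diff_ennreal[OF tendsto_const[of l] e] l by simp
  show "((\<lambda>t. l + e t) \<longlongrightarrow> l) G"
    using tendsto_add[OF tendsto_const[of l] e] by simp
qed

text \<open>One constant serves all times in \<open>[a, T]\<close>: \<open>B / t1\<close> is at most
  \<open>B / a\<close>, and the supremum of the first moments up to \<open>T\<close> is finite by
  the definition of a random field solution.\<close>

lemma solution_modulus:
  fixes \<nu> :: "'a::euclidean_space measure" and u :: "real \<Rightarrow> 'a \<Rightarrow> 'w \<Rightarrow> real"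
  assumes levy: "levy_process P X" and p: "transition_density P X p"
    and u0: "u0 \<in> borel_measurable borel" "\<And>y. 0 \<le> u0 y" "bounded (range u0)"
    and \<nu>: "sets \<nu> = sets borel"
    and N: "poisson_random_measure M (noise_intensity \<nu>) N"
    and J: "J \<in> borel_measurable borel" "\<And>h. 0 < J h" "(\<integral>\<^sup>+h. ennreal (J h) \<partial>\<nu>) \<le> ennreal K"
    and Lip: "0 \<le> Lip"
    and sigma: "\<And>h. \<bar>\<sigma> 0 h\<bar> \<le> J h" "\<And>r r' h. \<bar>\<sigma> r h - \<sigma> r' h\<bar> \<le> J h * Lip * \<bar>r - r'\<bar>"
    and sol: "random_field_solution M \<nu> N p lam \<sigma> u0 u"
    and a: "0 < a"
  obtains c where "c < \<infinity>" "\<And>t1 t2. a \<le> t1 \<Longrightarrow> t1 \<le> t2 \<Longrightarrow> t2 \<le> T \<Longrightarrow>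
    (\<integral>\<^sup>+\<omega>. ennreal \<bar>u t2 x \<omega> - u t1 x \<omega>\<bar> \<partial>M) \<le> c * density_modulus p x T (t2 - t1)"
proof (cases "0 < T")
  case True
  obtain B where B: "\<And>y. u0 y \<le> B"
    using u0(3) by (auto simp: bounded_iff abs_le_iff)
  have B0: "0 \<le> B" using u0(2)[of 0] B[of 0] by simp
  have J\<nu>: "J \<in> borel_measurable \<nu>" using J(1) \<nu> by (simp cong: measurable_cong_sets)
  have sf: "sigma_finite_measure \<nu>"
    using sigma_finite_of_positive_integrable[OF J\<nu> J(2)] order.strict_trans1[OF J(3) ennreal_less_top] by simp
  have ms: "mild_solution M \<nu> N p lam \<sigma> u0 u" using sol by (simp add: random_field_solution_def)
  define S where "S = (SUP t\<in>{0<..T}. SUP x. \<integral>\<^sup>+\<omega>. ennreal \<bar>u t x \<omega>\<bar> \<partial>M)"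
  have S: "S < \<infinity>" using sol True by (simp add: random_field_solution_def S_def)
  have C: "(\<integral>\<^sup>+\<omega>. ennreal \<bar>u s y \<omega>\<bar> \<partial>M) \<le> ennreal (enn2real S)" if "0 < s" "s \<le> T" for s y
  proof -
    have "(\<integral>\<^sup>+\<omega>. ennreal \<bar>u s y \<omega>\<bar> \<partial>M) \<le> S"
      unfolding S_def using that by (intro SUP_upper2[of s] SUP_upper) auto
    then show ?thesis using S by simp
  qed
  define c where "c = ennreal (B / a) + ennreal \<bar>lam\<bar> * ennreal ((1 + Lip * enn2real S) * K)"
  show ?thesis
  proof
    show "c < \<infinity>" by (simp add: c_def ennreal_mult_less_top)
    fix t1 t2 assume t: "a \<le> t1" "t1 \<le> t2" "t2 \<le> T"
    have t1: "0 < t1" using a t by simp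
    have "(\<integral>\<^sup>+\<omega>. ennreal \<bar>u t2 x \<omega> - u t1 x \<omega>\<bar> \<partial>M)
      \<le> (ennreal (B / t1) + ennreal \<bar>lam\<bar> * ennreal ((1 + Lip * enn2real S) * K)) * density_modulus p x T (t2 - t1)"
      by (rule solution_increment_bound[OF levy p u0(1,2) B \<nu> sf N J(1) less_imp_le[OF J(2)] J(3) Lip sigma ms C
            enn2real_nonneg t1 t(2,3)])
    also have "\<dots> \<le> c * density_modulus p x T (t2 - t1)"
      unfolding c_def using t(1) a B0
      by (intro mult_right_mono add_right_mono ennreal_leI divide_left_mono) auto
    finally show "(\<integral>\<^sup>+\<omega>. ennreal \<bar>u t2 x \<omega> - u t1 x \<omega>\<bar> \<partial>M) \<le> c * density_modulus p x T (t2 - t1)" .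
  qed
next
  case False
  \<comment> \<open>Vacuous: no time lies between the positive \<open>a\<close> and a nonpositive
    \<open>T\<close>.\<close>
  show ?thesis by (rule that[of 0]) (use a False in auto)
qed

theorem theorem2p11:
  fixes P :: "'v measure" and X :: "real \<Rightarrow> 'v \<Rightarrow> (real ^ 'd)"
    and L :: "(((real ^ 'd) \<Rightarrow> real) \<times> ((real ^ 'd) \<Rightarrow> real)) set"
    and p :: "real \<Rightarrow> (real ^ 'd) \<Rightarrow> (real ^ 'd) \<Rightarrow> real"
    and u0 :: "(real ^ 'd) \<Rightarrow> real" and lam :: real
    and \<nu> :: "(real ^ 'd) measure"
    and M :: "'w measure" and N :: "'w \<Rightarrow> (real \<times> (real ^ 'd) \<times> (real ^ 'd)) measure"
    and \<sigma> :: "real \<Rightarrow> (real ^ 'd) \<Rightarrow> real" and J :: "(real ^ 'd) \<Rightarrow> real" and Lip K :: real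
    and u :: "real \<Rightarrow> (real ^ 'd) \<Rightarrow> 'w \<Rightarrow> real"
  assumes levy: "levy_process P X"
    and generator: "L = L2_generator P X"
    and density: "transition_density P X p"
    and u0_measurable: "u0 \<in> borel_measurable borel"
    and u0_nonneg: "\<And>y. 0 \<le> u0 y"
    and u0_bounded: "bounded (range u0)"
    and nu: "levy_measure \<nu>"
    and noise: "poisson_random_measure M (noise_intensity \<nu>) N"
    and sigma_measurable: "(\<lambda>(r, h). \<sigma> r h) \<in> borel_measurable borel"
    and J_measurable: "J \<in> borel_measurable borel"
    and J_pos: "\<And>h. 0 < J h"
    and Lip_pos: "0 < Lip" and K_pos: "0 < K"
    and sigma_zero: "\<And>h. \<bar>\<sigma> 0 h\<bar> \<le> J h"
    and sigma_Lipschitz: "\<And>r r' h. \<bar>\<sigma> r h - \<sigma> r' h\<bar> \<le> J h * Lip * \<bar>r - r'\<bar>"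
    and J_integral: "(\<integral>\<^sup>+h. ennreal (J h) \<partial>\<nu>) \<le> ennreal K"
    and solution: "random_field_solution M \<nu> N p lam \<sigma> u0 u"
  shows "\<forall>x. (\<forall>t2>0. ((\<lambda>t1. \<integral>\<^sup>+\<omega>. ennreal \<bar>u t2 x \<omega> - u t1 x \<omega>\<bar> \<partial>M) \<longlongrightarrow> 0) (at_left t2)) \<and>
             continuous_on {0<..} (\<lambda>t. \<integral>\<^sup>+\<omega>. ennreal \<bar>u t x \<omega>\<bar> \<partial>M)"
proof (rule allI)
  fix x
  have \<nu>: "sets \<nu> = sets borel" using nu by (simp add: levy_measure_def)
  have pf: "predictable_field M N u"
    using solution by (simp add: random_field_solution_def mild_solution_def)
  \<comment> \<open>The limit is two-sided. Its restriction to the left is the first claim, and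
    continuity of the first moment needs both sides.\<close>
  have mean: "((\<lambda>t1. \<integral>\<^sup>+\<omega>. ennreal \<bar>u t x \<omega> - u t1 x \<omega>\<bar> \<partial>M) \<longlongrightarrow> 0) (at t)" if t: "0 < t" for t
  proof -
    \<comment> \<open>The window \<open>[t / 2, 2 * t]\<close> is a neighbourhood of
      \<open>t\<close> on which the constant does not blow up; its right end also serves as the
      cut-off of the density.\<close>
    obtain c where c: "c < \<infinity>" "\<And>t1 t2. t / 2 \<le> t1 \<Longrightarrow> t1 \<le> t2 \<Longrightarrow> t2 \<le> 2 * t \<Longrightarrow>
        (\<integral>\<^sup>+\<omega>. ennreal \<bar>u t2 x \<omega> - u t1 x \<omega>\<bar> \<partial>M) \<le> c * density_modulus p x (2 * t) (t2 - t1)"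
      using solution_modulus[OF levy density u0_measurable u0_nonneg u0_bounded \<nu> noise J_measurable J_pos J_integral
          less_imp_le[OF Lip_pos] sigma_zero sigma_Lipschitz solution, of "t / 2" "2 * t" x] t by auto
    \<comment> \<open>The modulus tends to 0 along the punctured filter, so
      \<open>\<bar>t - s\<bar>\<close> must avoid 0, which it does for \<open>s\<close> different
      from \<open>t\<close>. The absolute value treats both sides of \<open>t\<close> at
      once.\<close>
    have lim: "filterlim (\<lambda>s. \<bar>t - s\<bar>) (at 0) (at t)"
      unfolding filterlim_at by (auto simp: eventually_at_filter intro!: tendsto_eq_intros)
    have "((\<lambda>s. c * density_modulus p x (2 * t) \<bar>t - s\<bar>) \<longlongrightarrow> c * 0) (at t)"
      using c(1) filterlim_compose[OF density_modulus_tendsto[OF levy density] lim]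
      by (intro ennreal_tendsto_cmult) auto
    then have lim0: "((\<lambda>s. c * density_modulus p x (2 * t) \<bar>t - s\<bar>) \<longlongrightarrow> 0) (at t)" by simp
    have ev: "\<forall>\<^sub>F s in at t. t / 2 < s \<and> s < 2 * t"
      using t by (intro eventually_conj order_tendstoD[OF tendsto_ident_at]) auto
    show ?thesis
    proof (rule tendsto_sandwich[OF _ _ tendsto_const lim0])
      show "\<forall>\<^sub>F s in at t. (\<integral>\<^sup>+\<omega>. ennreal \<bar>u t x \<omega> - u s x \<omega>\<bar> \<partial>M) \<le> c * density_modulus p x (2 * t) \<bar>t - s\<bar>"
        using ev
      proof eventually_elim
        case (elim s)
        show ?case
        proof (cases "s \<le> t")
          case True
          then show ?thesis using c(2)[of s t] elim t by simp
        next
          case False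
          then show ?thesis using c(2)[of t s] elim t by (simp add: abs_minus_commute)
        qed
      qed
    qed simp
  qed
  have um: "u t x \<in> borel_measurable M" if "0 < t" for t
    by (rule predictable_field_random_variable[OF \<nu> noise pf that])
  have fin: "(\<integral>\<^sup>+\<omega>. ennreal \<bar>u t x \<omega>\<bar> \<partial>M) < \<infinity>" if "0 < t" for t
  proof -
    have "(\<integral>\<^sup>+\<omega>. ennreal \<bar>u t x \<omega>\<bar> \<partial>M) \<le> (SUP s\<in>{0<..t}. SUP x. \<integral>\<^sup>+\<omega>. ennreal \<bar>u s x \<omega>\<bar> \<partial>M)"
      using that by (intro SUP_upper2[of t] SUP_upper) auto
    also have "\<dots> < \<infinity>" using solution that by (simp add: random_field_solution_def)
    finally show ?thesis .
  qed
  \<comment> \<open>Used twice, with the roles of \<open>s\<close> and \<open>t\<close> exchanged,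
    this gives the upper and the lower bound on the first moment near \<open>t\<close>.\<close>
  have tri: "(\<integral>\<^sup>+\<omega>. ennreal \<bar>u s x \<omega>\<bar> \<partial>M) \<le> (\<integral>\<^sup>+\<omega>. ennreal \<bar>u t x \<omega>\<bar> \<partial>M) + (\<integral>\<^sup>+\<omega>. ennreal \<bar>u t x \<omega> - u s x \<omega>\<bar> \<partial>M)"
    if "0 < s" "0 < t" for s t
  proof -
    note [measurable] = um[OF that(1)] um[OF that(2)]
    have "(\<integral>\<^sup>+\<omega>. ennreal \<bar>u s x \<omega>\<bar> \<partial>M) \<le> (\<integral>\<^sup>+\<omega>. ennreal \<bar>u t x \<omega>\<bar> + ennreal \<bar>u t x \<omega> - u s x \<omega>\<bar> \<partial>M)"
      by (intro nn_integral_mono) (auto simp: ennreal_plus[symmetric] simp del: ennreal_plus intro!: ennreal_leI)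
    also have "\<dots> = (\<integral>\<^sup>+\<omega>. ennreal \<bar>u t x \<omega>\<bar> \<partial>M) + (\<integral>\<^sup>+\<omega>. ennreal \<bar>u t x \<omega> - u s x \<omega>\<bar> \<partial>M)"
      by (rule nn_integral_add) measurable
    finally show ?thesis .
  qed
  have "continuous_on {0<..} (\<lambda>t. \<integral>\<^sup>+\<omega>. ennreal \<bar>u t x \<omega>\<bar> \<partial>M)"
    unfolding continuous_on_eq_continuous_at[OF open_greaterThan] isCont_def
  proof
    fix t :: real assume "t \<in> {0<..}"
    then have t: "0 < t" by simp
    have ev: "\<forall>\<^sub>F s in at t. 0 < s"
      using t by (intro order_tendstoD[OF tendsto_ident_at]) auto
    show "((\<lambda>t. \<integral>\<^sup>+\<omega>. ennreal \<bar>u t x \<omega>\<bar> \<partial>M) \<longlongrightarrow> (\<integral>\<^sup>+\<omega>. ennreal \<bar>u t x \<omega>\<bar> \<partial>M)) (at t)"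
    proof (rule ennreal_tendsto_of_dist_le[OF _ _ mean[OF t] fin[OF t]])
      show "\<forall>\<^sub>F s in at t. (\<integral>\<^sup>+\<omega>. ennreal \<bar>u s x \<omega>\<bar> \<partial>M) \<le>
          (\<integral>\<^sup>+\<omega>. ennreal \<bar>u t x \<omega>\<bar> \<partial>M) + (\<integral>\<^sup>+\<omega>. ennreal \<bar>u t x \<omega> - u s x \<omega>\<bar> \<partial>M)"
        using ev by eventually_elim (rule tri[OF _ t])
      show "\<forall>\<^sub>F s in at t. (\<integral>\<^sup>+\<omega>. ennreal \<bar>u t x \<omega>\<bar> \<partial>M) \<le>
          (\<integral>\<^sup>+\<omega>. ennreal \<bar>u s x \<omega>\<bar> \<partial>M) + (\<integral>\<^sup>+\<omega>. ennreal \<bar>u t x \<omega> - u s x \<omega>\<bar> \<partial>M)"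
        using ev
      proof eventually_elim
        case (elim s)
        from tri[OF t elim] show ?case by (simp add: abs_minus_commute)
      qed
    qed
  qed
  moreover have "\<forall>t2>0. ((\<lambda>t1. \<integral>\<^sup>+\<omega>. ennreal \<bar>u t2 x \<omega> - u t1 x \<omega>\<bar> \<partial>M) \<longlongrightarrow> 0) (at_left t2)"
    using mean by (auto intro: filterlim_mono_eventually tendsto_within_subset)
  ultimately show "(\<forall>t2>0. ((\<lambda>t1. \<integral>\<^sup>+\<omega>. ennreal \<bar>u t2 x \<omega> - u t1 x \<omega>\<bar> \<partial>M) \<longlongrightarrow> 0) (at_left t2)) \<and>
             continuous_on {0<..} (\<lambda>t. \<integral>\<^sup>+\<omega>. ennreal \<bar>u t x \<omega>\<bar> \<partial>M)"
    by blast
qed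

end
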